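(* Let $\mathbbm{k}$ be an algebraically closed field of characteristic $p>2$, $\zeta\in\mathbbm{k}$ a primitive fourth root of unity, $\zeta^{1/2}$ a square root of $\zeta$. Let $v=2a_1+a_0$ with $1\le a_1\le p-1$, $a_0\in\{0,1\}$, and let $\beta^2_{v-1,1}$ be the double braiding on $\mathbb{T}_\zeta(v-1)\otimes\mathbb{T}_\zeta(1)$ in $\mathbf{Tilt}/\mathbf J$. 1. If $a_0=0$, then $\beta^2_{v-1,1}=\zeta^{v-1}\,E_v+2\zeta^{v-2}\,L_v$. 2. If $a_0=1$, then $$\beta^2_{v-1,1}=\zeta^{v-1}E_v+\zeta^{v-3}A_v+\zeta^{v-3}\tilde A_v+2\zeta^{v-2}Y_v+\zeta^{v-1}B_v,$$ where the first term is omitted if $v=2p-1$ and the last term is omitted if $v=3$.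
   Context: The Temperley–Lieb category $\mathbf{TL}$ over $\mathbbm{k}$ has objects $n\in\mathbb{Z}_{\ge0}$; morphisms $m\to n$ are $\mathbbm{k}$-linear combinations of planar matchings ($m$ bottom points, $n$ top points), closed loops being replaced by $-(\zeta+\zeta^{-1})=0$. Composition is vertical stacking ($g\circ f$ has $g$ on top), $\otimes$ is juxtaposition, $1_n$ is the identity on $n$ strands, $\mathrm{cup}:0\to2$, $\mathrm{cap}:2\to0$; $\mathrm{cup}_2:0\to4$, $\mathrm{cap}_2:4\to0$ are two nested cups, resp. caps. The braiding is determined by: the crossing whose over-strand runs from bottom left to top right is $\beta_{1,1}=\zeta^{1/2}1_2+\zeta^{-1/2}\mathrm{cup}\circ\mathrm{cap}$. The double braiding is $\beta^2_{X,Y}=\beta_{Y,X}\circ\beta_{X,Y}$. For $1\le a\le p$, $E_{2a-1}\in\mathrm{End}(2a-1)$ is the Jones–Wenzl idempotent: the unique idempotent with coefficient $1$ on $1_{2a-1}$ annihilated by capping or cupping any two adjacent strands. For $1\le a\le p-1$, $E_{2a}=E_{2a-1}\otimes1_1$. $\mathbf{Tilt}$ is the additive and idempotent completion of $\mathbf{TL}$, $\mathbb{T}_\zeta(j)$ is the image of $E_j$, and $\mathbf J$ is the thick tensor ideal generated by the image of $E_{2p-1}$; in the ribbon category $\mathbf{Tilt}/\mathbf J$ morphisms factoring through objects of $\mathbf J$ are zero. For even $j=2a$, $1\le a\le p-1$: $L_j=E_j\circ(1_{j-2}\otimes\mathrm{cup}\circ\mathrm{cap})\circ E_j\in\mathrm{End}(\mathbb{T}_\zeta(j))$.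 For $v=2a_1+1$, put $P=E_{v-2}$ and define endomorphisms of $\mathbb{T}_\zeta(v-1)\otimes\mathbb{T}_\zeta(1)$: $$A_v=(P\otimes1_2)(1_{v-3}\otimes\mathrm{cup}\otimes1_1)P(1_{v-2}\otimes\mathrm{cap})(P\otimes1_2),$$ $$\tilde A_v=(P\otimes1_2)(1_{v-2}\otimes\mathrm{cup})P(1_{v-3}\otimes\mathrm{cap}\otimes1_1)(P\otimes1_2),$$ $$Y_v=(P\otimes1_2)(1_{v-3}\otimes\mathrm{cup}\otimes1_1)P(1_{v-3}\otimes\mathrm{cap}\otimes1_1)(P\otimes1_2),$$ $$B_v=-\tfrac{a_1-1}{a_1}(P\otimes1_2)(1_{v-4}\otimes\mathrm{cup}_2)E_{v-4}(1_{v-4}\otimes\mathrm{cap}_2)(P\otimes1_2)\quad(v>3).$$ *)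

theory Defs
  imports
    "HOL-Library.Poly_Mapping"
    "HOL-Library.Disjoint_Sets"
    "HOL-Computational_Algebra.Computational_Algebra"
begin

section \<open>Planar matchings\<close>

text \<open>A diagram from \<open>m\<close> to \<open>n\<close> lives in a horizontal strip with bottom points
  \<open>Bot 0, \<dots>, Bot (m - 1)\<close> and top points \<open>Top 0, \<dots>, Top (n - 1)\<close>, both numbered from left to
  right.  It is recorded as the set of its strands, a strand being the set of its two end points.\<close>

datatype pt = Bot nat | Top nat

type_synonym matching = "pt set set"

definition points :: "nat \<Rightarrow> nat \<Rightarrow> pt set" where
  "points m n = Bot ` {..<m} \<union> Top ` {..<n}"

text \<open>Cutting the boundary of the strip at its left end, one meets the top points from right to
  left and then the bottom points from left to right; \<open>boundary_pos\<close> increases along this walk.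
  Two strands cross iff their end points interleave.\<close>

fun boundary_pos :: "pt \<Rightarrow> int" where
  "boundary_pos (Bot i) = int i"
| "boundary_pos (Top j) = - 1 - int j"

definition noncrossing :: "matching \<Rightarrow> bool" where
  "noncrossing D \<longleftrightarrow>
     \<not> (\<exists>a b c d. {a, b} \<in> D \<and> {c, d} \<in> D \<and>
          boundary_pos a < boundary_pos c \<and> boundary_pos c < boundary_pos b \<and>
          boundary_pos b < boundary_pos d)"

definition planar_matchings :: "nat \<Rightarrow> nat \<Rightarrow> matching set" where
  "planar_matchings m n =
     {D. partition_on (points m n) D \<and> (\<forall>b\<in>D. card b = 2) \<and> noncrossing D}"

definition id_diag :: "nat \<Rightarrow> matching" where
  "id_diag n = {{Bot i, Top i} | i. i < n}"

text \<open>Stacking \<open>E\<close> on top of \<open>D\<close>: a point is given by its level (0 bottom, 1 middle, 2 top)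
  and its position.\<close>

fun lower :: "pt \<Rightarrow> nat \<times> nat" where
  "lower (Bot i) = (0, i)"
| "lower (Top j) = (1, j)"

fun upper :: "pt \<Rightarrow> nat \<times> nat" where
  "upper (Bot i) = (1, i)"
| "upper (Top j) = (2, j)"

fun outer :: "pt \<Rightarrow> nat \<times> nat" where
  "outer (Bot i) = (0, i)"
| "outer (Top j) = (2, j)"

definition glued :: "matching \<Rightarrow> matching \<Rightarrow> (nat \<times> nat) set set" where
  "glued E D = (`) upper ` E \<union> (`) lower ` D"

definition connected_pts :: "matching \<Rightarrow> matching \<Rightarrow> ((nat \<times> nat) \<times> (nat \<times> nat)) set" where
  "connected_pts E D = {(x, y). \<exists>b \<in> glued E D. x \<in> b \<and> y \<in> b}\<^sup>*"

definition stack :: "matching \<Rightarrow> matching \<Rightarrow> matching" where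
  "stack E D = {{x, y} | x y. x \<noteq> y \<and> (outer x, outer y) \<in> connected_pts E D}"

text \<open>The closed loops are the connected components all of whose points are in the middle.\<close>

definition loops :: "matching \<Rightarrow> matching \<Rightarrow> nat" where
  "loops E D = card {C. \<exists>x \<in> \<Union>(glued E D). C = connected_pts E D `` {x} \<and> C \<subseteq> {1} \<times> UNIV}"

definition bot_width :: "matching \<Rightarrow> nat" where
  "bot_width D = card {i. Bot i \<in> \<Union>D}"

definition top_width :: "matching \<Rightarrow> nat" where
  "top_width D = card {j. Top j \<in> \<Union>D}"

fun shift_pt :: "nat \<Rightarrow> nat \<Rightarrow> pt \<Rightarrow> pt" where
  "shift_pt m n (Bot i) = Bot (m + i)"
| "shift_pt m n (Top j) = Top (n + j)"

definition juxtapose :: "matching \<Rightarrow> matching \<Rightarrow> matching" where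
  "juxtapose D E = D \<union> (`) (shift_pt (bot_width D) (top_width D)) ` E"


section \<open>Morphisms of the Temperley--Lieb category\<close>

text \<open>Linear combinations of diagrams.  Composition and tensor product read off the sizes of the
  diagrams from the diagrams themselves; they are the operations of the category on composable
  elements of the sets \<open>Hom m n\<close>.\<close>

type_synonym 'k tl = "matching \<Rightarrow>\<^sub>0 'k"

definition Hom :: "nat \<Rightarrow> nat \<Rightarrow> 'k::field tl set" where
  "Hom m n = {f. Poly_Mapping.keys f \<subseteq> planar_matchings m n}"

definition scale :: "'k::field \<Rightarrow> 'k tl \<Rightarrow> 'k tl" (infixr \<open>\<cdot>\<close> 72) where
  "c \<cdot> f = Poly_Mapping.map ((*) c) f"

definition tensor :: "'k::field tl \<Rightarrow> 'k tl \<Rightarrow> 'k tl" (infixr \<open>\<otimes>\<close> 80) where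
  "f \<otimes> g = (\<Sum>D\<in>Poly_Mapping.keys f. \<Sum>E\<in>Poly_Mapping.keys g.
     Poly_Mapping.single (juxtapose D E) (Poly_Mapping.lookup f D * Poly_Mapping.lookup g E))"

definition id_tl :: "nat \<Rightarrow> 'k::field tl" where
  "id_tl n = Poly_Mapping.single (id_diag n) 1"

definition cup :: "'k::field tl" where
  "cup = Poly_Mapping.single {{Top 0, Top 1}} 1"

definition cap :: "'k::field tl" where
  "cap = Poly_Mapping.single {{Bot 0, Bot 1}} 1"

definition cup2 :: "'k::field tl" where
  "cup2 = Poly_Mapping.single {{Top 0, Top 3}, {Top 1, Top 2}} 1"

definition cap2 :: "'k::field tl" where
  "cap2 = Poly_Mapping.single {{Bot 0, Bot 3}, {Bot 1, Bot 2}} 1"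

text \<open>Matrices of morphisms, for the additive completion: the list \<open>ns\<close> stands for the formal
  direct sum of its entries, and a morphism \<open>\<Oplus>ns \<rightarrow> \<Oplus>ms\<close> has its component from the \<open>j\<close>-th to
  the \<open>i\<close>-th summand in row \<open>i\<close> and column \<open>j\<close>, and is \<open>0\<close> outside the matrix.  An object of the
  idempotent completion of the result is such a list with an idempotent matrix.\<close>

type_synonym 'k tlmat = "nat \<Rightarrow> nat \<Rightarrow> 'k tl"

type_synonym 'k tobj = "nat list \<times> 'k tlmat"

definition mats :: "nat list \<Rightarrow> nat list \<Rightarrow> 'k::field tlmat set" where
  "mats ns ms = {M. \<forall>i j. if i < length ms \<and> j < length ns then M i j \<in> Hom (ns ! j) (ms ! i)
                          else M i j = 0}"

definition single_mat :: "'k::field tl \<Rightarrow> 'k tlmat" where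
  "single_mat f = (\<lambda>i j. if i = 0 \<and> j = 0 then f else 0)"

text \<open>The summands of a tensor product are ordered lexicographically.  In the tensor product of two
  matrices, \<open>r\<close> and \<open>c\<close> are the numbers of rows and columns of the second one.\<close>

definition tensor_list :: "nat list \<Rightarrow> nat list \<Rightarrow> nat list" where
  "tensor_list ns ms = [n + m. n \<leftarrow> ns, m \<leftarrow> ms]"

definition tensor_mat :: "nat \<Rightarrow> nat \<Rightarrow> 'k::field tlmat \<Rightarrow> 'k tlmat \<Rightarrow> 'k tlmat" where
  "tensor_mat r c M N = (\<lambda>i j. M (i div r) (j div c) \<otimes> N (i mod r) (j mod c))"

definition tensor_obj :: "'k::field tobj \<Rightarrow> 'k tobj \<Rightarrow> 'k tobj" (infixr \<open>\<otimes>\<^sub>T\<close> 80) where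
  "X \<otimes>\<^sub>T Y = (tensor_list (fst X) (fst Y),
              tensor_mat (length (fst Y)) (length (fst Y)) (snd X) (snd Y))"

definition sum_obj :: "'k::field tobj \<Rightarrow> 'k tobj \<Rightarrow> 'k tobj" (infixr \<open>\<oplus>\<^sub>T\<close> 65) where
  "X \<oplus>\<^sub>T Y = (fst X @ fst Y,
     let l = length (fst X) in
     (\<lambda>i j. if i < l \<and> j < l then snd X i j
            else if l \<le> i \<and> l \<le> j then snd Y (i - l) (j - l) else 0))"


text \<open>Everything depending on the parameter \<open>\<zeta>\<close>, i.e. on the value \<open>- (\<zeta> + \<zeta>\<^sup>-\<^sup>1)\<close> of a closed
  loop.\<close>

locale TL =
  fixes \<zeta> :: "'k::field"
begin

definition comp :: "'k tl \<Rightarrow> 'k tl \<Rightarrow> 'k tl" (infixr \<open>\<odot>\<close> 75) where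
  "g \<odot> f = (\<Sum>E\<in>Poly_Mapping.keys g. \<Sum>D\<in>Poly_Mapping.keys f.
     Poly_Mapping.single (stack E D)
       (Poly_Mapping.lookup g E * Poly_Mapping.lookup f D * (- (\<zeta> + inverse \<zeta>)) ^ loops E D))"


section \<open>The braiding\<close>

text \<open>Here \<open>s\<close> is the chosen square root of \<open>\<zeta>\<close>.  The braiding \<open>m \<otimes> n \<rightarrow> n \<otimes> m\<close> is obtained
  from the crossing of two strands by the hexagon identities
  \<open>\<beta>\<^sub>X\<^sub>,\<^sub>Y\<^sub>Z = (1\<^sub>Y \<otimes> \<beta>\<^sub>X\<^sub>,\<^sub>Z) (\<beta>\<^sub>X\<^sub>,\<^sub>Y \<otimes> 1\<^sub>Z)\<close> and \<open>\<beta>\<^sub>X\<^sub>Y\<^sub>,\<^sub>Z = (\<beta>\<^sub>X\<^sub>,\<^sub>Z \<otimes> 1\<^sub>Y) (1\<^sub>X \<otimes> \<beta>\<^sub>Y\<^sub>,\<^sub>Z)\<close>.\<close>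

definition crossing :: "'k \<Rightarrow> 'k tl" where
  "crossing s = s \<cdot> id_tl 2 + inverse s \<cdot> (cup \<odot> cap)"

fun braid_one :: "'k \<Rightarrow> nat \<Rightarrow> 'k tl" where
  "braid_one s 0 = id_tl 1"
| "braid_one s (Suc n) = (id_tl n \<otimes> crossing s) \<odot> (braid_one s n \<otimes> id_tl 1)"

fun braid :: "'k \<Rightarrow> nat \<Rightarrow> nat \<Rightarrow> 'k tl" where
  "braid s 0 n = id_tl n"
| "braid s (Suc m) n = (braid s m n \<otimes> id_tl 1) \<odot> (id_tl m \<otimes> braid_one s n)"


section \<open>Jones--Wenzl idempotents and the endomorphisms built from them\<close>

definition is_JW :: "nat \<Rightarrow> 'k tl \<Rightarrow> bool" where
  "is_JW n e \<longleftrightarrow>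
     e \<in> Hom n n \<and> e \<odot> e = e \<and> Poly_Mapping.lookup e (id_diag n) = 1 \<and>
     (\<forall>i. i + 2 \<le> n \<longrightarrow>
        (id_tl i \<otimes> cap \<otimes> id_tl (n - 2 - i)) \<odot> e = 0 \<and>
        e \<odot> (id_tl i \<otimes> cup \<otimes> id_tl (n - 2 - i)) = 0)"

definition JW :: "nat \<Rightarrow> 'k tl" where
  "JW n = (THE e. is_JW n e)"

text \<open>The idempotent \<open>E j\<close> is only meaningful for \<open>1 \<le> j \<le> 2p - 1\<close>, \<open>p\<close> being the
  characteristic.\<close>

definition E :: "nat \<Rightarrow> 'k tl" where
  "E j = (if odd j then JW j else JW (j - 1) \<otimes> id_tl 1)"

definition L :: "nat \<Rightarrow> 'k tl" where
  "L j = E j \<odot> (id_tl (j - 2) \<otimes> (cup \<odot> cap)) \<odot> E j"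

definition A :: "nat \<Rightarrow> 'k tl" where
  "A v = (let P = E (v - 2) in
     (P \<otimes> id_tl 2) \<odot> (id_tl (v - 3) \<otimes> cup \<otimes> id_tl 1) \<odot> P \<odot> (id_tl (v - 2) \<otimes> cap) \<odot>
     (P \<otimes> id_tl 2))"

definition A_tilde :: "nat \<Rightarrow> 'k tl" where
  "A_tilde v = (let P = E (v - 2) in
     (P \<otimes> id_tl 2) \<odot> (id_tl (v - 2) \<otimes> cup) \<odot> P \<odot> (id_tl (v - 3) \<otimes> cap \<otimes> id_tl 1) \<odot>
     (P \<otimes> id_tl 2))"

definition Y :: "nat \<Rightarrow> 'k tl" where
  "Y v = (let P = E (v - 2) in
     (P \<otimes> id_tl 2) \<odot> (id_tl (v - 3) \<otimes> cup \<otimes> id_tl 1) \<odot> P \<odot>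
     (id_tl (v - 3) \<otimes> cap \<otimes> id_tl 1) \<odot> (P \<otimes> id_tl 2))"

definition B :: "nat \<Rightarrow> 'k tl" where
  "B v = (let P = E (v - 2); a = (v - 1) div 2 in
     (- (of_nat (a - 1) / of_nat a)) \<cdot>
     ((P \<otimes> id_tl 2) \<odot> (id_tl (v - 4) \<otimes> cup2) \<odot> E (v - 4) \<odot> (id_tl (v - 4) \<otimes> cap2) \<odot>
      (P \<otimes> id_tl 2)))"


section \<open>The additive and idempotent completion\<close>

text \<open>Composition of matrices; the list in the middle is the object composed over.\<close>

definition mat_comp :: "'k tlmat \<Rightarrow> nat list \<Rightarrow> 'k tlmat \<Rightarrow> 'k tlmat" where
  "mat_comp N ns M = (\<lambda>i j. \<Sum>k<length ns. N i k \<odot> M k j)"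

definition Tilt :: "'k tobj set" where
  "Tilt = {(ns, e). e \<in> mats ns ns \<and> mat_comp e ns e = e}"

definition THom :: "'k tobj \<Rightarrow> 'k tobj \<Rightarrow> 'k tlmat set" where
  "THom X Z = {M \<in> mats (fst X) (fst Z).
     mat_comp (snd Z) (fst Z) (mat_comp M (fst X) (snd X)) = M}"

definition TComp :: "'k tlmat \<Rightarrow> 'k tobj \<Rightarrow> 'k tlmat \<Rightarrow> 'k tlmat" where
  "TComp N X M = mat_comp N (fst X) M"

definition T :: "nat \<Rightarrow> 'k tobj" where
  "T j = ([j], single_mat (E j))"

text \<open>The braiding of the formal direct sums of \<open>ns\<close> and \<open>ms\<close>: the summand \<open>ns ! a \<otimes> ms ! b\<close> has
  index \<open>a * length ms + b\<close> in the source, and \<open>ms ! b \<otimes> ns ! a\<close> has index \<open>b * length ns + a\<close> in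
  the target.\<close>

definition braid_mat :: "'k \<Rightarrow> nat list \<Rightarrow> nat list \<Rightarrow> 'k tlmat" where
  "braid_mat s ns ms = (\<lambda>i j.
     let a = j div length ms; b = j mod length ms in
     if j < length ns * length ms \<and> i = b * length ns + a then braid s (ns ! a) (ms ! b) else 0)"

definition TBraid :: "'k \<Rightarrow> 'k tobj \<Rightarrow> 'k tobj \<Rightarrow> 'k tlmat" where
  "TBraid s X Z =
     TComp (snd (Z \<otimes>\<^sub>T X)) (Z \<otimes>\<^sub>T X)
       (TComp (braid_mat s (fst X) (fst Z)) (X \<otimes>\<^sub>T Z) (snd (X \<otimes>\<^sub>T Z)))"

definition double_braiding :: "'k \<Rightarrow> 'k tobj \<Rightarrow> 'k tobj \<Rightarrow> 'k tlmat" where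
  "double_braiding s X Z = TComp (TBraid s Z X) (Z \<otimes>\<^sub>T X) (TBraid s X Z)"


section \<open>The quotient by the thick tensor ideal\<close>

text \<open>The rule \<open>summand\<close> includes closure under isomorphism.\<close>

inductive_set J :: "nat \<Rightarrow> 'k tobj set" for p :: nat where
  generator: "T (2 * p - 1) \<in> J p"
| tensor_right: "X \<in> J p \<Longrightarrow> Z \<in> Tilt \<Longrightarrow> X \<otimes>\<^sub>T Z \<in> J p"
| tensor_left: "X \<in> J p \<Longrightarrow> Z \<in> Tilt \<Longrightarrow> Z \<otimes>\<^sub>T X \<in> J p"
| direct_sum: "X \<in> J p \<Longrightarrow> Z \<in> J p \<Longrightarrow> X \<oplus>\<^sub>T Z \<in> J p"
| summand: "X \<in> J p \<Longrightarrow> Z \<in> Tilt \<Longrightarrow> r \<in> THom X Z \<Longrightarrow> i \<in> THom Z X \<Longrightarrow>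
    TComp r X i = snd Z \<Longrightarrow> Z \<in> J p"

definition factors_through_J :: "nat \<Rightarrow> 'k tobj \<Rightarrow> 'k tobj \<Rightarrow> 'k tlmat \<Rightarrow> bool" where
  "factors_through_J p X Z f \<longleftrightarrow>
     (\<exists>W \<in> J p. \<exists>g \<in> THom X W. \<exists>h \<in> THom W Z. f = TComp h W g)"

text \<open>Equality in \<open>Tilt/J\<close> of the classes of two morphisms \<open>X \<rightarrow> Z\<close> of \<open>Tilt\<close>.\<close>

definition eq_mod_J :: "nat \<Rightarrow> 'k tobj \<Rightarrow> 'k tobj \<Rightarrow> 'k tlmat \<Rightarrow> 'k tlmat \<Rightarrow> bool" where
  "eq_mod_J p X Z f g \<longleftrightarrow> factors_through_J p X Z (\<lambda>i j. f i j - g i j)"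

end

end

theory Submission
  imports Defs
begin

text \<open>Closed loops have value \<open>0\<close>, so a composite of diagrams is a diagram or \<open>0\<close>.  Put
  \<open>U\<^sub>i = cup\<^sub>i \<circ> cap\<^sub>i\<close>, so that a crossing is \<open>\<sigma>\<^sub>i = s + s\<^sup>-\<^sup>1 U\<^sub>i\<close>.  The double braiding of \<open>n\<close> strands with
  one strand is the Jucys--Murphy element \<open>J\<^sub>n = \<sigma>\<^sub>n\<^sub>-\<^sub>1 \<dots> \<sigma>\<^sub>0 \<sigma>\<^sub>0 \<dots> \<sigma>\<^sub>n\<^sub>-\<^sub>1\<close>, for which
  \<open>J\<^sub>n\<^sub>+\<^sub>1 = \<zeta> J\<^sub>n + U\<^sub>n J\<^sub>n + J\<^sub>n U\<^sub>n + \<zeta>\<^sup>-\<^sup>1 U\<^sub>n J\<^sub>n U\<^sub>n\<close>.  Between two copies of a Jones--Wenzl idempotent \<open>P\<close> the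
  element \<open>J\<^sub>n\<close> becomes a scalar as long as it only involves strands of \<open>P\<close>, and \<open>U\<^sub>n J\<^sub>n U\<^sub>n\<close> is a partial trace
  that satisfies a linear recursion.  With one strand more than \<open>P\<close> this gives the even case.  With
  two more strands it gives
  \<open>\<zeta>\<^sup>v\<^sup>-\<^sup>1 (P + 2\<zeta>\<^sup>-\<^sup>1 P U\<^sub>v\<^sub>-\<^sub>3 P - 2 P U\<^sub>v\<^sub>-\<^sub>3 U\<^sub>v\<^sub>-\<^sub>2 P - 2 P U\<^sub>v\<^sub>-\<^sub>2 U\<^sub>v\<^sub>-\<^sub>3 P)\<close>; here \<open>Y\<^sub>v = P U\<^sub>v\<^sub>-\<^sub>3 P\<close>, because \<open>U\<^sub>v\<^sub>-\<^sub>4\<close> has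
  coefficient \<open>0\<close> in the middle idempotent, and \<open>P = E\<^sub>v + A\<^sub>v + A'\<^sub>v + B\<^sub>v\<close> (with \<open>A'\<close> for
  \<open>A_tilde\<close>) is a recursion for the idempotents themselves.  So the equation holds before passing to
  the quotient, up to the term \<open>E\<^sub>v\<close> for \<open>v = 2p - 1\<close>, which is the identity of the generator of \<open>J\<close>.\<close>

text \<open>\<open>stack\<close> is defined through connected components, so a composite of planar
  matchings is not visibly planar. This is settled by generators: an innermost cup or cap can be
  split off from any planar matching, and a cap on top of a cup closes a loop, straightens, or
  slides past it. Associativity is read off from connectivity in three stacked diagrams. The
  remaining calculation takes place in an abstract ring with the relations of the
  \<open>U_i\<close>. There \<open>\<zeta>^2 = -1\<close> acts twice through the identity
  \<open>2 \<zeta>^n + \<zeta>^(-1) 2 \<zeta>^(n-1) = 0\<close>: it makes the partial trace of the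
  Jucys--Murphy element on an even number of strands vanish next to \<open>P\<close>, and it removes
  the multiple of \<open>P U_(v-2)\<close> for odd \<open>v\<close>. The coefficient in
  \<open>B_v\<close> is, with \<open>a_1 = b + 1\<close>, the value of \<open>[2b]/[2b+2]\<close>
  obtained as a limit at a fourth root of unity; it is what lets the partial trace of
  \<open>P\<close> cancel in the proof that the next generator kills the next idempotent. The
  characteristic enters through the invertibility of \<open>1, ..., a_1\<close>.\<close>

section \<open>Connectivity\<close>

text \<open>A segment of the path inside \<open>S\<close> with both ends in the range of \<open>g\<close> is replaced by a segment
  inside \<open>ss\<close>.\<close>

lemma rtrancl_compress:
  assumes "inj g" and ss: "\<And>x y. (x, y) \<in> ss\<^sup>* \<longleftrightarrow> (g x, g y) \<in> S\<^sup>*"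
  shows "(x, y) \<in> (rr \<union> ss)\<^sup>* \<longleftrightarrow> (g x, g y) \<in> (map_prod g g ` rr \<union> S)\<^sup>*"
proof
  assume "(x, y) \<in> (rr \<union> ss)\<^sup>*"
  then show "(g x, g y) \<in> (map_prod g g ` rr \<union> S)\<^sup>*"
  proof (induction rule: rtrancl_induct)
    case (step y z)
    have "(g y, g z) \<in> (map_prod g g ` rr \<union> S)\<^sup>*"
    proof (cases "(y, z) \<in> rr")
      case True
      then show ?thesis by (intro r_into_rtrancl) (auto intro!: image_eqI)
    next
      case False
      then have "(g y, g z) \<in> S\<^sup>*" using step(2) ss by blast
      then show ?thesis using rtrancl_mono[of S "map_prod g g ` rr \<union> S"] by auto
    qed
    then show ?case using step(3) by auto
  qed auto
next
  have mono: "rr\<^sup>* \<subseteq> (rr \<union> ss)\<^sup>*" "ss\<^sup>* \<subseteq> (rr \<union> ss)\<^sup>*" by (auto intro!: rtrancl_mono)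
  \<comment> \<open>Invariant for a path that may leave the range of \<open>g\<close>: its end is
    tied inside \<open>S\<close> to the image of some \<open>w\<close> already reachable from
    \<open>x\<close>.\<close>
  have "\<exists>w. (x, w) \<in> (rr \<union> ss)\<^sup>* \<and> (g w, z) \<in> S\<^sup>*" if "(g x, z) \<in> (map_prod g g ` rr \<union> S)\<^sup>*" for z
    using that
  proof (induction rule: rtrancl_induct)
    case (step y z)
    then obtain w where w: "(x, w) \<in> (rr \<union> ss)\<^sup>*" "(g w, y) \<in> S\<^sup>*" by auto
    show ?case
    proof (cases "(y, z) \<in> S")
      case True
      then show ?thesis using w by (meson rtrancl.rtrancl_into_rtrancl)
    next
      case False
      then obtain a b where ab: "y = g a" "z = g b" "(a, b) \<in> rr" using step(2) by auto
      have "(w, a) \<in> (rr \<union> ss)\<^sup>*" using w(2) ab ss mono by blast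
      then have "(x, b) \<in> (rr \<union> ss)\<^sup>*" using w(1) ab(3)
        by (meson UnI1 rtrancl.rtrancl_into_rtrancl rtrancl_trans)
      then show ?thesis using ab by auto
    qed
  qed auto
  moreover assume "(g x, g y) \<in> (map_prod g g ` rr \<union> S)\<^sup>*"
  ultimately obtain w where "(x, w) \<in> (rr \<union> ss)\<^sup>*" "(g w, g y) \<in> S\<^sup>*" by blast
  then show "(x, y) \<in> (rr \<union> ss)\<^sup>*" using ss mono by (meson rtrancl_trans subsetD)
qed

lemma rtrancl_map_prod_iff:
  assumes "inj g"
  shows "(g x, g y) \<in> (map_prod g g ` R)\<^sup>* \<longleftrightarrow> (x, y) \<in> R\<^sup>*"
  using rtrancl_compress[OF assms, of "{}" "{}" x y R] assms by (simp add: inj_eq)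

lemma rtrancl_cases_Field:
  assumes "(x, y) \<in> R\<^sup>*" obtains "x = y" | "x \<in> Domain R" "y \<in> Range R"
  using assms by (metis DomainI RangeI converse_rtranclE rtranclE)

text \<open>The path is cut where it first uses \<open>R\<close>; up to that point it stays inside
  \<open>S\<close>.\<close>

lemma rtrancl_Un_first:
  assumes "(x, y) \<in> (R \<union> S)\<^sup>*"
  shows "(x, y) \<in> S\<^sup>* \<or> (\<exists>z\<in>Domain R. (x, z) \<in> S\<^sup>*)"
  using assms by (induction rule: rtrancl_induct) (auto intro: rtrancl_into_rtrancl)

lemma rtrancl_Un_disjoint:
  assumes "Field R \<inter> Field S = {}"
  shows "(R \<union> S)\<^sup>* = R\<^sup>* \<union> S\<^sup>*"
proof
  have "(x, y) \<in> R\<^sup>* \<union> S\<^sup>*" if "(x, y) \<in> (R \<union> S)\<^sup>*" for x y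
    using that
  proof (induction rule: rtrancl_induct)
    case (step y z)
    consider "x = y" | "(x, y) \<in> R\<^sup>*" "y \<in> Field R" | "(x, y) \<in> S\<^sup>*" "y \<in> Field S"
      using step(3) by (meson FieldI2 UnE rtranclE)
    then show ?case
    proof cases
      case 1 then show ?thesis using step by auto
    next
      case 2
      then have "(y, z) \<in> R" using step(2) assms by (auto simp: Field_def)
      then show ?thesis using 2 by (auto intro: rtrancl_into_rtrancl)
    next
      case 3
      then have "(y, z) \<in> S" using step(2) assms by (auto simp: Field_def)
      then show ?thesis using 3 by (auto intro: rtrancl_into_rtrancl)
    qed
  qed auto
  then show "(R \<union> S)\<^sup>* \<subseteq> R\<^sup>* \<union> S\<^sup>*" by auto
qed (auto intro: rtrancl_mono[THEN subsetD])

section \<open>Sets of blocks as relations, and diagrams placed on levels\<close>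

definition block_rel :: "'a set set \<Rightarrow> 'a rel" where
  "block_rel B = {(x, y). \<exists>b\<in>B. x \<in> b \<and> y \<in> b}"

lemma block_rel_Un: "block_rel (A \<union> B) = block_rel A \<union> block_rel B"
  by (auto simp: block_rel_def)

lemma block_rel_image: "block_rel ((`) f ` B) = map_prod f f ` block_rel B"
  by (force simp: block_rel_def)

lemma sym_block_rel: "sym (block_rel B)"
  by (auto simp: block_rel_def sym_def)

lemma Field_block_rel: "Field (block_rel B) = \<Union>B"
  by (auto simp: block_rel_def Field_def)

lemma Domain_block_rel: "Domain (block_rel B) = \<Union>B"
  by (auto simp: block_rel_def)

lemma Range_block_rel: "Range (block_rel B) = \<Union>B"
  by (auto simp: block_rel_def)

lemma rtrancl_block_rel_sym: "(x, y) \<in> (block_rel B)\<^sup>* \<Longrightarrow> (y, x) \<in> (block_rel B)\<^sup>*"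
  by (metis symD sym_block_rel sym_rtrancl)

lemma rtrancl_block_rel_Union: "(x, y) \<in> (block_rel B)\<^sup>* \<Longrightarrow> x \<in> \<Union>B \<Longrightarrow> y \<in> \<Union>B"
  by (metis Range_block_rel rtrancl_cases_Field)

lemma rtrancl_block_rel_outside:
  "x \<notin> \<Union>B \<or> y \<notin> \<Union>B \<Longrightarrow> (x, y) \<in> (block_rel B)\<^sup>* \<longleftrightarrow> x = y"
  by (metis Range_block_rel Domain_block_rel rtrancl.rtrancl_refl rtrancl_cases_Field)

text \<open>Common form of \<open>lower\<close>, \<open>upper\<close> and \<open>outer\<close> (see
  \<open>lev_abbrevs\<close>), which also provides the levels 2 and 3 needed for three stacked
  diagrams.\<close>

fun lev :: "nat \<Rightarrow> nat \<Rightarrow> pt \<Rightarrow> nat \<times> nat" where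
  "lev i j (Bot k) = (i, k)"
| "lev i j (Top k) = (j, k)"

lemma inj_lev: "i \<noteq> j \<Longrightarrow> inj (lev i j)"
  by (rule injI, elim lev.elims) auto

lemma fst_lev: "fst (lev i j x) = (case x of Bot _ \<Rightarrow> i | Top _ \<Rightarrow> j)"
  by (cases x) auto

lemma lev_abbrevs: "lower = lev 0 1" "upper = lev 1 2" "outer = lev 0 2"
  by (rule ext, case_tac x, simp_all)+

lemma range_lev: "range (lev i j) = {i, j} \<times> UNIV"
proof (intro set_eqI iffI)
  fix y :: "nat \<times> nat" assume "y \<in> {i, j} \<times> UNIV"
  then show "y \<in> range (lev i j)"
    by (cases y) (metis SigmaE2 insertE lev.simps rangeI singletonD)
qed (auto simp: mem_Times_iff fst_lev split: pt.split)

lemma connected_pts_block_rel: "connected_pts E D = (block_rel (glued E D))\<^sup>*"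
  by (simp add: connected_pts_def block_rel_def)

lemma connected_pts_sym: "(x, y) \<in> connected_pts E D \<Longrightarrow> (y, x) \<in> connected_pts E D"
  by (simp add: connected_pts_block_rel rtrancl_block_rel_sym)

lemma connected_pts_trans:
  "(x, y) \<in> connected_pts E D \<Longrightarrow> (y, z) \<in> connected_pts E D \<Longrightarrow> (x, z) \<in> connected_pts E D"
  by (auto simp: connected_pts_def)

lemma doubleton_in_stack_iff:
  "{x, y} \<in> stack E D \<longleftrightarrow> x \<noteq> y \<and> (outer x, outer y) \<in> connected_pts E D"
  by (auto simp: stack_def doubleton_eq_iff intro: connected_pts_sym)

text \<open>\<open>stack\<close> joins every pair of connected outer points, so taking the
  transitive closure adds nothing.\<close>

lemma rtrancl_block_rel_stack:
  "(x, y) \<in> (block_rel (stack E D))\<^sup>* \<longleftrightarrow> (outer x, outer y) \<in> connected_pts E D"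
proof
  assume "(x, y) \<in> (block_rel (stack E D))\<^sup>*"
  then show "(outer x, outer y) \<in> connected_pts E D"
  proof (induction rule: rtrancl_induct)
    case base
    then show ?case by (simp add: connected_pts_def)
  next
    case (step y z)
    then obtain a b where ab: "(outer a, outer b) \<in> connected_pts E D" "y \<in> {a, b}" "z \<in> {a, b}"
      by (auto simp: block_rel_def stack_def)
    then have "(outer y, outer z) \<in> connected_pts E D"
      by (auto simp: connected_pts_def intro: connected_pts_sym[unfolded connected_pts_def])
    then show ?case using step(3) connected_pts_trans by blast
  qed
next
  assume "(outer x, outer y) \<in> connected_pts E D"
  then have "x = y \<or> {x, y} \<in> stack E D" by (auto simp: doubleton_in_stack_iff)
  then show "(x, y) \<in> (block_rel (stack E D))\<^sup>*"
  proof
    assume "{x, y} \<in> stack E D"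
    then have "(x, y) \<in> block_rel (stack E D)" unfolding block_rel_def by blast
    then show ?thesis by (rule r_into_rtrancl)
  qed simp
qed

definition glued3 :: "matching \<Rightarrow> matching \<Rightarrow> matching \<Rightarrow> (nat \<times> nat) set set" where
  "glued3 F E D = (`) (lev 2 3) ` F \<union> ((`) (lev 1 2) ` E \<union> (`) (lev 0 1) ` D)"

text \<open>The levels \<open>0, 1, 2\<close> of \<open>F\<close> over \<open>stack E D\<close> are the levels \<open>0, 2, 3\<close> of three stacked
  diagrams.\<close>

definition skip1 :: "nat \<times> nat \<Rightarrow> nat \<times> nat" where
  "skip1 x = (if fst x = 0 then 0 else fst x + 1, snd x)"

lemma inj_skip1: "inj skip1"
  by (rule injI) (auto simp: skip1_def prod_eq_iff split: if_splits)

lemma skip1_lev: "skip1 \<circ> lev 1 2 = lev 2 3" "skip1 (lev 0 1 x) = lev 0 2 x"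
  by (rule ext, case_tac x, simp_all add: skip1_def) (cases x, simp_all add: skip1_def)

lemma skip1_upper: "skip1 (upper x) = lev 2 3 x"
  by (cases x) (auto simp: skip1_def)

lemma fst_skip1: "fst (skip1 x) \<in> {1, 2} \<longleftrightarrow> fst x = 1"
  by (auto simp: skip1_def)

lemma range_skip1: "fst x \<noteq> 1 \<Longrightarrow> x \<in> range skip1"
  by (rule image_eqI[where x = "(if fst x = 0 then 0 else fst x - 1, snd x)"])
    (auto simp: skip1_def prod_eq_iff)

text \<open>An instance of \<open>rtrancl_compress\<close>: walking along a strand of
  \<open>stack E D\<close> amounts to walking through \<open>glued E D\<close> between two outer
  points, and \<open>skip1\<close> makes room for the hidden level.\<close>

lemma connected_stack_right:
  "(x, y) \<in> connected_pts F (stack E D) \<longleftrightarrow> (skip1 x, skip1 y) \<in> (block_rel (glued3 F E D))\<^sup>*"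
proof -
  have ss: "(x, y) \<in> (block_rel ((`) lower ` stack E D))\<^sup>* \<longleftrightarrow>
        (skip1 x, skip1 y) \<in> (block_rel (glued E D))\<^sup>*" for x y
  proof (cases "fst x \<le> 1 \<and> fst y \<le> 1")
    case True
    then have "x \<in> range lower" "y \<in> range lower" unfolding lev_abbrevs range_lev
      by (auto simp: mem_Times_iff)
    then obtain a b where "x = lower a" "y = lower b" by auto
    then show ?thesis
      by (simp add: block_rel_image lev_abbrevs rtrancl_map_prod_iff[OF inj_lev] skip1_lev
          rtrancl_block_rel_stack connected_pts_block_rel del: One_nat_def)
  next
    \<comment> \<open>A node above level 1 lies on no strand of either diagram, so both closures
      reduce to equality there.\<close>
    case False
    have 1: "\<Union>((`) lower ` stack E D) \<subseteq> {x. fst x \<le> 1}"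
      by (auto simp: lev_abbrevs fst_lev split: pt.split simp del: One_nat_def split_paired_All)
    have 2: "\<Union>(glued E D) \<subseteq> {x. fst x \<le> 2}"
      by (auto simp: glued_def lev_abbrevs fst_lev split: pt.split)
    have *: "z \<notin> \<Union>((`) lower ` stack E D) \<and> skip1 z \<notin> \<Union>(glued E D)" if "\<not> fst z \<le> 1" for z
      using that 1 2 by (force simp: skip1_def)
    have "(x, y) \<in> (block_rel ((`) lower ` stack E D))\<^sup>* \<longleftrightarrow> x = y"
      "(skip1 x, skip1 y) \<in> (block_rel (glued E D))\<^sup>* \<longleftrightarrow> skip1 x = skip1 y"
      using False *[of x] *[of y] rtrancl_block_rel_outside by metis+
    then show ?thesis using inj_skip1 by (simp add: inj_eq)
  qed
  have "(`) (lev 2 3) ` F = (`) skip1 ` (`) upper ` F"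
    by (simp add: image_image skip1_upper)
  then have "block_rel (glued3 F E D) =
      map_prod skip1 skip1 ` block_rel ((`) upper ` F) \<union> block_rel (glued E D)"
    by (simp add: glued3_def glued_def block_rel_Un lev_abbrevs block_rel_image[of skip1] del: One_nat_def)
  then show ?thesis
    using rtrancl_compress[OF inj_skip1 ss, of x y "block_rel ((`) upper ` F)"]
    by (simp add: connected_pts_block_rel glued_def[of F] block_rel_Un)
qed

section \<open>Absence of closed loops\<close>

definition no_loop :: "matching \<Rightarrow> matching \<Rightarrow> bool" where
  "no_loop E D \<longleftrightarrow> (\<forall>x\<in>\<Union>(glued E D). \<exists>y. (x, y) \<in> connected_pts E D \<and> fst y \<noteq> 1)"

definition no_loop3 :: "matching \<Rightarrow> matching \<Rightarrow> matching \<Rightarrow> bool" where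
  "no_loop3 F E D \<longleftrightarrow>
     (\<forall>x\<in>\<Union>(glued3 F E D). \<exists>y. (x, y) \<in> (block_rel (glued3 F E D))\<^sup>* \<and> fst y \<notin> {1, 2})"

text \<open>Finiteness excludes an infinite set of loops, whose cardinality would be 0 by default;
  \<open>no_loop\<close> does not have this defect and is used from here on.\<close>

lemma loops_eq_0_iff:
  assumes "finite (\<Union>(glued E D))"
  shows "loops E D = 0 \<longleftrightarrow> no_loop E D"
proof -
  let ?S = "{C. \<exists>x \<in> \<Union>(glued E D). C = connected_pts E D `` {x} \<and> C \<subseteq> {1} \<times> UNIV}"
  have "finite ?S" by (rule finite_subset[OF _ finite_imageI[OF assms]]) auto
  then have "loops E D = 0 \<longleftrightarrow> ?S = {}" by (simp add: loops_def)
  also have "\<dots> \<longleftrightarrow> (\<forall>x\<in>\<Union>(glued E D). \<not> connected_pts E D `` {x} \<subseteq> {1} \<times> UNIV)" by blast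
  also have "\<dots> \<longleftrightarrow> no_loop E D" unfolding no_loop_def by (intro ball_cong) (auto simp: subset_iff)
  finally show ?thesis .
qed

text \<open>A closed component of three stacked diagrams either stays at level 1, where it is a loop
  of \<open>E\<close> over \<open>D\<close>, or it meets level 2, where it is a loop of
  \<open>F\<close> over \<open>stack E D\<close>. By \<open>cover\<close> every point at level 2 is
  an end point of \<open>F\<close>, hence visible to the second condition.\<close>

lemma no_loop3_right:
  assumes cover: "\<And>k. Top k \<in> \<Union>E \<Longrightarrow> Bot k \<in> \<Union>F"
  shows "no_loop3 F E D \<longleftrightarrow> no_loop E D \<and> no_loop F (stack E D)"
proof
  let ?T = "(block_rel (glued3 F E D))\<^sup>*"
  assume nl: "no_loop3 F E D"
  show "no_loop E D \<and> no_loop F (stack E D)"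
  proof
    show "no_loop E D" unfolding no_loop_def
    proof
      fix x assume x: "x \<in> \<Union>(glued E D)"
      then have "x \<in> \<Union>(glued3 F E D)" by (auto simp: glued_def glued3_def lev_abbrevs)
      then obtain y where y: "(x, y) \<in> ?T" "fst y \<notin> {1, 2}" using nl unfolding no_loop3_def by blast
      have "block_rel (glued3 F E D) = block_rel ((`) (lev 2 3) ` F) \<union> block_rel (glued E D)"
        by (simp add: glued3_def glued_def lev_abbrevs block_rel_Un)
      \<comment> \<open>Either the path stays in \<open>glued E D\<close>, or it first meets
        \<open>F\<close> at level 2 or 3; in both cases level 1 has been left.\<close>
      from rtrancl_Un_first[OF y(1)[unfolded this]]
      have "\<exists>z. (x, z) \<in> connected_pts E D \<and> (z = y \<or> z \<in> range (lev 2 3))"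
        unfolding connected_pts_block_rel Domain_block_rel by blast
      then show "\<exists>y. (x, y) \<in> connected_pts E D \<and> fst y \<noteq> 1"
        using y(2) by (force simp: range_lev)
    qed
    show "no_loop F (stack E D)" unfolding no_loop_def
    proof
      fix x assume x: "x \<in> \<Union>(glued F (stack E D))"
      show "\<exists>y. (x, y) \<in> connected_pts F (stack E D) \<and> fst y \<noteq> 1"
      proof (cases "fst x = 1")
        case False
        then show ?thesis by (intro exI[of _ x]) (simp add: connected_pts_def)
      next
        case True
        have "skip1 x \<in> \<Union>(glued3 F E D)"
        proof (cases "x \<in> \<Union>((`) upper ` F)")
          case True
          then show ?thesis by (auto simp: glued3_def lev_abbrevs simp flip: skip1_lev(1))
        next
          case False
          then obtain b z where b: "b \<in> stack E D" "z \<in> b" "x = lower z" using x by (auto simp: glued_def)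
          from b(1) obtain u w where uw: "b = {u, w}" "u \<noteq> w" "(outer u, outer w) \<in> connected_pts E D"
            unfolding stack_def by blast
          \<comment> \<open>A strand has two different ends, so \<open>outer z\<close> is not
            isolated and must lie on a strand of \<open>E\<close> or \<open>D\<close>.\<close>
          then obtain z' where "z \<noteq> z'" "(outer z, outer z') \<in> connected_pts E D"
            using b(2) by (metis connected_pts_sym insertE singletonD)
          then have "outer z \<in> \<Union>(glued E D)"
            using inj_lev[of 0 2] rtrancl_block_rel_outside
            by (metis connected_pts_block_rel injD lev_abbrevs(3) zero_neq_numeral)
          then show ?thesis using b(3)
            by (auto simp: glued3_def glued_def lev_abbrevs skip1_lev simp del: One_nat_def)
        qed
        then obtain y where y: "(skip1 x, y) \<in> ?T" "fst y \<notin> {1, 2}" using nl unfolding no_loop3_def by blast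
        then have "y \<in> range skip1" by (intro range_skip1) auto
        then obtain y' where "y = skip1 y'" by blast
        then show ?thesis using y fst_skip1[of y'] by (intro exI[of _ y']) (simp add: connected_stack_right)
      qed
    qed
  qed
next
  let ?T = "(block_rel (glued3 F E D))\<^sup>*"
  assume nl: "no_loop E D \<and> no_loop F (stack E D)"
  \<comment> \<open>Points at level 2 come first, since a path leaving level 1 may end at level 2
    and then has to be prolonged.\<close>
  have two: "\<exists>y. (x, y) \<in> ?T \<and> fst y \<notin> {1, 2}" if x: "x \<in> \<Union>(glued3 F E D)" "fst x = 2" for x
  proof -
    have "x \<in> \<Union>((`) (lev 2 3) ` F)"
    proof (rule ccontr)
      assume "x \<notin> \<Union>((`) (lev 2 3) ` F)"
      then have "x \<in> \<Union>((`) (lev 1 2) ` E)" using x by (auto simp: glued3_def fst_lev split: pt.splits)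
      then obtain z where z: "z \<in> \<Union>E" "x = lev 1 2 z" by auto
      then have "z = Top (snd x)" using x(2) by (cases z) auto
      then have "Bot (snd x) \<in> \<Union>F" using z cover by auto
      then have "lev 2 3 (Bot (snd x)) \<in> \<Union>((`) (lev 2 3) ` F)" by blast
      then show False using \<open>x \<notin> _\<close> x(2) by (metis lev.simps(1) prod.collapse)
    qed
    then obtain z where "z \<in> \<Union>F" "x = lev 2 3 z" by blast
    then have "upper z \<in> \<Union>((`) upper ` F)" "x = skip1 (upper z)" by (auto simp: skip1_upper)
    then obtain x' where x': "x' \<in> \<Union>((`) upper ` F)" "x = skip1 x'" by blast
    then have "x' \<in> \<Union>(glued F (stack E D))" by (auto simp: glued_def)
    then obtain y' where "(x', y') \<in> connected_pts F (stack E D)" "fst y' \<noteq> 1"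
      using nl unfolding no_loop_def by meson
    then show ?thesis using x' fst_skip1[of y'] by (intro exI[of _ "skip1 y'"]) (simp add: connected_stack_right)
  qed
  show "no_loop3 F E D" unfolding no_loop3_def
  proof
    fix x assume x: "x \<in> \<Union>(glued3 F E D)"
    consider "fst x \<notin> {1, 2}" | "fst x = 2" | "fst x = 1" by auto
    then show "\<exists>y. (x, y) \<in> ?T \<and> fst y \<notin> {1, 2}"
    proof cases
      case 3
      then have "x \<in> \<Union>(glued E D)" using x by (auto simp: glued3_def glued_def lev_abbrevs fst_lev split: pt.splits)
      then obtain y where y: "(x, y) \<in> connected_pts E D" "fst y \<noteq> 1" using nl unfolding no_loop_def by meson
      have "connected_pts E D \<subseteq> ?T" unfolding connected_pts_block_rel
        by (rule rtrancl_mono) (auto simp: block_rel_def glued3_def glued_def lev_abbrevs)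
      then have y': "(x, y) \<in> ?T" using y by auto
      show ?thesis
      proof (cases "fst y = 2")
        case False
        then show ?thesis using y y' by (intro exI[of _ y]) simp
      next
        case True
        then obtain z where "(y, z) \<in> ?T" "fst z \<notin> {1, 2}"
          using two[of y] rtrancl_block_rel_Union[OF y' x] by meson
        then show ?thesis using y' by (meson rtrancl_trans)
      qed
    next
      case 1
      then show ?thesis by (intro exI[of _ x]) simp
    qed (rule two[OF x])
  qed
qed

section \<open>Reflection in a horizontal line\<close>

fun flip_pt :: "pt \<Rightarrow> pt" where
  "flip_pt (Bot i) = Top i"
| "flip_pt (Top i) = Bot i"

text \<open>It reverses the order of stacking (\<open>flip_stack\<close>), so that each statement
  about cups, or about stacks nested to the right, yields its mirror image.\<close>

definition flip :: "matching \<Rightarrow> matching" where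
  "flip D = (`) flip_pt ` D"

lemma flip_pt_flip_pt [simp]: "flip_pt (flip_pt x) = x"
  by (cases x) auto

lemma inj_flip_pt: "inj flip_pt"
  by (metis flip_pt_flip_pt injI)

lemma flip_flip [simp]: "flip (flip D) = D"
  by (simp add: flip_def image_image)

lemma lev_flip_pt: "lev i j (flip_pt x) = lev j i x"
  by (cases x) auto

text \<open>Levels above \<open>n\<close> do not occur in the diagrams; fixing them makes the map
  injective on all nodes, as \<open>rtrancl_map_prod_iff\<close> demands.\<close>

definition reflect :: "nat \<Rightarrow> nat \<times> nat \<Rightarrow> nat \<times> nat" where
  "reflect n x = (if fst x \<le> n then n - fst x else fst x, snd x)"

lemma reflect_lev: "i \<le> n \<Longrightarrow> j \<le> n \<Longrightarrow> reflect n (lev i j x) = lev (n - i) (n - j) x"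
  by (cases x) (auto simp: reflect_def)

lemma inj_reflect: "inj (reflect n)"
  by (rule injI) (auto simp: reflect_def prod_eq_iff split: if_splits)

lemma glued_flip: "glued (flip D) (flip E) = (`) (reflect 2) ` glued E D"
  by (auto simp: glued_def lev_abbrevs flip_def image_Un image_image lev_flip_pt reflect_lev)

lemma glued3_flip: "glued3 (flip D) (flip E) (flip F) = (`) (reflect 3) ` glued3 F E D"
  by (auto simp: glued3_def lev_abbrevs flip_def image_Un image_image lev_flip_pt reflect_lev)

lemma connected_flip:
  "(reflect 2 x, reflect 2 y) \<in> connected_pts (flip D) (flip E) \<longleftrightarrow> (x, y) \<in> connected_pts E D"
  by (simp add: connected_pts_block_rel glued_flip block_rel_image rtrancl_map_prod_iff[OF inj_reflect])

lemma connected3_flip: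
  "(reflect 3 x, reflect 3 y) \<in> (block_rel (glued3 (flip D) (flip E) (flip F)))\<^sup>* \<longleftrightarrow>
   (x, y) \<in> (block_rel (glued3 F E D))\<^sup>*"
  by (simp add: glued3_flip block_rel_image rtrancl_map_prod_iff[OF inj_reflect])

lemma stack_doubletons: "b \<in> stack E D \<Longrightarrow> \<exists>x y. b = {x, y}"
  by (auto simp: stack_def)

lemma doubleton_set_eqI:
  assumes "\<And>b. b \<in> A \<Longrightarrow> \<exists>x y. b = {x, y}" "\<And>b. b \<in> B \<Longrightarrow> \<exists>x y. b = {x, y}"
    "\<And>x y. {x, y} \<in> A \<longleftrightarrow> {x, y} \<in> B"
  shows "A = B"
  using assms by (metis subsetI subset_antisym)

lemma doubleton_in_flip_iff: "{x, y} \<in> flip D \<longleftrightarrow> {flip_pt x, flip_pt y} \<in> D"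
proof
  assume "{flip_pt x, flip_pt y} \<in> D"
  then have "flip_pt ` {flip_pt x, flip_pt y} \<in> flip D" unfolding flip_def by blast
  then show "{x, y} \<in> flip D" by simp
next
  assume "{x, y} \<in> flip D"
  then obtain b where "b \<in> D" "{x, y} = flip_pt ` b" by (auto simp: flip_def)
  then have "flip_pt ` {x, y} = b" by (simp add: image_image)
  then show "{flip_pt x, flip_pt y} \<in> D" using \<open>b \<in> D\<close> by simp
qed

lemma flip_stack: "flip (stack E D) = stack (flip D) (flip E)"
proof (rule doubleton_set_eqI)
  fix b assume "b \<in> flip (stack E D)"
  then show "\<exists>x y. b = {x, y}" by (auto simp: flip_def stack_def)
next
  fix x y
  have "outer (flip_pt z) = reflect 2 (outer z)" for z
    by (simp add: lev_abbrevs lev_flip_pt reflect_lev)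
  then have "(outer x, outer y) \<in> connected_pts (flip D) (flip E) \<longleftrightarrow>
      (outer (flip_pt x), outer (flip_pt y)) \<in> connected_pts E D"
    using connected_flip by (metis flip_pt_flip_pt)
  then show "{x, y} \<in> flip (stack E D) \<longleftrightarrow> {x, y} \<in> stack (flip D) (flip E)"
    by (simp only: doubleton_in_flip_iff doubleton_in_stack_iff inj_eq[OF inj_flip_pt])
qed (auto simp: stack_def)

section \<open>Associativity of stacking\<close>

text \<open>Mirror image of \<open>skip1\<close>: the levels 0, 1, 2 of \<open>stack F E\<close>
  over \<open>D\<close> go to the levels 0, 1, 3.\<close>

definition skip2 :: "nat \<times> nat \<Rightarrow> nat \<times> nat" where
  "skip2 x = reflect 3 (skip1 (reflect 2 x))"

lemma reflect_reflect [simp]: "reflect n (reflect n x) = x"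
  by (auto simp: reflect_def prod_eq_iff)

lemma connected_stack_left:
  "(x, y) \<in> connected_pts (stack F E) D \<longleftrightarrow> (skip2 x, skip2 y) \<in> (block_rel (glued3 F E D))\<^sup>*"
  unfolding skip2_def connected_flip[symmetric, of x y] flip_stack connected_stack_right
  by (subst connected3_flip[symmetric]) simp

text \<open>Both sides record which outer points are connected in the three stacked diagrams,
  because \<open>skip1\<close> and \<open>skip2\<close> agree on outer points.\<close>

lemma stack_assoc: "stack F (stack E D) = stack (stack F E) D"
proof (rule doubleton_set_eqI)
  fix x y
  have "skip1 (outer z) = skip2 (outer z)" for z
    by (cases z) (auto simp: skip2_def skip1_def reflect_def)
  then show "{x, y} \<in> stack F (stack E D) \<longleftrightarrow> {x, y} \<in> stack (stack F E) D"
    by (simp add: doubleton_in_stack_iff connected_stack_right connected_stack_left)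
qed (auto simp: stack_def)

lemma fst_reflect: "fst (reflect 2 x) = 1 \<longleftrightarrow> fst x = 1" "fst (reflect 3 x) \<in> {1, 2} \<longleftrightarrow> fst x \<in> {1, 2}"
  by (auto simp: reflect_def)

lemma no_loop_flip: "no_loop (flip D) (flip E) \<longleftrightarrow> no_loop E D"
proof -
  have "no_loop (flip D) (flip E)" if "no_loop E D" for D E
    unfolding no_loop_def
  proof
    fix x assume "x \<in> \<Union>(glued (flip D) (flip E))"
    then obtain x' where x': "x' \<in> \<Union>(glued E D)" "x = reflect 2 x'"
      unfolding glued_flip by blast
    then obtain y where "(x', y) \<in> connected_pts E D" "fst y \<noteq> 1"
      using \<open>no_loop E D\<close> unfolding no_loop_def by blast
    then show "\<exists>y. (x, y) \<in> connected_pts (flip D) (flip E) \<and> fst y \<noteq> 1"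
      using x' by (intro exI[of _ "reflect 2 y"]) (simp add: connected_flip fst_reflect del: One_nat_def)
  qed
  from this[of E D] this[of "flip D" "flip E"] show ?thesis by auto
qed

lemma no_loop3_flip: "no_loop3 (flip D) (flip E) (flip F) \<longleftrightarrow> no_loop3 F E D"
proof -
  have "no_loop3 (flip D) (flip E) (flip F)" if "no_loop3 F E D" for D E F
    unfolding no_loop3_def
  proof
    fix x assume "x \<in> \<Union>(glued3 (flip D) (flip E) (flip F))"
    then obtain x' where x': "x' \<in> \<Union>(glued3 F E D)" "x = reflect 3 x'"
      unfolding glued3_flip by blast
    then obtain y where "(x', y) \<in> (block_rel (glued3 F E D))\<^sup>*" "fst y \<notin> {1, 2}"
      using \<open>no_loop3 F E D\<close> unfolding no_loop3_def by blast
    then show "\<exists>y. (x, y) \<in> (block_rel (glued3 (flip D) (flip E) (flip F)))\<^sup>* \<and> fst y \<notin> {1, 2}"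
      using x' fst_reflect(2)[of y] by (intro exI[of _ "reflect 3 y"]) (simp add: connected3_flip)
  qed
  from this[of F E D] this[of "flip D" "flip E" "flip F"] show ?thesis by auto
qed

lemma Union_flip: "\<Union>(flip D) = flip_pt ` \<Union>D"
  by (auto simp: flip_def)

lemma in_Union_flip_iff: "x \<in> \<Union>(flip D) \<longleftrightarrow> flip_pt x \<in> \<Union>D"
  unfolding Union_flip by (metis flip_pt_flip_pt image_iff)

text \<open>Both sides say that the three stacked diagrams contain no closed loop; the second
  bracketing is reached by reflection.\<close>

lemma no_loop_assoc:
  assumes "\<And>k. Top k \<in> \<Union>E \<Longrightarrow> Bot k \<in> \<Union>F" "\<And>k. Bot k \<in> \<Union>E \<Longrightarrow> Top k \<in> \<Union>D"
  shows "no_loop E D \<and> no_loop F (stack E D) \<longleftrightarrow> no_loop F E \<and> no_loop (stack F E) D"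
proof -
  have "no_loop E D \<and> no_loop F (stack E D) \<longleftrightarrow> no_loop3 F E D"
    using no_loop3_right assms(1) by blast
  also have "\<dots> \<longleftrightarrow> no_loop3 (flip D) (flip E) (flip F)" by (simp add: no_loop3_flip)
  also have "\<dots> \<longleftrightarrow> no_loop (flip E) (flip F) \<and> no_loop (flip D) (stack (flip E) (flip F))"
    by (rule no_loop3_right) (use assms(2) in \<open>simp only: in_Union_flip_iff flip_pt.simps\<close>)
  also have "\<dots> \<longleftrightarrow> no_loop F E \<and> no_loop (stack F E) D"
    by (simp add: no_loop_flip flip: flip_stack)
  finally show ?thesis .
qed

section \<open>Planar matchings\<close>

lemma finite_points [simp]: "finite (points m n)"
  by (simp add: points_def)

lemma points_simps [simp]: "Bot k \<in> points m n \<longleftrightarrow> k < m" "Top k \<in> points m n \<longleftrightarrow> k < n"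
  by (auto simp: points_def)

lemma Union_planar: "D \<in> planar_matchings m n \<Longrightarrow> \<Union>D = points m n"
  by (auto simp: planar_matchings_def partition_on_def)

lemma planar_block:
  assumes "D \<in> planar_matchings m n" "b \<in> D" obtains x y where "b = {x, y}" "x \<noteq> y"
  using assms by (auto simp: planar_matchings_def card_2_iff)

lemma planar_block_points:
  "D \<in> planar_matchings m n \<Longrightarrow> {x, y} \<in> D \<Longrightarrow> x \<in> points m n \<and> y \<in> points m n \<and> x \<noteq> y"
  using Union_planar by (fastforce simp: planar_matchings_def)

lemma planar_blocks_eq:
  "D \<in> planar_matchings m n \<Longrightarrow> b \<in> D \<Longrightarrow> c \<in> D \<Longrightarrow> x \<in> b \<Longrightarrow> x \<in> c \<Longrightarrow> b = c"
  unfolding planar_matchings_def partition_on_def disjoint_def by blast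

lemma planar_unique:
  "D \<in> planar_matchings m n \<Longrightarrow> {x, y} \<in> D \<Longrightarrow> {x, z} \<in> D \<Longrightarrow> y = z"
  using planar_blocks_eq[of D m n "{x, y}" "{x, z}" x] planar_block_points[of D m n x]
  by (auto simp: doubleton_eq_iff)

lemma planar_partner:
  assumes "D \<in> planar_matchings m n" "x \<in> points m n"
  obtains y where "{x, y} \<in> D" "y \<noteq> x"
proof -
  obtain b where b: "b \<in> D" "x \<in> b" using assms(2) unfolding Union_planar[OF assms(1), symmetric] by blast
  obtain u w where "b = {u, w}" "u \<noteq> w" using planar_block[OF assms(1) b(1)] .
  then show ?thesis using b that[of u] that[of w] by (auto simp: insert_commute)
qed

lemma planar_noncrossing:
  "D \<in> planar_matchings m n \<Longrightarrow> {a, b} \<in> D \<Longrightarrow> {c, d} \<in> D \<Longrightarrow>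
   boundary_pos a < boundary_pos c \<Longrightarrow> boundary_pos c < boundary_pos b \<Longrightarrow>
   \<not> boundary_pos b < boundary_pos d"
  unfolding planar_matchings_def noncrossing_def by blast

lemma planarI:
  assumes "\<And>b. b \<in> D \<Longrightarrow> \<exists>x y. b = {x, y} \<and> x \<noteq> y \<and> x \<in> points m n \<and> y \<in> points m n"
    "\<And>x. x \<in> points m n \<Longrightarrow> \<exists>b\<in>D. x \<in> b"
    "\<And>b c x. b \<in> D \<Longrightarrow> c \<in> D \<Longrightarrow> x \<in> b \<Longrightarrow> x \<in> c \<Longrightarrow> b = c" "noncrossing D"
  shows "D \<in> planar_matchings m n"
proof -
  have "partition_on (points m n) D"
    by (rule partition_onI) (use assms(1-3) in \<open>fastforce simp: disjnt_def\<close>)+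
  then show ?thesis using assms(1,4) by (fastforce simp: planar_matchings_def)
qed

lemma boundary_pos_flip_pt: "boundary_pos (flip_pt x) = - 1 - boundary_pos x"
  by (cases x) auto

lemma flip_pt_in_points [simp]: "flip_pt x \<in> points m n \<longleftrightarrow> x \<in> points n m"
  by (cases x) auto

lemma planar_flip:
  assumes "D \<in> planar_matchings m n" shows "flip D \<in> planar_matchings n m"
proof (rule planarI)
  fix b assume "b \<in> flip D"
  then obtain c where c: "c \<in> D" "b = flip_pt ` c" by (auto simp: flip_def)
  obtain x y where xy: "c = {x, y}" "x \<noteq> y" using planar_block[OF assms c(1)] .
  then show "\<exists>x y. b = {x, y} \<and> x \<noteq> y \<and> x \<in> points n m \<and> y \<in> points n m"
    using c planar_block_points[OF assms, of x y]
    by (intro exI[of _ "flip_pt x"] exI[of _ "flip_pt y"]) (simp add: inj_eq[OF inj_flip_pt])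
next
  fix x assume "x \<in> points n m"
  then have "flip_pt x \<in> \<Union>D" using Union_planar[OF assms] by simp
  then show "\<exists>b\<in>flip D. x \<in> b" by (metis UnionE in_Union_flip_iff)
next
  fix b c x assume *: "b \<in> flip D" "c \<in> flip D" "x \<in> b" "x \<in> c"
  then obtain b' c' where b'c': "b' \<in> D" "c' \<in> D" "b = flip_pt ` b'" "c = flip_pt ` c'"
    unfolding flip_def by blast
  then obtain x' where "x = flip_pt x'" "x' \<in> b'" "x' \<in> c'"
    using * by (auto simp: inj_eq[OF inj_flip_pt])
  then show "b = c" using b'c' planar_blocks_eq[OF assms, of b' c' x'] by simp
next
  show "noncrossing (flip D)"
    unfolding noncrossing_def
  proof (intro notI, elim exE conjE)
    fix a b c d
    assume *: "{a, b} \<in> flip D" "{c, d} \<in> flip D" "boundary_pos a < boundary_pos c"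
      "boundary_pos c < boundary_pos b" "boundary_pos b < boundary_pos d"
    then show False
      using planar_noncrossing[OF assms, of "flip_pt d" "flip_pt c" "flip_pt b" "flip_pt a"]
      by (simp add: doubleton_in_flip_iff boundary_pos_flip_pt insert_commute)
  qed
qed

lemma finite_glued:
  assumes "D \<in> planar_matchings m n" "E \<in> planar_matchings n k"
  shows "finite (\<Union>(glued E D))"
proof -
  have "\<Union>(glued E D) = upper ` \<Union>E \<union> lower ` \<Union>D" by (auto simp: glued_def)
  then show ?thesis using assms by (simp add: Union_planar)
qed

text \<open>The map \<open>f\<close> slides every node along its strand to an outer point, so that a
  glued block becomes a block of \<open>M\<close> or a single point. Connected nodes then land in
  one block, which bounds the stack from above; \<open>conv\<close> is the other inclusion.\<close>

lemma stack_eqI: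
  assumes M: "\<And>b. b \<in> M \<Longrightarrow> \<exists>x y. b = {x, y} \<and> x \<noteq> y"
      "\<And>b c x. b \<in> M \<Longrightarrow> c \<in> M \<Longrightarrow> x \<in> b \<Longrightarrow> x \<in> c \<Longrightarrow> b = c"
    and f: "\<And>x. f (outer x) = x" "\<And>b. b \<in> glued E D \<Longrightarrow> f ` b \<in> M \<or> (\<exists>z. f ` b \<subseteq> {z})"
    and conv: "\<And>x y. {x, y} \<in> M \<Longrightarrow> x \<noteq> y \<Longrightarrow> (outer x, outer y) \<in> connected_pts E D"
  shows "stack E D = M"
proof (rule doubleton_set_eqI)
  have block: "{x, y} \<in> M" if "b \<in> M" "x \<in> b" "y \<in> b" "x \<noteq> y" for b x y
  proof -
    obtain u w where "b = {u, w}" using M(1) \<open>b \<in> M\<close> by blast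
    then have "b = {x, y}" using that by auto
    then show ?thesis using that by simp
  qed
  have *: "f p = f q \<or> {f p, f q} \<in> M" if "(p, q) \<in> connected_pts E D" for p q
    using that unfolding connected_pts_block_rel
  proof (induction rule: rtrancl_induct)
    case (step y z)
    then obtain b where b: "b \<in> glued E D" "y \<in> b" "z \<in> b" by (auto simp: block_rel_def)
    show ?case
    proof (cases "f y = f z")
      case False
      moreover have "f y \<in> f ` b" "f z \<in> f ` b" using b by auto
      ultimately have "f ` b \<in> M" using f(2)[OF b(1)] by (metis singletonD subset_iff)
      moreover have "f p = f y \<or> {f p, f y} = f ` b"
        using step(3) b(2) M(2)[OF _ \<open>f ` b \<in> M\<close>, of "{f p, f y}" "f y"] by auto
      ultimately show ?thesis using block[of "f ` b" "f p" "f z"] b by blast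
    qed (use step in auto)
  qed auto
  fix x y
  show "{x, y} \<in> stack E D \<longleftrightarrow> {x, y} \<in> M"
    using *[of "outer x" "outer y"] conv[of x y] f(1) M(1)[of "{x, y}"]
    by (auto simp: doubleton_in_stack_iff doubleton_eq_iff)
qed (use M(1) stack_doubletons in blast)+

lemma connected_upperI: "b \<in> E \<Longrightarrow> x \<in> b \<Longrightarrow> y \<in> b \<Longrightarrow> (upper x, upper y) \<in> connected_pts E D"
  unfolding connected_pts_def glued_def by (intro r_into_rtrancl) blast

lemma connected_lowerI: "b \<in> D \<Longrightarrow> x \<in> b \<Longrightarrow> y \<in> b \<Longrightarrow> (lower x, lower y) \<in> connected_pts E D"
  unfolding connected_pts_def glued_def by (intro r_into_rtrancl) blast

lemma no_loopI:
  assumes "\<And>k. (1, k) \<in> \<Union>(glued E D) \<Longrightarrow> \<exists>y. ((1, k), y) \<in> connected_pts E D \<and> fst y \<noteq> 1"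
  shows "no_loop E D"
  unfolding no_loop_def
proof
  fix x assume "x \<in> \<Union>(glued E D)"
  moreover have "(x, x) \<in> connected_pts E D" by (simp add: connected_pts_def)
  ultimately show "\<exists>y. (x, y) \<in> connected_pts E D \<and> fst y \<noteq> 1"
    using assms[of "snd x"] by (metis prod.collapse)
qed

lemma glued_middle_iff: "(1, k) \<in> \<Union>(glued E D) \<longleftrightarrow> Bot k \<in> \<Union>E \<or> Top k \<in> \<Union>D"
proof -
  have "(1, k) = upper x \<longleftrightarrow> x = Bot k" "(1, k) = lower x \<longleftrightarrow> x = Top k" for x by (cases x; auto)+
  moreover have "\<Union>(glued E D) = upper ` \<Union>E \<union> lower ` \<Union>D" by (auto simp: glued_def)
  ultimately show ?thesis by (simp only: Un_iff image_iff) blast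
qed

section \<open>Inserting a cup at two adjacent top positions\<close>

definition ins :: "nat \<Rightarrow> nat \<Rightarrow> nat" where
  "ins i j = (if j < i then j else j + 2)"

fun ins_pt :: "nat \<Rightarrow> pt \<Rightarrow> pt" where
  "ins_pt i (Bot k) = Bot k"
| "ins_pt i (Top k) = Top (ins i k)"

definition cup_diag :: "nat \<Rightarrow> nat \<Rightarrow> matching" where
  "cup_diag i n = insert {Top i, Top (Suc i)} ((\<lambda>j. {Bot j, Top (ins i j)}) ` {..<n})"

lemma id_diag_altdef: "id_diag n = (\<lambda>j. {Bot j, Top j}) ` {..<n}"
  by (auto simp: id_diag_def)

lemma ins_pt_simps:
  "ins_pt i x = ins_pt i y \<longleftrightarrow> x = y"
  "boundary_pos (ins_pt i x) < boundary_pos (ins_pt i y) \<longleftrightarrow> boundary_pos x < boundary_pos y"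
  "ins_pt i x \<noteq> Top i" "ins_pt i x \<noteq> Top (Suc i)" "Top i \<noteq> ins_pt i x" "Top (Suc i) \<noteq> ins_pt i x"
  by (cases x; cases y; auto simp: ins_def)+

lemma inj_ins_pt: "inj (ins_pt i)"
  by (rule injI) (simp add: ins_pt_simps)

lemma ins_pt_points: "i \<le> n \<Longrightarrow> ins_pt i x \<in> points m (n + 2) \<longleftrightarrow> x \<in> points m n"
  by (cases x) (auto simp: ins_def)

lemma ins_pt_surj:
  assumes "x \<noteq> Top i" "x \<noteq> Top (Suc i)" obtains y where "x = ins_pt i y"
proof (cases x)
  case (Top k)
  then have "k < i \<or> i + 2 \<le> k" using assms by auto
  then have "k = ins i (if k < i then k else k - 2)" by (auto simp: ins_def)
  then show ?thesis using Top that[of "Top (if k < i then k else k - 2)"] by simp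
qed (use that[of x] in auto)

definition add_cup :: "nat \<Rightarrow> matching \<Rightarrow> matching" where
  "add_cup i D = insert {Top i, Top (Suc i)} ((`) (ins_pt i) ` D)"

lemma in_add_cup_iff: "{ins_pt i x, ins_pt i y} \<in> add_cup i D \<longleftrightarrow> {x, y} \<in> D"
proof
  assume "{ins_pt i x, ins_pt i y} \<in> add_cup i D"
  then obtain b where "b \<in> D" "ins_pt i ` {x, y} = ins_pt i ` b"
    by (auto simp: add_cup_def doubleton_eq_iff ins_pt_simps)
  then show "{x, y} \<in> D" unfolding inj_image_eq_iff[OF inj_ins_pt] by simp
next
  assume "{x, y} \<in> D"
  then have "ins_pt i ` {x, y} \<in> add_cup i D" unfolding add_cup_def by blast
  then show "{ins_pt i x, ins_pt i y} \<in> add_cup i D" by simp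
qed

lemma planar_add_cup:
  assumes D: "D \<in> planar_matchings m n" and i: "i \<le> n"
  shows "add_cup i D \<in> planar_matchings m (n + 2)"
proof (rule planarI)
  fix b assume "b \<in> add_cup i D"
  then consider "b = {Top i, Top (Suc i)}" | c where "c \<in> D" "b = ins_pt i ` c"
    by (auto simp: add_cup_def)
  then show "\<exists>x y. b = {x, y} \<and> x \<noteq> y \<and> x \<in> points m (n + 2) \<and> y \<in> points m (n + 2)"
  proof cases
    case 1 then show ?thesis using i by (intro exI[of _ "Top i"] exI[of _ "Top (Suc i)"]) auto
  next
    case 2
    obtain x y where "c = {x, y}" "x \<noteq> y" using planar_block[OF D 2(1)] by metis
    then show ?thesis using 2 planar_block_points[OF D, of x y] i
      by (intro exI[of _ "ins_pt i x"] exI[of _ "ins_pt i y"]) (auto simp: ins_pt_simps ins_pt_points simp del: add_2_eq_Suc')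
  qed
next
  fix x assume x: "x \<in> points m (n + 2)"
  show "\<exists>b\<in>add_cup i D. x \<in> b"
  proof (cases "x \<in> {Top i, Top (Suc i)}")
    case False
    then obtain y where y: "x = ins_pt i y" using ins_pt_surj by blast
    then have "y \<in> \<Union>D" using x i Union_planar[OF D] by (simp add: ins_pt_points del: add_2_eq_Suc')
    then show ?thesis using y by (auto simp: add_cup_def)
  qed (auto simp: add_cup_def)
next
  fix b c x assume *: "b \<in> add_cup i D" "c \<in> add_cup i D" "x \<in> b" "x \<in> c"
  show "b = c"
  proof (cases "x \<in> {Top i, Top (Suc i)}")
    case True
    then show ?thesis using * by (auto simp: add_cup_def ins_pt_simps)
  next
    case False
    then obtain b' c' where b'c': "b' \<in> D" "c' \<in> D" "b = ins_pt i ` b'" "c = ins_pt i ` c'"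
      using * unfolding add_cup_def by blast
    then obtain x' where "x = ins_pt i x'" "x' \<in> b'" "x' \<in> c'"
      using * by (auto simp: ins_pt_simps)
    then show ?thesis using b'c' planar_blocks_eq[OF D, of b' c' x'] by simp
  qed
next
  show "noncrossing (add_cup i D)"
    unfolding noncrossing_def
  proof (intro notI, elim exE conjE)
    fix a b c d
    assume *: "{a, b} \<in> add_cup i D" "{c, d} \<in> add_cup i D"
      and pos: "boundary_pos a < boundary_pos c" "boundary_pos c < boundary_pos b" "boundary_pos b < boundary_pos d"
    have range: "x \<in> range (ins_pt i) \<and> y \<in> range (ins_pt i)"
      if "{x, y} \<in> add_cup i D" "{x, y} \<noteq> {Top i, Top (Suc i)}" for x y
    proof -
      from that obtain b' where "{x, y} = ins_pt i ` b'" by (auto simp: add_cup_def)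
      moreover have "x \<in> {x, y}" "y \<in> {x, y}" by auto
      ultimately show ?thesis by blast
    qed
    \<comment> \<open>No boundary position lies between two adjacent top points, so the new cup
      cannot interleave with a strand.\<close>
    have "{a, b} \<noteq> {Top i, Top (Suc i)}" "{c, d} \<noteq> {Top i, Top (Suc i)}"
      using pos by (auto simp: doubleton_eq_iff)
    note range[OF *(1) this(1)] range[OF *(2) this(2)]
    moreover from this obtain a' b' where "a = ins_pt i a'" "b = ins_pt i b'" by (elim conjE rangeE)
    moreover from calculation obtain c' d' where "c = ins_pt i c'" "d = ins_pt i d'" by (elim conjE rangeE)
    ultimately show False using planar_noncrossing[OF D, of a' b' c' d'] * pos
      by (simp add: in_add_cup_iff ins_pt_simps)
  qed
qed

lemma planar_remove_cup:
  assumes D: "D \<in> planar_matchings m n" and cup: "{Top i, Top (Suc i)} \<in> D"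
  obtains D' where "n \<ge> 2" "i \<le> n - 2" "D' \<in> planar_matchings m (n - 2)" "D = add_cup i D'"
proof -
  have n: "Suc i < n" using planar_block_points[OF D cup] by simp
  define D' where "D' = {b. ins_pt i ` b \<in> D}"
  have eq: "D = add_cup i D'"
  proof (intro set_eqI iffI)
    fix b assume b: "b \<in> D"
    show "b \<in> add_cup i D'"
    proof (cases "b = {Top i, Top (Suc i)}")
      case False
      then have "Top i \<notin> b" "Top (Suc i) \<notin> b" using planar_blocks_eq[OF D b cup] by auto
      then have "b \<subseteq> range (ins_pt i)" by (metis ins_pt_surj rangeI subsetI)
      then obtain c where "b = ins_pt i ` c" by (metis subset_imageE)
      then show ?thesis using b by (auto simp: add_cup_def D'_def)
    qed (simp add: add_cup_def)
  qed (use cup in \<open>auto simp: add_cup_def D'_def\<close>)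
  have pts: "ins_pt i x \<in> points m n \<longleftrightarrow> x \<in> points m (n - 2)" for x
    using ins_pt_points[of i "n - 2" x m] n by (simp add: le_diff_conv2 Suc_diff_Suc numeral_2_eq_2)
  have "D' \<in> planar_matchings m (n - 2)"
  proof (rule planarI)
    fix b assume b: "b \<in> D'"
    then have "ins_pt i ` b \<in> D" by (simp add: D'_def)
    then obtain x y where xy: "ins_pt i ` b = {x, y}" "x \<noteq> y" by (rule planar_block[OF D])
    then obtain x' y' where x'y': "x = ins_pt i x'" "y = ins_pt i y'" by blast
    then have "ins_pt i ` b = ins_pt i ` {x', y'}" using xy by simp
    then have "b = {x', y'}" by (simp only: inj_image_eq_iff[OF inj_ins_pt])
    moreover have "x \<in> points m n \<and> y \<in> points m n"
      using planar_block_points[OF D, of x y] b xy by (simp add: D'_def)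
    ultimately show "\<exists>x y. b = {x, y} \<and> x \<noteq> y \<and> x \<in> points m (n - 2) \<and> y \<in> points m (n - 2)"
      using x'y' xy pts by blast
  next
    fix x assume "x \<in> points m (n - 2)"
    then have "ins_pt i x \<in> \<Union>D" using pts Union_planar[OF D] by simp
    then obtain b where "b \<in> D'" "ins_pt i x \<in> ins_pt i ` b"
      unfolding eq by (auto simp: add_cup_def ins_pt_simps)
    then show "\<exists>b\<in>D'. x \<in> b" by (auto simp: ins_pt_simps)
  next
    fix b c x assume "b \<in> D'" "c \<in> D'" "x \<in> b" "x \<in> c"
    then have "ins_pt i ` b = ins_pt i ` c"
      using planar_blocks_eq[OF D, of "ins_pt i ` b" "ins_pt i ` c" "ins_pt i x"] by (auto simp: D'_def)
    then show "b = c" by (simp only: inj_image_eq_iff[OF inj_ins_pt])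
  next
    show "noncrossing D'" unfolding noncrossing_def
    proof (intro notI, elim exE conjE)
      fix a b c d assume "{a, b} \<in> D'" "{c, d} \<in> D'" "boundary_pos a < boundary_pos c"
        "boundary_pos c < boundary_pos b" "boundary_pos b < boundary_pos d"
      then show False
        using planar_noncrossing[OF D, of "ins_pt i a" "ins_pt i b" "ins_pt i c" "ins_pt i d"]
        by (simp add: D'_def ins_pt_simps)
    qed
  qed
  then show ?thesis using that n eq by simp
qed

lemma
  assumes D: "D \<in> planar_matchings m n" and i: "i \<le> n"
  shows stack_cup_diag: "stack (cup_diag i n) D = add_cup i D"
    and no_loop_cup_diag: "no_loop (cup_diag i n) D"
proof -
  have step: "((1, k), (2, ins i k)) \<in> connected_pts (cup_diag i n) D" if "k < n" for k
    using connected_upperI[of "{Bot k, Top (ins i k)}" "cup_diag i n" "Bot k" "Top (ins i k)" D] that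
    by (auto simp: cup_diag_def)
  show "no_loop (cup_diag i n) D"
  proof (rule no_loopI)
    fix k assume "(1, k) \<in> \<Union>(glued (cup_diag i n) D)"
    then have "Bot k \<in> \<Union>(cup_diag i n) \<or> Top k \<in> \<Union>D" by (simp only: glued_middle_iff)
    then have "k < n" unfolding Union_planar[OF D] by (auto simp: cup_diag_def)
    then show "\<exists>y. ((1, k), y) \<in> connected_pts (cup_diag i n) D \<and> fst y \<noteq> 1"
      using step by (intro exI[of _ "(2, ins i k)"]) auto
  qed
  \<comment> \<open>The node map for \<open>stack_eqI\<close>: a middle point is carried up along
    its strand of the cup diagram.\<close>
  define f where "f x = (if fst x = 0 then Bot (snd x) else if fst x = 1 then Top (ins i (snd x)) else Top (snd x))"
    for x :: "nat \<times> nat"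
  have f_lower: "f (lower x) = ins_pt i x" and f_outer: "f (outer x) = x" for x
    by (cases x; simp add: f_def)+
  have P: "add_cup i D \<in> planar_matchings m (n + 2)" using planar_add_cup[OF D i] .
  show "stack (cup_diag i n) D = add_cup i D"
  proof (rule stack_eqI[where f = f])
    fix b assume "b \<in> add_cup i D"
    then show "\<exists>x y. b = {x, y} \<and> x \<noteq> y" using planar_block[OF P] by metis
  next
    fix b c x assume "b \<in> add_cup i D" "c \<in> add_cup i D" "x \<in> b" "x \<in> c"
    then show "b = c" by (rule planar_blocks_eq[OF P])
  next
    fix b assume "b \<in> glued (cup_diag i n) D"
    then consider c where "c \<in> D" "b = lower ` c" | "b = {(2, i), (2, Suc i)}"
      | k where "k < n" "b = {(1, k), (2, ins i k)}"
      by (auto simp: glued_def cup_diag_def)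
    then show "f ` b \<in> add_cup i D \<or> (\<exists>z. f ` b \<subseteq> {z})"
    proof cases
      case 1
      then show ?thesis by (auto simp: image_image f_lower add_cup_def)
    qed (auto simp: f_def add_cup_def)
  next
    fix x y assume xy: "{x, y} \<in> add_cup i D" "x \<noteq> y"
    have lower_outer: "(lower x, outer (ins_pt i x)) \<in> connected_pts (cup_diag i n) D" if "x \<in> \<Union>D" for x
      using that Union_planar[OF D] step by (cases x) (auto simp: connected_pts_def)
    from xy consider "{x, y} = {Top i, Top (Suc i)}" | b where "b \<in> D" "{x, y} = ins_pt i ` b"
      by (auto simp: add_cup_def)
    then show "(outer x, outer y) \<in> connected_pts (cup_diag i n) D"
    proof cases
      case 1
      have "(upper x, upper y) \<in> connected_pts (cup_diag i n) D"
        by (rule connected_upperI[of "{Top i, Top (Suc i)}"]) (use 1 in \<open>auto simp: cup_diag_def\<close>)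
      then show ?thesis using 1 by (auto simp: doubleton_eq_iff)
    next
      case 2
      then obtain x' y' where "x' \<in> b" "y' \<in> b" "x = ins_pt i x'" "y = ins_pt i y'" by blast
      then show ?thesis using connected_lowerI[OF 2(1), of x' y' "cup_diag i n"] 2(1)
          lower_outer[of x'] lower_outer[of y'] connected_pts_trans connected_pts_sym
        by (metis UnionI)
    qed
  qed (rule f_outer)
qed

lemma
  assumes D: "D \<in> planar_matchings m n"
  shows stack_id_diag: "stack (id_diag n) D = D"
    and no_loop_id_diag: "no_loop (id_diag n) D"
proof -
  have step: "((1, k), (2, k)) \<in> connected_pts (id_diag n) D" if "k < n" for k
    using connected_upperI[of "{Bot k, Top k}" "id_diag n" "Bot k" "Top k" D] that
    by (auto simp: id_diag_def)
  show "no_loop (id_diag n) D"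
  proof (rule no_loopI)
    fix k assume "(1, k) \<in> \<Union>(glued (id_diag n) D)"
    then have "Bot k \<in> \<Union>(id_diag n) \<or> Top k \<in> \<Union>D" by (simp only: glued_middle_iff)
    then have "k < n" unfolding Union_planar[OF D] by (auto simp: id_diag_def)
    then show "\<exists>y. ((1, k), y) \<in> connected_pts (id_diag n) D \<and> fst y \<noteq> 1"
      using step by (intro exI[of _ "(2, k)"]) auto
  qed
  define f where "f x = (if fst x = 0 then Bot (snd x) else Top (snd x))"
    for x :: "nat \<times> nat"
  have f_lower: "f (lower x) = x" and f_outer: "f (outer x) = x" for x
    by (cases x; simp add: f_def)+
  show "stack (id_diag n) D = D"
  proof (rule stack_eqI[where f = f])
    fix b assume "b \<in> D"
    then show "\<exists>x y. b = {x, y} \<and> x \<noteq> y" using planar_block[OF D] by metis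
  next
    fix b c x assume "b \<in> D" "c \<in> D" "x \<in> b" "x \<in> c"
    then show "b = c" by (rule planar_blocks_eq[OF D])
  next
    fix b assume "b \<in> glued (id_diag n) D"
    then consider c where "c \<in> D" "b = lower ` c" | k where "k < n" "b = {(1, k), (2, k)}"
      by (auto simp: glued_def id_diag_def)
    then show "f ` b \<in> D \<or> (\<exists>z. f ` b \<subseteq> {z})"
      by cases (auto simp: image_image f_lower, auto simp: f_def)
  next
    fix x y assume xy: "{x, y} \<in> D" "x \<noteq> y"
    have lower_outer: "(lower x, outer x) \<in> connected_pts (id_diag n) D" if "x \<in> points m n" for x
      using that step by (cases x) (auto simp: connected_pts_def)
    show "(outer x, outer y) \<in> connected_pts (id_diag n) D"
      using connected_lowerI[OF xy(1), of x y "id_diag n"] planar_block_points[OF D xy(1)]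
          lower_outer[of x] lower_outer[of y] connected_pts_trans connected_pts_sym
      by (metis insertCI)
  qed (rule f_outer)
qed

lemma flip_id_diag: "flip (id_diag n) = id_diag n"
  by (auto simp: flip_def id_diag_altdef image_image insert_commute)

lemma planar_id_diag: "id_diag n \<in> planar_matchings n n"
proof (rule planarI)
  show "noncrossing (id_diag n)"
    by (auto simp: noncrossing_def id_diag_def doubleton_eq_iff)
qed (auto simp: id_diag_def points_def)

lemma
  assumes D: "D \<in> planar_matchings m n"
  shows stack_id_diag_right: "stack D (id_diag m) = D"
    and no_loop_id_diag_right: "no_loop D (id_diag m)"
proof -
  have "flip (stack D (id_diag m)) = flip D"
    by (simp add: flip_stack flip_id_diag stack_id_diag[OF planar_flip[OF D]])
  then show "stack D (id_diag m) = D" by (metis flip_flip)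
  show "no_loop D (id_diag m)"
    using no_loop_id_diag[OF planar_flip[OF D]] no_loop_flip[of "id_diag m" D] by (simp add: flip_id_diag)
qed

section \<open>Cups and caps generate the planar matchings\<close>

lemma planar_adjacent_cup:
  assumes D: "D \<in> planar_matchings m n"
  shows "{Top i, Top j} \<in> D \<Longrightarrow> i < j \<Longrightarrow> \<exists>k. {Top k, Top (Suc k)} \<in> D"
proof (induction "j - i" arbitrary: i j rule: less_induct)
  case less
  show ?case
  proof (cases "j = Suc i")
    case False
    then have i: "Suc i < j" "Suc i < n" using less planar_block_points[OF D less(2)] by auto
    \<comment> \<open>The strand at \<open>Top (Suc i)\<close> cannot cross the given cup, so it is
      enclosed by it and is a narrower cup, to which the induction applies.\<close>
    then obtain y where y: "{Top (Suc i), y} \<in> D" using planar_partner[OF D, of "Top (Suc i)"] by auto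
    have ne: "y \<noteq> Top i" "y \<noteq> Top j" "y \<noteq> Top (Suc i)"
      using planar_unique[OF D, of "Top i" "Top j" "Top (Suc i)"] planar_unique[OF D, of "Top j" "Top i" "Top (Suc i)"]
        y less(2) i planar_block_points[OF D y] by (auto simp: insert_commute)
    have *: "{Top j, Top i} \<in> D" "{y, Top (Suc i)} \<in> D" using y less(2) by (auto simp: insert_commute)
    show ?thesis
    proof (cases y)
      case (Bot k)
      then show ?thesis using planar_noncrossing[OF D *(1) y] i by simp
    next
      case (Top k)
      have "k > Suc i" using planar_noncrossing[OF D *(1) y] i Top ne by (cases "k < i") auto
      moreover have "k < j" using planar_noncrossing[OF D *(2,1)] i Top ne by (cases "k < j") auto
      ultimately show ?thesis using less(1)[of k "Suc i"] y Top by auto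
    qed
  qed (use less in auto)
qed

lemma planar_eqI:
  assumes "C \<in> planar_matchings m n" "D \<in> planar_matchings m n" "C \<subseteq> D" shows "C = D"
proof
  show "D \<subseteq> C"
  proof
    fix b assume b: "b \<in> D"
    then obtain x y where "b = {x, y}" "x \<noteq> y" using planar_block[OF assms(2)] by metis
    then have "x \<in> b" "x \<in> \<Union>C" using b Union_planar[OF assms(1)] Union_planar[OF assms(2)] by auto
    then show "b \<in> C" using planar_blocks_eq[OF assms(2) b] assms(3) by blast
  qed
qed fact

text \<open>Without cups the strands give a strictly increasing map from top positions to bottom
  positions; for \<open>n = m\<close> such a map is the identity.\<close>

lemma planar_no_cup:
  assumes D: "D \<in> planar_matchings m n" and no_cup: "\<And>i j. {Top i, Top j} \<notin> D"
  shows "n \<le> m" and "n = m \<Longrightarrow> D = id_diag n"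
proof -
  have "\<exists>k<m. {Top j, Bot k} \<in> D" if j: "j < n" for j
  proof -
    obtain y where "{Top j, y} \<in> D" by (rule planar_partner[OF D, of "Top j"]) (use j in simp)
    then show ?thesis using no_cup planar_block_points[OF D] by (cases y) fastforce+
  qed
  then obtain \<pi> where \<pi>: "\<And>j. j < n \<Longrightarrow> \<pi> j < m" "\<And>j. j < n \<Longrightarrow> {Top j, Bot (\<pi> j)} \<in> D" by metis
  have mono: "\<pi> i < \<pi> j" if "i < j" "j < n" for i j
  proof -
    have "{Bot (\<pi> i), Top i} \<in> D" "{Bot (\<pi> j), Top j} \<in> D" using \<pi>(2) that by (auto simp: insert_commute)
    then have "\<pi> i \<noteq> \<pi> j" using planar_unique[OF D, of "Bot (\<pi> i)" "Top i" "Top j"] that by auto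
    then show ?thesis using planar_noncrossing[OF D \<pi>(2)[of j] \<pi>(2)[of i]] that by auto
  qed
  have gap: "\<pi> i + d \<le> \<pi> (i + d)" if "i + d < n" for i d
    using that
  proof (induction d)
    case (Suc d)
    then show ?case using mono[of "i + d" "i + Suc d"] by simp
  qed simp
  show "n \<le> m" using gap[of 0 "n - 1"] \<pi>(1)[of "n - 1"] by (cases n) auto
  assume "n = m"
  have "\<pi> j = j" if "j < n" for j
    using gap[of 0 j] gap[of j "n - 1 - j"] \<pi>(1)[of "n - 1"] that \<open>n = m\<close> by auto
  then have "id_diag n \<subseteq> D" using \<pi>(2) by (force simp: id_diag_def insert_commute)
  then show "D = id_diag n" using planar_eqI planar_id_diag D \<open>n = m\<close> by metis
qed

text \<open>This serves the uniqueness of the Jones--Wenzl idempotent: what kills all cups from the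
  left kills every diagram except the identity.\<close>

lemma planar_not_id:
  assumes D: "D \<in> planar_matchings n n" and "D \<noteq> id_diag n"
  obtains i D' where "i + 2 \<le> n" "D' \<in> planar_matchings n (n - 2)" "D = stack (cup_diag i (n - 2)) D'"
proof -
  obtain i j where ij: "{Top i, Top j} \<in> D" using planar_no_cup[OF D] assms(2) by blast
  then have "i \<noteq> j" using planar_block_points[OF D] by blast
  then obtain k where "{Top k, Top (Suc k)} \<in> D"
    using planar_adjacent_cup[OF D, of i j] planar_adjacent_cup[OF D, of j i] ij
    by (metis insert_commute linorder_neqE_nat)
  then show ?thesis using planar_remove_cup[OF D] that stack_cup_diag by (metis le_diff_conv2)
qed

text \<open>An innermost cup or cap is split off, and a matching with neither is an identity.
  Planarity of composites is later proved along this induction instead of by a topological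
  argument.\<close>

lemma planar_induct [consumes 1, case_names id cup cap]:
  assumes "D \<in> planar_matchings m n"
    and id: "\<And>n. P n n (id_diag n)"
    and cup: "\<And>m n i D. D \<in> planar_matchings m n \<Longrightarrow> i \<le> n \<Longrightarrow> P m n D \<Longrightarrow>
        P m (n + 2) (stack (cup_diag i n) D)"
    and cap: "\<And>m n i D. D \<in> planar_matchings m n \<Longrightarrow> i \<le> m \<Longrightarrow> P m n D \<Longrightarrow>
        P (m + 2) n (stack D (flip (cup_diag i m)))"
  shows "P m n D"
  using assms(1)
proof (induction "m + n" arbitrary: m n D rule: less_induct)
  case less
  note D = less(2)
  consider (cup) i j where "{Top i, Top j} \<in> D" | (cap) i j where "{Bot i, Bot j} \<in> D"
    | (id) "\<And>i j. {Top i, Top j} \<notin> D" "\<And>i j. {Bot i, Bot j} \<notin> D" by blast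
  then show ?case
  proof cases
    case cup
    then have "i \<noteq> j" using planar_block_points[OF D] by blast
    then obtain k where k: "{Top k, Top (Suc k)} \<in> D"
      using planar_adjacent_cup[OF D, of i j] planar_adjacent_cup[OF D, of j i] cup
      by (metis insert_commute linorder_neqE_nat)
    obtain D' where D': "2 \<le> n" "k \<le> n - 2" "D' \<in> planar_matchings m (n - 2)" "D = add_cup k D'"
      using planar_remove_cup[OF D k] by metis
    then have "P m (n - 2 + 2) (stack (cup_diag k (n - 2)) D')"
      by (intro assms(3) less(1)) auto
    then show ?thesis using D' by (simp add: stack_cup_diag del: add_2_eq_Suc')
  next
    case cap
    let ?D = "flip D"
    note F = planar_flip[OF D]
    have ij: "{Top i, Top j} \<in> ?D" using cap by (simp add: doubleton_in_flip_iff)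
    then have "i \<noteq> j" using planar_block_points[OF F] by blast
    then obtain k where k: "{Top k, Top (Suc k)} \<in> ?D"
      using planar_adjacent_cup[OF F, of i j] planar_adjacent_cup[OF F, of j i] ij
      by (metis insert_commute linorder_neqE_nat)
    obtain D' where D': "2 \<le> m" "k \<le> m - 2" "D' \<in> planar_matchings n (m - 2)" "?D = add_cup k D'"
      using planar_remove_cup[OF F k] by metis
    then have eq: "D = stack (flip D') (flip (cup_diag k (m - 2)))"
      using stack_cup_diag[OF D'(3,2)] flip_stack by (metis flip_flip)
    have "P (m - 2 + 2) n (stack (flip D') (flip (cup_diag k (m - 2))))"
      using D' planar_flip[OF D'(3)] by (intro assms(4) less(1)) auto
    then show ?thesis using D' eq by (simp del: add_2_eq_Suc')
  next
    case id
    have "n \<le> m" using planar_no_cup(1)[OF D id(1)] .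
    moreover have "m \<le> n"
      by (rule planar_no_cup(1)[OF planar_flip[OF D]]) (use id(2) in \<open>simp add: doubleton_in_flip_iff\<close>)
    ultimately show ?thesis using planar_no_cup(2)[OF D id(1)] assms(2) by simp
  qed
qed

section \<open>Juxtaposition\<close>

lemma planar_widths:
  assumes "D \<in> planar_matchings m n" shows "bot_width D = m" "top_width D = n"
proof -
  have "{i. Bot i \<in> \<Union>D} = {..<m}" "{i. Top i \<in> \<Union>D} = {..<n}"
    unfolding Union_planar[OF assms] by auto
  then show "bot_width D = m" "top_width D = n" unfolding bot_width_def top_width_def by simp_all
qed

lemma juxtapose_planar:
  "D \<in> planar_matchings m n \<Longrightarrow> juxtapose D E = D \<union> (`) (shift_pt m n) ` E"
  by (simp add: juxtapose_def planar_widths)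

lemma shift_pt_eq_iff: "shift_pt m n x = shift_pt m n y \<longleftrightarrow> x = y"
  by (cases x; cases y) auto

lemma inj_shift_pt: "inj (shift_pt m n)"
  by (rule injI) (simp add: shift_pt_eq_iff)

lemma shift_pt_points:
  "shift_pt m n x \<in> points (m + m') (n + n') \<longleftrightarrow> x \<in> points m' n'" "shift_pt m n x \<notin> points m n"
  by (cases x; simp)+

lemma points_add: "points (m + m') (n + n') = points m n \<union> shift_pt m n ` points m' n'"
proof (intro set_eqI iffI)
  fix x assume x: "x \<in> points (m + m') (n + n')"
  show "x \<in> points m n \<union> shift_pt m n ` points m' n'"
  proof (cases "x \<in> points m n")
    case False
    then have "x = shift_pt m n (case x of Bot k \<Rightarrow> Bot (k - m) | Top k \<Rightarrow> Top (k - n))" by (cases x) auto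
    then show ?thesis using x shift_pt_points(1) by (metis UnI2 image_eqI)
  qed auto
next
  fix x assume "x \<in> points m n \<union> shift_pt m n ` points m' n'"
  then show "x \<in> points (m + m') (n + n')"
  proof
    assume "x \<in> points m n"
    then show ?thesis by (cases x) auto
  qed (auto simp: shift_pt_points(1))
qed

lemma planar_juxtapose:
  assumes D: "D \<in> planar_matchings m n" and E: "E \<in> planar_matchings m' n'"
  shows "juxtapose D E \<in> planar_matchings (m + m') (n + n')"
  unfolding juxtapose_planar[OF D]
proof (rule planarI)
  fix b assume "b \<in> D \<union> (`) (shift_pt m n) ` E"
  then consider "b \<in> D" | c where "c \<in> E" "b = shift_pt m n ` c" by auto
  then show "\<exists>x y. b = {x, y} \<and> x \<noteq> y \<and> x \<in> points (m + m') (n + n') \<and> y \<in> points (m + m') (n + n')"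
  proof cases
    case 1
    obtain x y where "b = {x, y}" "x \<noteq> y" using planar_block[OF D 1] .
    then show ?thesis using planar_block_points[OF D, of x y] 1 by (auto simp: points_add)
  next
    case 2
    obtain x y where "c = {x, y}" "x \<noteq> y" using planar_block[OF E 2(1)] .
    then show ?thesis using planar_block_points[OF E, of x y] 2
      by (intro exI[of _ "shift_pt m n x"] exI[of _ "shift_pt m n y"]) (simp add: shift_pt_eq_iff shift_pt_points)
  qed
next
  fix x assume "x \<in> points (m + m') (n + n')"
  then have "x \<in> \<Union>D \<or> x \<in> shift_pt m n ` \<Union>E"
    unfolding points_add Union_planar[OF D] Union_planar[OF E] by auto
  then show "\<exists>b\<in>D \<union> (`) (shift_pt m n) ` E. x \<in> b" by blast
next
  fix b c x assume *: "b \<in> D \<union> (`) (shift_pt m n) ` E" "c \<in> D \<union> (`) (shift_pt m n) ` E" "x \<in> b" "x \<in> c"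
  show "b = c"
  proof (cases "x \<in> points m n")
    case True
    then have "b \<in> D" "c \<in> D" using * shift_pt_points(2) by auto
    then show ?thesis using planar_blocks_eq[OF D] * by blast
  next
    case False
    then have "b \<notin> D" "c \<notin> D" using * unfolding Union_planar[OF D, symmetric] by auto
    then obtain b' c' where b'c': "b' \<in> E" "c' \<in> E" "b = shift_pt m n ` b'" "c = shift_pt m n ` c'"
      using * by blast
    then obtain x' where "x = shift_pt m n x'" "x' \<in> b'" "x' \<in> c'"
      using * by (auto simp: shift_pt_eq_iff)
    then show ?thesis using b'c' planar_blocks_eq[OF E, of b' c' x'] by simp
  qed
next
  let ?J = "D \<union> (`) (shift_pt m n) ` E"
  show "noncrossing ?J"
    unfolding noncrossing_def
  proof (intro notI, elim exE conjE)
    fix a b c d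
    assume *: "{a, b} \<in> ?J" "{c, d} \<in> ?J"
      and pos: "boundary_pos a < boundary_pos c" "boundary_pos c < boundary_pos b" "boundary_pos b < boundary_pos d"
    \<comment> \<open>The boundary positions of \<open>D\<close> form the interval from
      \<open>- n\<close> to \<open>m - 1\<close>. A strand has both ends inside it or both outside,
      so strands of the two halves do not interleave.\<close>
    have cases: "({x, y} \<in> D \<and> - int n \<le> boundary_pos x \<and> boundary_pos x < int m \<and>
          - int n \<le> boundary_pos y \<and> boundary_pos y < int m) \<or>
        (\<exists>x' y'. {x', y'} \<in> E \<and> x = shift_pt m n x' \<and> y = shift_pt m n y' \<and>
          \<not> (- int n \<le> boundary_pos x \<and> boundary_pos x < int m) \<and>
          \<not> (- int n \<le> boundary_pos y \<and> boundary_pos y < int m))" if xy: "{x, y} \<in> ?J" for x y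
    proof (cases "{x, y} \<in> D")
      case True
      then show ?thesis using planar_block_points[OF D True] by (cases x; cases y) auto
    next
      case False
      then obtain e where e: "e \<in> E" "{x, y} = shift_pt m n ` e" using xy by blast
      then obtain x' y' where "x = shift_pt m n x'" "y = shift_pt m n y'" by blast
      moreover from this have "shift_pt m n ` e = shift_pt m n ` {x', y'}" using e by simp
      then have "e = {x', y'}" by (simp only: inj_image_eq_iff[OF inj_shift_pt])
      ultimately show ?thesis using e
        by (intro disjI2 exI[of _ x'] exI[of _ y']) (cases x'; cases y'; auto)
    qed
    have shift_less: "boundary_pos x < boundary_pos y"
      if "boundary_pos (shift_pt m n x) < boundary_pos (shift_pt m n y)" for x y
      using that by (cases x; cases y) auto
    from cases[OF *(1)] show False
    proof (elim disjE conjE exE)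
      assume D1: "{a, b} \<in> D" "- int n \<le> boundary_pos a" "boundary_pos b < int m"
      then have "{c, d} \<in> D" using cases[OF *(2)] pos by auto
      then show False using planar_noncrossing[OF D D1(1)] pos by simp
    next
      fix a' b' assume D1: "{a', b'} \<in> E" "a = shift_pt m n a'" "b = shift_pt m n b'"
        "\<not> (- int n \<le> boundary_pos b \<and> boundary_pos b < int m)"
      then obtain c' d' where "{c', d'} \<in> E" "c = shift_pt m n c'" "d = shift_pt m n d'"
        using cases[OF *(2)] pos by auto
      then show False using planar_noncrossing[OF E D1(1), of c' d'] pos D1(2,3) shift_less by blast
    qed
  qed
qed

lemma shift_pt_shift_pt: "shift_pt m n (shift_pt m' n' x) = shift_pt (m + m') (n + n') x"
  by (cases x) auto

lemma juxtapose_assoc: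
  assumes "D \<in> planar_matchings m n" "E \<in> planar_matchings m' n'"
  shows "juxtapose (juxtapose D E) F = juxtapose D (juxtapose E F)"
  unfolding juxtapose_planar[OF planar_juxtapose[OF assms]]
  by (simp add: juxtapose_planar[OF assms(1)] juxtapose_planar[OF assms(2)] image_Un image_image
      shift_pt_shift_pt Un_assoc)

lemma id_diag_0: "id_diag 0 = {}"
  by (simp add: id_diag_def)

lemma juxtapose_id_0: "juxtapose D (id_diag 0) = D"
  by (simp add: juxtapose_def id_diag_0)

lemma id_0_juxtapose: "juxtapose (id_diag 0) D = D"
proof -
  have "shift_pt 0 0 = id" by (rule ext, case_tac x) auto
  then show ?thesis unfolding juxtapose_planar[OF planar_id_diag] by (simp add: id_diag_0)
qed

lemma lessThan_add_Un: "{..<m + n} = {..<m} \<union> (+) m ` {..<n}" for m n :: nat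
proof -
  have "(+) m ` {..<n} = {m..<m + n}"
    using image_add_atLeastLessThan[of m 0 n] by (simp add: lessThan_atLeast0 add.commute)
  then show ?thesis by auto
qed

lemma juxtapose_id_id: "juxtapose (id_diag m) (id_diag n) = id_diag (m + n)"
  unfolding juxtapose_planar[OF planar_id_diag]
  by (simp add: id_diag_altdef lessThan_add_Un image_Un image_image)

lemma flip_juxtapose:
  assumes "D \<in> planar_matchings m n"
  shows "flip (juxtapose D E) = juxtapose (flip D) (flip E)"
proof -
  have "flip_pt (shift_pt m n x) = shift_pt n m (flip_pt x)" for x by (cases x) auto
  then show ?thesis
    unfolding juxtapose_planar[OF assms] juxtapose_planar[OF planar_flip[OF assms]]
    by (simp add: flip_def image_Un image_image)
qed

lemma planar_cup: "{{Top 0, Top 1}} \<in> planar_matchings 0 2"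
proof (rule planarI)
  show "noncrossing {{Top 0, Top 1}}" by (auto simp: noncrossing_def doubleton_eq_iff)
  show "\<exists>x y. b = {x, y} \<and> x \<noteq> y \<and> x \<in> points 0 2 \<and> y \<in> points 0 2"
    if "b \<in> {{Top 0, Top 1}}" for b
    using that by (intro exI[of _ "Top 0"] exI[of _ "Top 1"]) simp
qed (auto simp: points_def less_2_cases_iff)

text \<open>Reduces the local relations between cups and caps to diagrams with very few points,
  padded by identities.\<close>

lemma cup_diag_juxtapose:
  assumes "i \<le> n"
  shows "cup_diag i n = juxtapose (id_diag i) (juxtapose {{Top 0, Top 1}} (id_diag (n - i)))"
proof -
  have "{..<n} = {..<i} \<union> (+) i ` {..<n - i}"
    using lessThan_add_Un[of i "n - i"] assms by simp
  then have "cup_diag i n = insert {Top i, Top (Suc i)}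
      ((\<lambda>j. {Bot j, Top j}) ` {..<i} \<union> (\<lambda>j. {Bot (i + j), Top (i + j + 2)}) ` {..<n - i})"
    by (simp add: cup_diag_def image_Un image_image ins_def)
  also have "\<dots> = juxtapose (id_diag i) (juxtapose {{Top 0, Top 1}} (id_diag (n - i)))"
    unfolding juxtapose_planar[OF planar_id_diag] juxtapose_planar[OF planar_cup]
    by (simp add: id_diag_altdef image_Un image_image ac_simps)
  finally show ?thesis .
qed

section \<open>Interchange of stacking and juxtaposition\<close>

definition shift_node :: "nat \<Rightarrow> nat \<Rightarrow> nat \<Rightarrow> nat \<times> nat \<Rightarrow> nat \<times> nat" where
  "shift_node m n k x = (fst x, (if fst x = 0 then m else if fst x = 1 then n else k) + snd x)"

lemma shift_node_pt:
  "shift_node m n k (lower x) = lower (shift_pt m n x)"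
  "shift_node m n k (upper x) = upper (shift_pt n k x)"
  "shift_node m n k (outer x) = outer (shift_pt m k x)"
  by (cases x; simp add: shift_node_def)+

lemma inj_shift_node: "inj (shift_node m n k)"
proof (rule injI)
  fix x y assume eq: "shift_node m n k x = shift_node m n k y"
  then have "fst x = fst y" by (simp add: shift_node_def)
  then show "x = y" using eq by (auto simp: shift_node_def prod_eq_iff split: if_splits)
qed

lemma fst_shift_node [simp]: "fst (shift_node m n k x) = fst x"
  by (simp add: shift_node_def)

lemma inj_outer: "inj outer"
  by (simp add: lev_abbrevs inj_lev)

context
  fixes m1 n1 k1 m2 n2 k2 :: nat and D1 E1 D2 E2 :: matching
  assumes D1: "D1 \<in> planar_matchings m1 n1" and E1: "E1 \<in> planar_matchings n1 k1"
    and D2: "D2 \<in> planar_matchings m2 n2" and E2: "E2 \<in> planar_matchings n2 k2"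
begin

lemma glued_juxtapose:
  "glued (juxtapose E1 E2) (juxtapose D1 D2) = glued E1 D1 \<union> (`) (shift_node m1 n1 k1) ` glued E2 D2"
  by (auto simp: glued_def juxtapose_planar[OF D1] juxtapose_planar[OF E1] image_Un image_image shift_node_pt)

lemma glued_disjoint: "\<Union>(glued E1 D1) \<inter> \<Union>((`) (shift_node m1 n1 k1) ` glued E2 D2) = {}"
proof -
  let ?w = "\<lambda>x. if fst x = 0 then m1 else if fst x = 1 then n1 else k1 :: nat"
  have "\<Union>(glued E1 D1) = upper ` \<Union>E1 \<union> lower ` \<Union>D1" by (auto simp: glued_def)
  then have sub: "snd x < ?w x" if "x \<in> \<Union>(glued E1 D1)" for x
    using that unfolding Union_planar[OF D1] Union_planar[OF E1] by (auto simp: points_def)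
  have "\<not> snd x < ?w x" if x: "x \<in> \<Union>((`) (shift_node m1 n1 k1) ` glued E2 D2)" for x
  proof -
    from x obtain y where "x = shift_node m1 n1 k1 y" by blast
    then show ?thesis by (simp add: shift_node_def)
  qed
  then show ?thesis using sub by (meson disjoint_iff)
qed

lemma connected_juxtapose:
  "connected_pts (juxtapose E1 E2) (juxtapose D1 D2) =
    connected_pts E1 D1 \<union> (map_prod (shift_node m1 n1 k1) (shift_node m1 n1 k1) ` block_rel (glued E2 D2))\<^sup>*"
  unfolding connected_pts_block_rel glued_juxtapose block_rel_Un block_rel_image[symmetric]
  by (rule rtrancl_Un_disjoint) (simp add: Field_block_rel glued_disjoint)

lemma connected_shift:
  assumes "(x, y) \<in> (map_prod (shift_node m1 n1 k1) (shift_node m1 n1 k1) ` block_rel (glued E2 D2))\<^sup>*"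
    and "x \<noteq> y"
  obtains x' y' where "x = shift_node m1 n1 k1 x'" "y = shift_node m1 n1 k1 y'" "(x', y') \<in> connected_pts E2 D2"
proof -
  obtain x' y' where x'y': "x = shift_node m1 n1 k1 x'" "y = shift_node m1 n1 k1 y'"
    using assms by (cases rule: rtrancl_cases_Field) auto
  then show ?thesis using that assms(1)
    by (simp add: rtrancl_map_prod_iff[OF inj_shift_node] connected_pts_block_rel)
qed

lemma no_loop_juxtapose:
  "no_loop (juxtapose E1 E2) (juxtapose D1 D2) \<longleftrightarrow> no_loop E1 D1 \<and> no_loop E2 D2"
proof
  assume nl: "no_loop (juxtapose E1 E2) (juxtapose D1 D2)"
  show "no_loop E1 D1 \<and> no_loop E2 D2"
  proof
    show "no_loop E1 D1" unfolding no_loop_def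
    proof
      fix x assume x: "x \<in> \<Union>(glued E1 D1)"
      then have "x \<in> \<Union>(glued (juxtapose E1 E2) (juxtapose D1 D2))" by (simp add: glued_juxtapose)
      then obtain y where y: "(x, y) \<in> connected_pts (juxtapose E1 E2) (juxtapose D1 D2)" "fst y \<noteq> 1"
        using nl unfolding no_loop_def by meson
      have "x \<notin> \<Union>((`) (shift_node m1 n1 k1) ` glued E2 D2)" using x glued_disjoint by blast
      then have "(x, y) \<in> connected_pts E1 D1"
        using y(1) rtrancl_block_rel_outside[of x "(`) (shift_node m1 n1 k1) ` glued E2 D2" y]
        unfolding connected_juxtapose block_rel_image[symmetric] by (auto simp: connected_pts_def)
      then show "\<exists>y. (x, y) \<in> connected_pts E1 D1 \<and> fst y \<noteq> 1" using y by blast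
    qed
    show "no_loop E2 D2" unfolding no_loop_def
    proof
      fix x assume x: "x \<in> \<Union>(glued E2 D2)"
      let ?x = "shift_node m1 n1 k1 x"
      have x': "?x \<in> \<Union>((`) (shift_node m1 n1 k1) ` glued E2 D2)" using x by blast
      then have "?x \<in> \<Union>(glued (juxtapose E1 E2) (juxtapose D1 D2))" unfolding glued_juxtapose by blast
      then obtain y where y: "(?x, y) \<in> connected_pts (juxtapose E1 E2) (juxtapose D1 D2)" "fst y \<noteq> 1"
        using nl unfolding no_loop_def by meson
      show "\<exists>y. (x, y) \<in> connected_pts E2 D2 \<and> fst y \<noteq> 1"
      proof (cases "?x = y")
        case True
        then show ?thesis using y by (intro exI[of _ x]) (auto simp: connected_pts_def)
      next
        case False
        have "?x \<notin> \<Union>(glued E1 D1)" using x' glued_disjoint by blast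
        then have "(?x, y) \<notin> connected_pts E1 D1"
          using False rtrancl_block_rel_outside connected_pts_block_rel by metis
        then obtain x'' y' where "?x = shift_node m1 n1 k1 x''" "y = shift_node m1 n1 k1 y'"
          "(x'', y') \<in> connected_pts E2 D2"
          using y(1) False connected_shift[of ?x y] unfolding connected_juxtapose by blast
        then show ?thesis using y(2) by (intro exI[of _ y']) (simp add: inj_eq[OF inj_shift_node])
      qed
    qed
  qed
next
  assume nl: "no_loop E1 D1 \<and> no_loop E2 D2"
  show "no_loop (juxtapose E1 E2) (juxtapose D1 D2)" unfolding no_loop_def
  proof
    fix x assume "x \<in> \<Union>(glued (juxtapose E1 E2) (juxtapose D1 D2))"
    then consider "x \<in> \<Union>(glued E1 D1)" | z where "z \<in> \<Union>(glued E2 D2)" "x = shift_node m1 n1 k1 z"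
      unfolding glued_juxtapose by blast
    then show "\<exists>y. (x, y) \<in> connected_pts (juxtapose E1 E2) (juxtapose D1 D2) \<and> fst y \<noteq> 1"
    proof cases
      case 1
      then obtain y where "(x, y) \<in> connected_pts E1 D1" "fst y \<noteq> 1" using nl unfolding no_loop_def by meson
      then show ?thesis unfolding connected_juxtapose by blast
    next
      case 2
      then obtain y where "(z, y) \<in> connected_pts E2 D2" "fst y \<noteq> 1" using nl unfolding no_loop_def by meson
      then show ?thesis unfolding connected_juxtapose using 2
        by (intro exI[of _ "shift_node m1 n1 k1 y"])
          (simp add: rtrancl_map_prod_iff[OF inj_shift_node] connected_pts_block_rel)
    qed
  qed
qed

text \<open>The two glued halves share no node, so no path passes from one to the other. Planarity
  of \<open>stack E1 D1\<close> ensures that \<open>juxtapose\<close> shifts by the widths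
  \<open>m1\<close> and \<open>k1\<close>; for composites without loops it is supplied later by
  \<open>planar_stack\<close>.\<close>

lemma stack_juxtapose:
  assumes "stack E1 D1 \<in> planar_matchings m1 k1"
  shows "stack (juxtapose E1 E2) (juxtapose D1 D2) = juxtapose (stack E1 D1) (stack E2 D2)"
  unfolding juxtapose_planar[OF assms]
proof (rule doubleton_set_eqI)
  fix b assume "b \<in> stack E1 D1 \<union> (`) (shift_pt m1 k1) ` stack E2 D2"
  then show "\<exists>x y. b = {x, y}" by (auto simp: stack_def)
next
  fix x y
  show "{x, y} \<in> stack (juxtapose E1 E2) (juxtapose D1 D2) \<longleftrightarrow>
      {x, y} \<in> stack E1 D1 \<union> (`) (shift_pt m1 k1) ` stack E2 D2"
  proof
    assume *: "{x, y} \<in> stack (juxtapose E1 E2) (juxtapose D1 D2)"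
    show "{x, y} \<in> stack E1 D1 \<union> (`) (shift_pt m1 k1) ` stack E2 D2"
    proof (cases "(outer x, outer y) \<in> connected_pts E1 D1")
      case True
      then show ?thesis using * by (auto simp: doubleton_in_stack_iff)
    next
      case False
      have ne: "x \<noteq> y" "outer x \<noteq> outer y" using * by (auto simp: doubleton_in_stack_iff inj_eq[OF inj_outer])
      have "(outer x, outer y) \<in> connected_pts (juxtapose E1 E2) (juxtapose D1 D2)"
        using * by (simp add: doubleton_in_stack_iff)
      then have "(outer x, outer y) \<in>
          (map_prod (shift_node m1 n1 k1) (shift_node m1 n1 k1) ` block_rel (glued E2 D2))\<^sup>*"
        using False unfolding connected_juxtapose by blast
      then obtain p q where pq: "outer x = shift_node m1 n1 k1 p" "outer y = shift_node m1 n1 k1 q"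
        "(p, q) \<in> connected_pts E2 D2"
        using connected_shift[OF _ ne(2)] by metis
      have "fst (outer z) \<in> {0, 2}" for z by (cases z) auto
      then have "fst p \<in> {0, 2}" "fst q \<in> {0, 2}" using pq(1,2) by (metis fst_shift_node)+
      then have "p \<in> range outer" "q \<in> range outer" by (auto simp: lev_abbrevs range_lev mem_Times_iff)
      then obtain x' y' where x'y': "p = outer x'" "q = outer y'" by blast
      then have "x = shift_pt m1 k1 x'" "y = shift_pt m1 k1 y'"
        using pq by (simp_all add: shift_node_pt inj_eq[OF inj_outer])
      moreover from this have "{x', y'} \<in> stack E2 D2" using pq x'y' ne by (auto simp: doubleton_in_stack_iff)
      ultimately have "{x, y} = shift_pt m1 k1 ` {x', y'}" "{x', y'} \<in> stack E2 D2" by auto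
      then show ?thesis by blast
    qed
  next
    assume "{x, y} \<in> stack E1 D1 \<union> (`) (shift_pt m1 k1) ` stack E2 D2"
    then consider "{x, y} \<in> stack E1 D1" | b where "b \<in> stack E2 D2" "{x, y} = shift_pt m1 k1 ` b" by auto
    then show "{x, y} \<in> stack (juxtapose E1 E2) (juxtapose D1 D2)"
    proof cases
      case 1
      then show ?thesis by (auto simp: doubleton_in_stack_iff connected_juxtapose)
    next
      case 2
      then obtain p q where pq: "b = {p, q}" "p \<noteq> q" "(outer p, outer q) \<in> connected_pts E2 D2"
        unfolding stack_def by blast
      then have "(shift_node m1 n1 k1 (outer p), shift_node m1 n1 k1 (outer q)) \<in>
          connected_pts (juxtapose E1 E2) (juxtapose D1 D2)"
        unfolding connected_juxtapose connected_pts_block_rel[of E2]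
        by (simp add: rtrancl_map_prod_iff[OF inj_shift_node])
      then have "{shift_pt m1 k1 p, shift_pt m1 k1 q} \<in> stack (juxtapose E1 E2) (juxtapose D1 D2)"
        using pq by (simp add: doubleton_in_stack_iff shift_pt_eq_iff shift_node_pt)
      then show ?thesis using 2 pq by simp
    qed
  qed
qed (auto simp: stack_def)

end

section \<open>Isotopy\<close>

lemma not_no_loop_cap_cup: "\<not> no_loop {{Bot 0, Bot 1}} {{Top 0, Top 1}}"
proof
  have g: "glued {{Bot 0, Bot 1}} {{Top 0, Top 1}} = {{(1, 0), (1, 1)}}" by (simp add: glued_def)
  have fst: "fst y = 1" if "((1, 0), y) \<in> connected_pts {{Bot 0, Bot 1}} {{Top 0, Top 1}}" for y
    using that unfolding connected_pts_block_rel g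
    by (induction rule: rtrancl_induct) (auto simp: block_rel_def)
  assume "no_loop {{Bot 0, Bot 1}} {{Top 0, Top 1}}"
  then show False using fst unfolding no_loop_def g by blast
qed

lemma
  defines "E \<equiv> {{Bot 0, Bot 1}, {Bot 2, Top 0}}" and "D \<equiv> {{Bot 0, Top 0}, {Top 1, Top 2}}"
  shows stack_zigzag: "stack E D = id_diag 1" and no_loop_zigzag: "no_loop E D"
proof -
  have g: "glued E D = {{(1, 0), (1, 1)}, {(1, 2), (2, 0)}, {(0, 0), (1, 0)}, {(1, 1), (1, 2)}}"
    by (auto simp: glued_def E_def D_def)
  have *: "{(1, 0), (1, 1), (1, 2), (2, 0)} \<times> {(0, 0)} \<subseteq> connected_pts E D"
  proof -
    have s: "(x, y) \<in> connected_pts E D" if "b \<in> glued E D" "x \<in> b" "y \<in> b" for b x y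
      using that unfolding connected_pts_block_rel block_rel_def by (intro r_into_rtrancl) blast
    have 1: "((1, 0), (0, 0)) \<in> connected_pts E D" by (rule s[of "{(0, 0), (1, 0)}"]) (auto simp: g)
    have 2: "((1, 1), (1, 0)) \<in> connected_pts E D" by (rule s[of "{(1, 0), (1, 1)}"]) (auto simp: g)
    have 3: "((1, 2), (1, 1)) \<in> connected_pts E D" by (rule s[of "{(1, 1), (1, 2)}"]) (auto simp: g)
    have 4: "((2, 0), (1, 2)) \<in> connected_pts E D" by (rule s[of "{(1, 2), (2, 0)}"]) (auto simp: g)
    show ?thesis using 1 2 3 4 connected_pts_trans by blast
  qed
  show "no_loop E D"
    unfolding no_loop_def
  proof
    fix x assume "x \<in> \<Union>(glued E D)"
    then have "x = (0, 0) \<or> (x, (0, 0)) \<in> connected_pts E D" using * by (auto simp: g)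
    then show "\<exists>y. (x, y) \<in> connected_pts E D \<and> fst y \<noteq> 1"
      by (intro exI[of _ "(0, 0)"]) (auto simp: connected_pts_def)
  qed
  have id1: "id_diag 1 = {{Bot 0, Top 0}}" by (auto simp: id_diag_def)
  \<comment> \<open>The whole middle lies on the single strand and is collapsed to its top end; only
    the bottom segment remains as a block.\<close>
  define f where "f x = (if fst x = 0 then Bot (snd x) else if fst x = 1 then Top 0 else Top (snd x))"
    for x :: "nat \<times> nat"
  show "stack E D = id_diag 1"
  proof (rule stack_eqI[where f = f])
    show "f (outer x) = x" for x by (cases x) (auto simp: f_def)
    show "(outer x, outer y) \<in> connected_pts E D" if "{x, y} \<in> id_diag 1" "x \<noteq> y" for x y
    proof -
      have "{x, y} = {Bot 0, Top 0}" using that unfolding id1 by simp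
      moreover have "(outer (Top 0), outer (Bot 0)) \<in> connected_pts E D" using * by simp
      moreover from connected_pts_sym[OF this] have "(outer (Bot 0), outer (Top 0)) \<in> connected_pts E D" .
      ultimately show ?thesis by (auto simp only: doubleton_eq_iff)
    qed
    show "\<exists>x y. b = {x, y} \<and> x \<noteq> y" if "b \<in> id_diag 1" for b
      using that unfolding id1 by blast
  qed (auto simp: id1 g f_def insert_commute simp del: One_nat_def)
qed

lemma cup_diag_0_0: "cup_diag 0 0 = {{Top 0, Top 1}}"
  by (simp add: cup_diag_def)

lemma id_juxtapose_cup_diag:
  assumes "i \<le> n" shows "juxtapose (id_diag k) (cup_diag i n) = cup_diag (k + i) (k + n)"
  using assms
  by (simp add: cup_diag_juxtapose juxtapose_id_id flip: juxtapose_assoc[OF planar_id_diag planar_id_diag])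

lemma planar_cup_diag: "i \<le> n \<Longrightarrow> cup_diag i n \<in> planar_matchings n (n + 2)"
  using planar_add_cup[OF planar_id_diag, of i n]
  by (simp add: cup_diag_def add_cup_def id_diag_altdef image_image)

lemma cup_diag_juxtapose_id:
  assumes "i \<le> n" shows "juxtapose (cup_diag i n) (id_diag k) = cup_diag i (n + k)"
proof -
  note id = planar_id_diag
  have "juxtapose (cup_diag i n) (id_diag k) =
      juxtapose (id_diag i) (juxtapose (juxtapose {{Top 0, Top 1}} (id_diag (n - i))) (id_diag k))"
    unfolding cup_diag_juxtapose[OF assms]
    by (rule juxtapose_assoc[OF id planar_juxtapose[OF planar_cup id]])
  also have "\<dots> = cup_diag i (n + k)"
    unfolding juxtapose_assoc[OF planar_cup id] juxtapose_id_id
    using assms by (subst cup_diag_juxtapose) simp_all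
  finally show ?thesis .
qed

lemma planar_cap_diag: "i \<le> n \<Longrightarrow> flip (cup_diag i n) \<in> planar_matchings (n + 2) n"
  by (rule planar_flip[OF planar_cup_diag])

text \<open>Two diagrams side by side may be put at either relative height; comparing the two orders
  gives the commutation of distant cups and caps.\<close>

lemma
  assumes X: "X \<in> planar_matchings a b" and Y: "Y \<in> planar_matchings c d"
  shows stack_juxtapose_left: "stack (juxtapose X (id_diag d)) (juxtapose (id_diag a) Y) = juxtapose X Y"
    and stack_juxtapose_right: "stack (juxtapose (id_diag b) Y) (juxtapose X (id_diag c)) = juxtapose X Y"
  using X Y
  by (simp_all add: stack_juxtapose[OF planar_id_diag X Y planar_id_diag]
      stack_juxtapose[OF X planar_id_diag planar_id_diag Y] stack_id_diag_right stack_id_diag)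

lemma flip_cup_diag_juxtapose_id:
  "i \<le> n \<Longrightarrow> juxtapose (flip (cup_diag i n)) (id_diag k) = flip (cup_diag i (n + k))"
  by (simp add: flip_juxtapose[OF planar_cup_diag] flip_id_diag flip: cup_diag_juxtapose_id)

lemma id_juxtapose_flip_cup_diag:
  "i \<le> n \<Longrightarrow> juxtapose (id_diag k) (flip (cup_diag i n)) = flip (cup_diag (k + i) (k + n))"
  by (simp add: flip_juxtapose[OF planar_id_diag] flip_id_diag flip: id_juxtapose_cup_diag)

lemma not_no_loop_cap_cup_diag:
  assumes "i \<le> n" shows "\<not> no_loop (flip (cup_diag i n)) (cup_diag i n)"
proof -
  have 1: "cup_diag i n = juxtapose (id_diag i) (cup_diag 0 (n - i))"
    using assms by (simp add: id_juxtapose_cup_diag)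
  have 2: "cup_diag 0 (n - i) = juxtapose (cup_diag 0 0) (id_diag (n - i))"
    by (simp add: cup_diag_juxtapose_id)
  have "flip (cup_diag 0 0) = {{Bot 0, Bot 1}}" by (simp add: cup_diag_0_0 flip_def)
  then have "\<not> no_loop (flip (cup_diag 0 0)) (cup_diag 0 0)"
    using not_no_loop_cap_cup by (simp add: cup_diag_0_0)
  moreover have p: "cup_diag 0 0 \<in> planar_matchings 0 2" "flip (cup_diag 0 0) \<in> planar_matchings 2 0"
    using planar_cup_diag[of 0 0] planar_cap_diag[of 0 0] by (simp_all add: numeral_2_eq_2)
  ultimately have "\<not> no_loop (flip (cup_diag 0 (n - i))) (cup_diag 0 (n - i))"
    unfolding 2 flip_juxtapose[OF p(1)] flip_id_diag
    by (simp add: no_loop_juxtapose[OF p planar_id_diag planar_id_diag])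
  then show ?thesis
    unfolding 1 flip_juxtapose[OF planar_id_diag] flip_id_diag
    by (simp add: no_loop_juxtapose[OF planar_id_diag planar_id_diag planar_cup_diag planar_cap_diag])
qed

text \<open>The zigzag on one strand, with identities juxtaposed on both sides.\<close>

lemma
  assumes "i < n"
  shows stack_cap_cup_Suc: "stack (flip (cup_diag i n)) (cup_diag (Suc i) n) = id_diag n"
    and no_loop_cap_cup_Suc: "no_loop (flip (cup_diag i n)) (cup_diag (Suc i) n)"
proof -
  let ?r = "n - 1 - i"
  note id = planar_id_diag
  have cup: "cup_diag (Suc i) n = juxtapose (id_diag i) (juxtapose (cup_diag 1 1) (id_diag ?r))"
    using assms by (simp add: id_juxtapose_cup_diag cup_diag_juxtapose_id)
  have cap: "flip (cup_diag i n) = juxtapose (id_diag i) (juxtapose (flip (cup_diag 0 1)) (id_diag ?r))"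
    using assms by (simp add: id_juxtapose_flip_cup_diag flip_cup_diag_juxtapose_id)
  have "cup_diag 1 1 = {{Bot 0, Top 0}, {Top 1, Top 2}}" "flip (cup_diag 0 1) = {{Bot 0, Bot 1}, {Bot 2, Top 0}}"
    by (simp_all add: cup_diag_def flip_def ins_def numeral_2_eq_2 insert_commute lessThan_Suc)
  then have z: "stack (flip (cup_diag 0 1)) (cup_diag 1 1) = id_diag 1" "no_loop (flip (cup_diag 0 1)) (cup_diag 1 1)"
    using stack_zigzag no_loop_zigzag by simp_all
  have p: "cup_diag 1 1 \<in> planar_matchings 1 3" "flip (cup_diag 0 1) \<in> planar_matchings 3 1"
    using planar_cup_diag[of 1 1] planar_cap_diag[of 0 1] by (simp_all add: numeral_3_eq_3)
  have q: "juxtapose (cup_diag 1 1) (id_diag ?r) \<in> planar_matchings (1 + ?r) (3 + ?r)"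
    "juxtapose (flip (cup_diag 0 1)) (id_diag ?r) \<in> planar_matchings (3 + ?r) (1 + ?r)"
    using planar_juxtapose[OF p(1) id] planar_juxtapose[OF p(2) id] by auto
  have *: "stack (juxtapose (flip (cup_diag 0 1)) (id_diag ?r)) (juxtapose (cup_diag 1 1) (id_diag ?r)) = id_diag (1 + ?r)"
    by (simp only: stack_juxtapose[OF p id id] z id stack_id_diag[OF id] juxtapose_id_id)
  have "stack (flip (cup_diag i n)) (cup_diag (Suc i) n) = id_diag (i + (1 + ?r))"
    unfolding cup cap
    by (simp only: stack_juxtapose[OF id id q] stack_id_diag[OF id] id * juxtapose_id_id)
  then show "stack (flip (cup_diag i n)) (cup_diag (Suc i) n) = id_diag n"
    using assms by simp
  have "no_loop (juxtapose (flip (cup_diag 0 1)) (id_diag ?r)) (juxtapose (cup_diag 1 1) (id_diag ?r))"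
    by (simp only: no_loop_juxtapose[OF p id id] z no_loop_id_diag[OF id])
  then show "no_loop (flip (cup_diag i n)) (cup_diag (Suc i) n)"
    unfolding cup cap by (simp only: no_loop_juxtapose[OF id id q] no_loop_id_diag[OF id])
qed

lemma stack_cap_Suc_cup:
  "i < n \<Longrightarrow> stack (flip (cup_diag (Suc i) n)) (cup_diag i n) = id_diag n"
  by (metis flip_flip flip_id_diag flip_stack stack_cap_cup_Suc)

lemma no_loop_cap_Suc_cup: "i < n \<Longrightarrow> no_loop (flip (cup_diag (Suc i) n)) (cup_diag i n)"
  using no_loop_flip[of "cup_diag (Suc i) n" "flip (cup_diag i n)"] no_loop_cap_cup_Suc by simp

text \<open>Both sides equal \<open>juxtapose X Y\<close>, where \<open>X\<close> is the cap on the
  first \<open>j\<close> points and \<open>Y\<close> is the cup to the right of them.\<close>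

lemma stack_cap_cup_far:
  assumes "i + 2 \<le> j" "j \<le> n"
  shows "stack (flip (cup_diag i n)) (cup_diag j n) = stack (cup_diag (j - 2) (n - 2)) (flip (cup_diag i (n - 2)))"
proof -
  let ?X = "flip (cup_diag i (j - 2))" and ?Y = "cup_diag 0 (n - j)"
  have X: "?X \<in> planar_matchings j (j - 2)" using planar_cap_diag[of i "j - 2"] assms by (simp del: add_2_eq_Suc')
  have Y: "?Y \<in> planar_matchings (n - j) (n - j + 2)" by (rule planar_cup_diag) simp
  have "flip (cup_diag i n) = juxtapose ?X (id_diag (n - j + 2))"
    "cup_diag j n = juxtapose (id_diag j) ?Y"
    "cup_diag (j - 2) (n - 2) = juxtapose (id_diag (j - 2)) ?Y"
    "flip (cup_diag i (n - 2)) = juxtapose ?X (id_diag (n - j))"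
    using assms by (simp_all add: flip_cup_diag_juxtapose_id id_juxtapose_cup_diag del: add_2_eq_Suc')
  then show ?thesis using stack_juxtapose_left[OF X Y] stack_juxtapose_right[OF X Y] by simp
qed

lemma stack_cap_cup_far':
  assumes "j + 2 \<le> i" "i \<le> n"
  shows "stack (flip (cup_diag i n)) (cup_diag j n) = stack (cup_diag j (n - 2)) (flip (cup_diag (i - 2) (n - 2)))"
  using arg_cong[OF stack_cap_cup_far[OF assms], of flip] by (simp add: flip_stack)

section \<open>Planarity of composites\<close>

lemma no_loop_planar_assoc:
  assumes "D \<in> planar_matchings m n" "E \<in> planar_matchings n k" "F \<in> planar_matchings k l"
  shows "no_loop E D \<and> no_loop F (stack E D) \<longleftrightarrow> no_loop F E \<and> no_loop (stack F E) D"
  by (rule no_loop_assoc) (simp_all only: Union_planar[OF assms(1)] Union_planar[OF assms(2)] Union_planar[OF assms(3)] points_simps)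

lemma
  assumes D: "D \<in> planar_matchings m n" and i: "i \<le> m"
  shows planar_stack_cap: "stack D (flip (cup_diag i m)) \<in> planar_matchings (m + 2) n"
    and no_loop_cap_diag: "no_loop D (flip (cup_diag i m))"
proof -
  note F = planar_flip[OF D]
  have "stack (cup_diag i m) (flip D) \<in> planar_matchings n (m + 2)"
    using planar_add_cup[OF F i] stack_cup_diag[OF F i] by simp
  then show "stack D (flip (cup_diag i m)) \<in> planar_matchings (m + 2) n"
    using planar_flip flip_stack by (metis flip_flip)
  show "no_loop D (flip (cup_diag i m))"
    using no_loop_cup_diag[OF F i] no_loop_flip[of "flip D" "cup_diag i m"] by simp
qed

text \<open>Induction on \<open>D\<close>. A cap put on a topmost cup closes a loop, which is
  excluded, or forms a zigzag with it, or slides below it onto the rest of \<open>D\<close>, where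
  the induction hypothesis applies.\<close>

lemma planar_cap_stack:
  assumes "D \<in> planar_matchings m n" "i + 2 \<le> n" "no_loop (flip (cup_diag i (n - 2))) D"
  shows "stack (flip (cup_diag i (n - 2))) D \<in> planar_matchings m (n - 2)"
  using assms
proof (induction arbitrary: i rule: planar_induct)
  case (id n)
  then have cap: "flip (cup_diag i (n - 2)) \<in> planar_matchings n (n - 2)"
    using planar_cap_diag[of i "n - 2"] by (simp del: add_2_eq_Suc')
  then show ?case by (simp add: stack_id_diag_right)
next
  case (cap m n j D)
  note [simp del] = add_2_eq_Suc'
  have c: "flip (cup_diag i (n - 2)) \<in> planar_matchings n (n - 2)"
    using planar_cap_diag[of i "n - 2"] cap.prems by simp
  have "no_loop (flip (cup_diag i (n - 2))) D"
    using no_loop_planar_assoc[OF planar_cap_diag[OF cap.hyps(2)] cap.hyps(1) c] cap.prems(2)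
      no_loop_cap_diag[OF cap.hyps(1,2)] by blast
  then have "stack (flip (cup_diag i (n - 2))) D \<in> planar_matchings m (n - 2)" using cap.IH cap.prems by blast
  then show ?case unfolding stack_assoc using planar_stack_cap cap.hyps(2) by blast
next
  case (cup m n j D)
  note [simp del] = add_2_eq_Suc'
  note D = cup.hyps(1)
  have i: "i \<le> n" using cup.prems(1) by simp
  note assoc = no_loop_planar_assoc[OF D planar_cup_diag[OF cup.hyps(2)] planar_cap_diag[OF i]]
  have nl: "no_loop (flip (cup_diag i n)) (cup_diag j n)" "no_loop (stack (flip (cup_diag i n)) (cup_diag j n)) D"
    using assoc cup.prems(2) no_loop_cup_diag[OF D cup.hyps(2)] by simp_all
  have "i \<noteq> j" using nl(1) not_no_loop_cap_cup_diag[OF i] by blast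
  then consider "j = Suc i" | "i = Suc j" | "i + 2 \<le> j" | "j + 2 \<le> i" by linarith
  then have "stack (stack (flip (cup_diag i n)) (cup_diag j n)) D \<in> planar_matchings m n"
  proof cases
    case 1
    then show ?thesis using cup.hyps by (simp add: stack_cap_cup_Suc stack_id_diag)
  next
    case 2
    then show ?thesis using D i by (simp add: stack_cap_Suc_cup stack_id_diag)
  next
    case 3
    have n: "n - 2 + 2 = n" "j - 2 \<le> n - 2" "i \<le> n - 2" using 3 cup.hyps(2) by auto
    have c: "cup_diag (j - 2) (n - 2) \<in> planar_matchings (n - 2) n" "flip (cup_diag i (n - 2)) \<in> planar_matchings n (n - 2)"
      using planar_cup_diag[OF n(2)] planar_cap_diag[OF n(3)] n(1) by simp_all
    note eq = stack_cap_cup_far[OF 3 cup.hyps(2)]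
    \<comment> \<open>After the exchange the cap meets \<open>D\<close> directly; reassociating
      transfers the absence of loops, as the induction hypothesis requires.\<close>
    have "no_loop (flip (cup_diag i (n - 2))) D"
      using no_loop_planar_assoc[OF D c(2,1)] no_loop_cup_diag[OF c(2) n(2)] nl(2) unfolding eq by blast
    then have *: "stack (flip (cup_diag i (n - 2))) D \<in> planar_matchings m (n - 2)" using cup.IH n(3) 3 cup.hyps(2) by simp
    then show ?thesis
      using planar_add_cup[OF * n(2)] n(1) unfolding eq stack_assoc[symmetric] stack_cup_diag[OF * n(2)] by simp
  next
    case 4
    have n: "n - 2 + 2 = n" "j \<le> n - 2" "i - 2 \<le> n - 2" using 4 i by auto
    have c: "cup_diag j (n - 2) \<in> planar_matchings (n - 2) n" "flip (cup_diag (i - 2) (n - 2)) \<in> planar_matchings n (n - 2)"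
      using planar_cup_diag[OF n(2)] planar_cap_diag[OF n(3)] n(1) by simp_all
    note eq = stack_cap_cup_far'[OF 4 i]
    have "no_loop (flip (cup_diag (i - 2) (n - 2))) D"
      using no_loop_planar_assoc[OF D c(2,1)] no_loop_cup_diag[OF c(2) n(2)] nl(2) unfolding eq by blast
    then have *: "stack (flip (cup_diag (i - 2) (n - 2))) D \<in> planar_matchings m (n - 2)" using cup.IH n(3) 4 i by simp
    then show ?thesis
      using planar_add_cup[OF * n(2)] n(1) unfolding eq stack_assoc[symmetric] stack_cup_diag[OF * n(2)] by simp
  qed
  then show ?case by (simp add: stack_assoc)
qed

text \<open>Induction on the upper diagram. A cup at its top is harmless by
  \<open>planar_add_cup\<close>; a cap at its bottom is first applied to \<open>D\<close> by
  \<open>planar_cap_stack\<close>.\<close>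

lemma planar_stack:
  assumes "E \<in> planar_matchings n k" "D \<in> planar_matchings m n" "no_loop E D"
  shows "stack E D \<in> planar_matchings m k"
  using assms
proof (induction arbitrary: D rule: planar_induct)
  case (id n)
  then show ?case by (simp add: stack_id_diag)
next
  case (cup n k i E)
  have "no_loop E D"
    using no_loop_planar_assoc[OF cup.prems(1) cup.hyps(1) planar_cup_diag[OF cup.hyps(2)]] cup.prems(2)
      no_loop_cup_diag[OF cup.hyps] by blast
  then have *: "stack E D \<in> planar_matchings m k" using cup.IH cup.prems(1) by blast
  then show ?case
    using planar_add_cup[OF * cup.hyps(2)] unfolding stack_assoc[symmetric] stack_cup_diag[OF * cup.hyps(2)] by simp
next
  case (cap n k i E)
  have nl: "no_loop (flip (cup_diag i n)) D" "no_loop E (stack (flip (cup_diag i n)) D)"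
    using no_loop_planar_assoc[OF cap.prems(1) planar_cap_diag[OF cap.hyps(2)] cap.hyps(1)] cap.prems(2)
      no_loop_cap_diag[OF cap.hyps] by blast+
  have "stack (flip (cup_diag i n)) D \<in> planar_matchings m n"
    using planar_cap_stack[OF cap.prems(1)] nl(1) cap.hyps(2) by simp
  then show ?case unfolding stack_assoc[symmetric] using cap.IH nl(2) by blast
qed

section \<open>Linear combinations of diagrams\<close>

lemma lookup_scale [simp]: "Poly_Mapping.lookup (c \<cdot> f) D = c * Poly_Mapping.lookup f D"
  by (simp add: scale_def Poly_Mapping.map.rep_eq when_def)

lemma scale_simps:
  "c \<cdot> (f + g) = c \<cdot> f + c \<cdot> g" "(c + d) \<cdot> f = c \<cdot> f + d \<cdot> f" "c \<cdot> d \<cdot> f = (c * d) \<cdot> f"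
  "1 \<cdot> f = f" "0 \<cdot> f = 0" "c \<cdot> 0 = 0" "c \<cdot> (f - g) = c \<cdot> f - c \<cdot> g" "- f = (- 1) \<cdot> f"
  "c \<cdot> Poly_Mapping.single D a = Poly_Mapping.single D (c * a)"
  by (auto intro!: poly_mapping_eqI simp: lookup_add lookup_minus lookup_single when_def algebra_simps)

lemma poly_mapping_sum_single:
  "(\<Sum>D\<in>Poly_Mapping.keys f. Poly_Mapping.single D (Poly_Mapping.lookup f D)) = f"
  by (rule poly_mapping_eqI) (auto simp: lookup_sum lookup_single when_def in_keys_iff sum.delta')

lemma Hom_simps [simp]:
  "0 \<in> Hom m n" "f \<in> Hom m n \<Longrightarrow> g \<in> Hom m n \<Longrightarrow> f + g \<in> Hom m n"
  "f \<in> Hom m n \<Longrightarrow> g \<in> Hom m n \<Longrightarrow> f - g \<in> Hom m n"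
  "f \<in> Hom m n \<Longrightarrow> c \<cdot> f \<in> Hom m n" "f \<in> Hom m n \<Longrightarrow> - f \<in> Hom m n"
  "D \<in> planar_matchings m n \<Longrightarrow> Poly_Mapping.single D a \<in> Hom m n"
  by (auto simp: Hom_def in_keys_iff subset_iff lookup_add lookup_minus lookup_single when_def)
    (metis add.right_neutral)+

lemma Hom_induct [consumes 1, case_names zero add]:
  assumes "f \<in> Hom m n" and "P 0"
    and "\<And>D c g. D \<in> planar_matchings m n \<Longrightarrow> g \<in> Hom m n \<Longrightarrow> P g \<Longrightarrow> P (Poly_Mapping.single D c + g)"
  shows "P f"
proof -
  let ?s = "\<lambda>S. \<Sum>D\<in>S. Poly_Mapping.single D (Poly_Mapping.lookup f D)"
  have "P (?s S) \<and> ?s S \<in> Hom m n" if "finite S" "S \<subseteq> planar_matchings m n" for S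
    using that by (induction rule: finite_induct) (auto simp: assms)
  from this[of "Poly_Mapping.keys f"] show ?thesis
    using assms(1) by (simp add: poly_mapping_sum_single Hom_def)
qed

lemma Hom_ext:
  assumes "f \<in> Hom m n"
    and add: "\<And>f g. \<phi> (f + g) = \<phi> f + (\<phi> g :: 'a :: ab_group_add)" "\<And>f g. \<psi> (f + g) = \<psi> f + \<psi> g"
    and eq: "\<And>D c. D \<in> planar_matchings m n \<Longrightarrow> \<phi> (Poly_Mapping.single D c) = \<psi> (Poly_Mapping.single D c)"
  shows "\<phi> f = \<psi> f"
  using assms(1)
proof (induction rule: Hom_induct)
  case zero
  show ?case using add[of 0 0] by simp
qed (simp add: add eq)

text \<open>Common form of \<open>tensor\<close>, with weight 1, and \<open>comp\<close>, with a
  power of the loop value as weight, so that bilinearity is proved once.\<close>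

definition bilinear_ext :: "(matching \<Rightarrow> matching \<Rightarrow> matching) \<Rightarrow> (matching \<Rightarrow> matching \<Rightarrow> 'k) \<Rightarrow>
    'k::field tl \<Rightarrow> 'k tl \<Rightarrow> 'k tl" where
  "bilinear_ext h w f g = (\<Sum>D\<in>Poly_Mapping.keys f. \<Sum>E\<in>Poly_Mapping.keys g.
     Poly_Mapping.single (h D E) (Poly_Mapping.lookup f D * Poly_Mapping.lookup g E * w D E))"

text \<open>Supports change under addition and scaling; a common larger index set makes the sums
  comparable term by term.\<close>

lemma bilinear_ext_superset:
  assumes "finite A" "finite B" "Poly_Mapping.keys f \<subseteq> A" "Poly_Mapping.keys g \<subseteq> B"
  shows "bilinear_ext h w f g = (\<Sum>D\<in>A. \<Sum>E\<in>B.
     Poly_Mapping.single (h D E) (Poly_Mapping.lookup f D * Poly_Mapping.lookup g E * w D E))"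
proof -
  have "bilinear_ext h w f g = (\<Sum>D\<in>A. \<Sum>E\<in>Poly_Mapping.keys g.
     Poly_Mapping.single (h D E) (Poly_Mapping.lookup f D * Poly_Mapping.lookup g E * w D E))"
    unfolding bilinear_ext_def
    by (rule sum.mono_neutral_left) (use assms in \<open>auto simp: in_keys_iff\<close>)
  also have "\<dots> = (\<Sum>D\<in>A. \<Sum>E\<in>B.
     Poly_Mapping.single (h D E) (Poly_Mapping.lookup f D * Poly_Mapping.lookup g E * w D E))"
    by (rule sum.cong[OF refl], rule sum.mono_neutral_left) (use assms in \<open>auto simp: in_keys_iff\<close>)
  finally show ?thesis .
qed

lemma bilinear_ext_add_left:
  "bilinear_ext h w (f + f') g = bilinear_ext h w f g + bilinear_ext h w f' g"
proof -
  let ?A = "Poly_Mapping.keys f \<union> Poly_Mapping.keys f'"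
  note b = bilinear_ext_superset[of ?A "Poly_Mapping.keys g" _ g]
  show ?thesis using keys_add[of f f']
    by (simp add: b lookup_add single_add algebra_simps sum.distrib)
qed

lemma bilinear_ext_add_right:
  "bilinear_ext h w f (g + g') = bilinear_ext h w f g + bilinear_ext h w f g'"
proof -
  let ?B = "Poly_Mapping.keys g \<union> Poly_Mapping.keys g'"
  note b = bilinear_ext_superset[of "Poly_Mapping.keys f" ?B f]
  show ?thesis using keys_add[of g g']
    by (simp add: b lookup_add single_add algebra_simps sum.distrib)
qed

lemma bilinear_ext_single:
  "bilinear_ext h w (Poly_Mapping.single D a) (Poly_Mapping.single E b) =
   Poly_Mapping.single (h D E) (a * b * w D E)"
  by (subst bilinear_ext_superset[of "{D}" "{E}"]) auto

lemma scale_sum: "c \<cdot> (\<Sum>x\<in>S. f x) = (\<Sum>x\<in>S. c \<cdot> f x)"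
  by (induction S rule: infinite_finite_induct) (auto simp: scale_simps)

lemma bilinear_ext_scale:
  "bilinear_ext h w (c \<cdot> f) g = c \<cdot> bilinear_ext h w f g"
  "bilinear_ext h w f (c \<cdot> g) = c \<cdot> bilinear_ext h w f g"
proof -
  have "Poly_Mapping.keys (c \<cdot> f) \<subseteq> Poly_Mapping.keys f" for f :: "'a tl" by (auto simp: in_keys_iff)
  then show "bilinear_ext h w (c \<cdot> f) g = c \<cdot> bilinear_ext h w f g"
    "bilinear_ext h w f (c \<cdot> g) = c \<cdot> bilinear_ext h w f g"
    by (simp_all add: bilinear_ext_superset[of "Poly_Mapping.keys f" "Poly_Mapping.keys g"] scale_sum
        scale_simps ac_simps)
qed

lemma tensor_bilinear_ext: "f \<otimes> g = bilinear_ext juxtapose (\<lambda>_ _. 1) f g"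
  by (simp add: tensor_def bilinear_ext_def)

lemma tensor_zero [simp]: "0 \<otimes> f = 0" "f \<otimes> 0 = 0"
  by (simp_all add: tensor_def)

lemma tensor_linear:
  "(f + g) \<otimes> h = f \<otimes> h + g \<otimes> h" "h \<otimes> (f + g) = h \<otimes> f + h \<otimes> g"
  "(c \<cdot> f) \<otimes> g = c \<cdot> (f \<otimes> g)" "f \<otimes> (c \<cdot> g) = c \<cdot> (f \<otimes> g)"
  "(f - g) \<otimes> h = f \<otimes> h - g \<otimes> h" "h \<otimes> (f - g) = h \<otimes> f - h \<otimes> g"
proof -
  show *: "(f + g) \<otimes> h = f \<otimes> h + g \<otimes> h" "h \<otimes> (f + g) = h \<otimes> f + h \<otimes> g"
    "(c \<cdot> f) \<otimes> g = c \<cdot> (f \<otimes> g)" "f \<otimes> (c \<cdot> g) = c \<cdot> (f \<otimes> g)" for f g h :: "'a tl" and c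
    by (simp_all add: tensor_bilinear_ext bilinear_ext_add_left bilinear_ext_add_right bilinear_ext_scale)
  have "(f - g) \<otimes> h + g \<otimes> h = f \<otimes> h" "h \<otimes> (f - g) + h \<otimes> g = h \<otimes> f" by (simp_all flip: *)
  then show "(f - g) \<otimes> h = f \<otimes> h - g \<otimes> h" "h \<otimes> (f - g) = h \<otimes> f - h \<otimes> g" by (simp_all add: eq_diff_eq)
qed

lemma tensor_single:
  "Poly_Mapping.single D a \<otimes> Poly_Mapping.single E b = Poly_Mapping.single (juxtapose D E) (a * b)"
  by (simp add: tensor_bilinear_ext bilinear_ext_single)

lemma tensor_Hom [simp]:
  assumes "f \<in> Hom m n" "g \<in> Hom m' n'" shows "f \<otimes> g \<in> Hom (m + m') (n + n')"
  using assms(1)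
proof (induction rule: Hom_induct)
  case (add D c f)
  have "Poly_Mapping.single D c \<otimes> g \<in> Hom (m + m') (n + n')"
    using assms(2)
    by (induction rule: Hom_induct) (auto simp: tensor_linear tensor_single planar_juxtapose add)
  then show ?case using add by (simp add: tensor_linear)
qed simp

lemma tensor_assoc:
  assumes "f \<in> Hom m n" "g \<in> Hom m' n'" shows "(f \<otimes> g) \<otimes> h = f \<otimes> (g \<otimes> h)"
  using assms(1)
proof (rule Hom_ext)
  fix D c assume D: "D \<in> planar_matchings m n"
  show "(Poly_Mapping.single D c \<otimes> g) \<otimes> h = Poly_Mapping.single D c \<otimes> (g \<otimes> h)"
    using assms(2)
  proof (rule Hom_ext)
    fix E d assume E: "E \<in> planar_matchings m' n'"
    have "(Poly_Mapping.single D c \<otimes> Poly_Mapping.single E d) \<otimes> (\<Sum>F\<in>S. Poly_Mapping.single F (w F)) =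
        Poly_Mapping.single D c \<otimes> (Poly_Mapping.single E d \<otimes> (\<Sum>F\<in>S. Poly_Mapping.single F (w F)))" for S w
      by (induction S rule: infinite_finite_induct)
        (auto simp: tensor_linear tensor_single juxtapose_assoc[OF D E] ac_simps)
    from this[of "Poly_Mapping.lookup h" "Poly_Mapping.keys h"]
    show "(Poly_Mapping.single D c \<otimes> Poly_Mapping.single E d) \<otimes> h =
        Poly_Mapping.single D c \<otimes> (Poly_Mapping.single E d \<otimes> h)" by (simp add: poly_mapping_sum_single)
  qed (simp_all add: tensor_linear)
qed (simp_all add: tensor_linear)

lemma id_tl_Hom [simp]: "id_tl n \<in> Hom n n"
  by (simp add: id_tl_def planar_id_diag)

lemma id_tensor_id: "id_tl m \<otimes> id_tl n = id_tl (m + n)"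
  by (simp add: id_tl_def tensor_single juxtapose_id_id)

lemma tensor_id_0: "f \<otimes> id_tl 0 = f" "id_tl 0 \<otimes> f = f"
proof -
  have "(\<Sum>D\<in>S. Poly_Mapping.single D (w D)) \<otimes> id_tl 0 = (\<Sum>D\<in>S. Poly_Mapping.single D (w D))"
    "id_tl 0 \<otimes> (\<Sum>D\<in>S. Poly_Mapping.single D (w D)) = (\<Sum>D\<in>S. Poly_Mapping.single D (w D))"
    for S and w :: "matching \<Rightarrow> 'a"
    by (induction S rule: infinite_finite_induct;
        simp add: tensor_linear id_tl_def tensor_single juxtapose_id_0 id_0_juxtapose)+
  from this[of "Poly_Mapping.lookup f" "Poly_Mapping.keys f"]
  show "f \<otimes> id_tl 0 = f" "id_tl 0 \<otimes> f = f" by (simp_all add: poly_mapping_sum_single)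
qed

section \<open>Composition with vanishing loop value\<close>

locale TL_zero = TL \<zeta> for \<zeta> :: "'k::field" +
  assumes loop_value: "\<zeta> + inverse \<zeta> = 0"
begin

lemma comp_bilinear_ext: "g \<odot> f = bilinear_ext stack (\<lambda>C D. (- (\<zeta> + inverse \<zeta>)) ^ loops C D) g f"
  by (simp add: comp_def bilinear_ext_def)

lemma comp_zero [simp]: "0 \<odot> f = 0" "f \<odot> 0 = 0"
  by (simp_all add: comp_def)

lemma comp_linear:
  "(f + g) \<odot> h = f \<odot> h + g \<odot> h" "h \<odot> (f + g) = h \<odot> f + h \<odot> g"
  "(c \<cdot> f) \<odot> g = c \<cdot> (f \<odot> g)" "f \<odot> (c \<cdot> g) = c \<cdot> (f \<odot> g)"
  "(f - g) \<odot> h = f \<odot> h - g \<odot> h" "h \<odot> (f - g) = h \<odot> f - h \<odot> g"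
proof -
  show *: "(f + g) \<odot> h = f \<odot> h + g \<odot> h" "h \<odot> (f + g) = h \<odot> f + h \<odot> g"
    "(c \<cdot> f) \<odot> g = c \<cdot> (f \<odot> g)" "f \<odot> (c \<cdot> g) = c \<cdot> (f \<odot> g)" for f g h c
    by (simp_all add: comp_bilinear_ext bilinear_ext_add_left bilinear_ext_add_right bilinear_ext_scale)
  have "(f - g) \<odot> h + g \<odot> h = f \<odot> h" "h \<odot> (f - g) + h \<odot> g = h \<odot> f" by (simp_all flip: *)
  then show "(f - g) \<odot> h = f \<odot> h - g \<odot> h" "h \<odot> (f - g) = h \<odot> f - h \<odot> g" by (simp_all add: eq_diff_eq)
qed

text \<open>The power of the loop value is \<open>0 ^ 0 = 1\<close> without loops and 0
  otherwise.\<close>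

lemma comp_single:
  assumes "D \<in> planar_matchings m n" "C \<in> planar_matchings n k"
  shows "Poly_Mapping.single C a \<odot> Poly_Mapping.single D b =
    (if no_loop C D then Poly_Mapping.single (stack C D) (a * b) else 0)"
  using loops_eq_0_iff[OF finite_glued[OF assms]]
  by (cases "loops C D") (auto simp: comp_bilinear_ext bilinear_ext_single loop_value)

lemma comp_Hom [simp]:
  assumes "g \<in> Hom n k" "f \<in> Hom m n" shows "g \<odot> f \<in> Hom m k"
  using assms(1)
proof (induction rule: Hom_induct)
  case (add C c g)
  have "Poly_Mapping.single C c \<odot> f \<in> Hom m k"
    using assms(2)
    by (induction rule: Hom_induct) (auto simp: comp_linear comp_single[OF _ add(1)] planar_stack[OF add(1)])
  then show ?case using add by (simp add: comp_linear)
qed simp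

lemma comp_assoc:
  assumes "h \<in> Hom k l" "g \<in> Hom n k" "f \<in> Hom m n"
  shows "(h \<odot> g) \<odot> f = h \<odot> (g \<odot> f)"
  using assms(1)
proof (rule Hom_ext)
  fix F c assume F: "F \<in> planar_matchings k l"
  show "(Poly_Mapping.single F c \<odot> g) \<odot> f = Poly_Mapping.single F c \<odot> (g \<odot> f)"
    using assms(2)
  proof (rule Hom_ext)
    fix C d assume C: "C \<in> planar_matchings n k"
    show "(Poly_Mapping.single F c \<odot> Poly_Mapping.single C d) \<odot> f =
      Poly_Mapping.single F c \<odot> (Poly_Mapping.single C d \<odot> f)"
      using assms(3)
    proof (rule Hom_ext)
      fix D e assume D: "D \<in> planar_matchings m n"
      show "(Poly_Mapping.single F c \<odot> Poly_Mapping.single C d) \<odot> Poly_Mapping.single D e =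
        Poly_Mapping.single F c \<odot> (Poly_Mapping.single C d \<odot> Poly_Mapping.single D e)"
        using no_loop_planar_assoc[OF D C F]
        by (auto simp: comp_single[OF C F] comp_single[OF D C] comp_single[OF D planar_stack[OF F C]]
            comp_single[OF planar_stack[OF C D] F] stack_assoc ac_simps)
    qed (simp_all add: comp_linear)
  qed (simp_all add: comp_linear)
qed (simp_all add: comp_linear)

lemma comp_id:
  assumes "f \<in> Hom m n" shows "id_tl n \<odot> f = f" "f \<odot> id_tl m = f"
proof -
  have "id_tl n \<odot> f = id f"
    using assms by (rule Hom_ext)
      (simp_all add: comp_linear, simp add: id_tl_def comp_single[OF _ planar_id_diag] no_loop_id_diag stack_id_diag)
  moreover have "f \<odot> id_tl m = id f"
    using assms by (rule Hom_ext)
      (simp_all add: comp_linear, simp add: id_tl_def comp_single[OF planar_id_diag] no_loop_id_diag_right stack_id_diag_right)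
  ultimately show "id_tl n \<odot> f = f" "f \<odot> id_tl m = f" by simp_all
qed

lemma tensor_comp:
  assumes "g \<in> Hom n k" "f \<in> Hom m n" "g' \<in> Hom n' k'" "f' \<in> Hom m' n'"
  shows "(g \<otimes> g') \<odot> (f \<otimes> f') = (g \<odot> f) \<otimes> (g' \<odot> f')"
  using assms(1)
proof (rule Hom_ext)
  fix C c assume C: "C \<in> planar_matchings n k"
  show "(Poly_Mapping.single C c \<otimes> g') \<odot> (f \<otimes> f') = (Poly_Mapping.single C c \<odot> f) \<otimes> (g' \<odot> f')"
    using assms(2)
  proof (rule Hom_ext)
    fix D d assume D: "D \<in> planar_matchings m n"
    show "(Poly_Mapping.single C c \<otimes> g') \<odot> (Poly_Mapping.single D d \<otimes> f') =
        (Poly_Mapping.single C c \<odot> Poly_Mapping.single D d) \<otimes> (g' \<odot> f')"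
      using assms(3)
    proof (rule Hom_ext)
      fix C' c' assume C': "C' \<in> planar_matchings n' k'"
      show "(Poly_Mapping.single C c \<otimes> Poly_Mapping.single C' c') \<odot> (Poly_Mapping.single D d \<otimes> f') =
        (Poly_Mapping.single C c \<odot> Poly_Mapping.single D d) \<otimes> (Poly_Mapping.single C' c' \<odot> f')"
        using assms(4)
      proof (rule Hom_ext)
        fix D' d' assume D': "D' \<in> planar_matchings m' n'"
        show "(Poly_Mapping.single C c \<otimes> Poly_Mapping.single C' c') \<odot>
            (Poly_Mapping.single D d \<otimes> Poly_Mapping.single D' d') =
          (Poly_Mapping.single C c \<odot> Poly_Mapping.single D d) \<otimes>
            (Poly_Mapping.single C' c' \<odot> Poly_Mapping.single D' d')"
          \<comment> \<open>A loop in either half makes both sides 0; without loops the left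
            composite is planar, as \<open>stack_juxtapose\<close> requires.\<close>
          using no_loop_juxtapose[OF D C D' C'] stack_juxtapose[OF D C D' C'] planar_stack[OF C D]
          by (auto simp: tensor_single comp_single[OF planar_juxtapose[OF D D'] planar_juxtapose[OF C C']]
              comp_single[OF D C] comp_single[OF D' C'] ac_simps)
      qed (simp_all add: comp_linear tensor_linear)
    qed (simp_all add: comp_linear tensor_linear)
  qed (simp_all add: comp_linear tensor_linear)
qed (simp_all add: comp_linear tensor_linear)

end

section \<open>A ring of endomorphisms\<close>

lemma TL_zero_0: "TL_zero 0"
  by unfold_locales simp

lemma (in TL_zero) comp_eq_comp_0: "comp = TL.comp 0"
  by (intro ext) (simp add: comp_def TL.comp_def loop_value)

lemma comp_endo: "\<forall>n. f n \<in> Hom n n \<Longrightarrow> \<forall>n. g n \<in> Hom n n \<Longrightarrow> TL.comp 0 (f n) (g n) \<in> Hom n n"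
  by (rule TL_zero.comp_Hom[OF TL_zero_0, where n = n]) auto

text \<open>A type can depend neither on the number of strands nor on \<open>\<zeta>\<close>, so a ring is formed from
  families with one endomorphism for each number of strands, and the parameter is \<open>0\<close>: as
  \<open>inverse 0 = 0\<close>, closed loops have value \<open>0\<close> for it, just as for a primitive fourth root of
  unity.\<close>

typedef (overloaded) 'k tl_endo = "{f :: nat \<Rightarrow> 'k::field tl. \<forall>n. f n \<in> Hom n n}"
  morphisms component Endo
  by (intro exI[of _ "\<lambda>_. 0"]) simp

setup_lifting type_definition_tl_endo

instantiation tl_endo :: (field) ring_1
begin

lift_definition zero_tl_endo :: "'a tl_endo" is "\<lambda>_. 0" by simp
lift_definition one_tl_endo :: "'a tl_endo" is id_tl by simp
lift_definition plus_tl_endo :: "'a tl_endo \<Rightarrow> 'a tl_endo \<Rightarrow> 'a tl_endo" is "\<lambda>f g n. f n + g n" by simp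
lift_definition minus_tl_endo :: "'a tl_endo \<Rightarrow> 'a tl_endo \<Rightarrow> 'a tl_endo" is "\<lambda>f g n. f n - g n" by simp
lift_definition uminus_tl_endo :: "'a tl_endo \<Rightarrow> 'a tl_endo" is "\<lambda>f n. - f n" by simp
lift_definition times_tl_endo :: "'a tl_endo \<Rightarrow> 'a tl_endo \<Rightarrow> 'a tl_endo" is "\<lambda>f g n. TL.comp 0 (f n) (g n)"
  by (rule comp_endo) auto

instance
proof
  fix a b c :: "'a tl_endo"
  interpret TL_zero "0 :: 'a" by (rule TL_zero_0)
  show "a * b * c = a * (b * c)" 
  proof transfer
    fix a b c :: "nat \<Rightarrow> 'a tl"
    assume "\<forall>n. a n \<in> Hom n n" "\<forall>n. b n \<in> Hom n n" "\<forall>n. c n \<in> Hom n n"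
    then have "TL.comp 0 (TL.comp 0 (a n) (b n)) (c n) = TL.comp 0 (a n) (TL.comp 0 (b n) (c n))" for n
      by (intro comp_assoc[where k = n and l = n and m = n and n = n]) auto
    then show "(\<lambda>n. TL.comp 0 (TL.comp 0 (a n) (b n)) (c n)) = (\<lambda>n. TL.comp 0 (a n) (TL.comp 0 (b n) (c n)))"
      by simp
  qed
  have id: "TL.comp 0 (id_tl n) f = f" "TL.comp 0 f (id_tl n) = f" if "f \<in> Hom n n" for n and f :: "'a tl"
    using comp_id[OF that] by auto
  show "1 * a = a" "a * 1 = a" by (transfer; simp add: id)+
  show "(a + b) * c = a * c + b * c" "a * (b + c) = a * b + a * c" by (transfer; simp add: comp_linear)+
  show "(0 :: 'a tl_endo) \<noteq> 1"
  proof transfer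
    have "Poly_Mapping.lookup (id_tl 0 :: 'a tl) (id_diag 0) = 1" by (simp add: id_tl_def)
    then show "(\<lambda>_. 0 :: 'a tl) \<noteq> id_tl" by (metis lookup_zero zero_neq_one)
  qed
qed (transfer; simp add: algebra_simps)+

end

lift_definition scalar_endo :: "'k::field \<Rightarrow> 'k tl_endo" is "\<lambda>c n. c \<cdot> id_tl n" by simp

section \<open>The Temperley--Lieb relations with vanishing loop value\<close>

text \<open>The Jones--Wenzl idempotents on an even number of strands do not exist at a fourth root of unity,
  so the usual recursion is replaced by one with steps of two strands.  For \<open>b = 0\<close> the value
  \<open>t = u 0\<close> has no meaning, but then the last term has coefficient \<open>0\<close>.\<close>

fun jw_rec :: "('k::field \<Rightarrow> 'a::ring_1) \<Rightarrow> (nat \<Rightarrow> 'a) \<Rightarrow> nat \<Rightarrow> 'a" where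
  "jw_rec h u 0 = 1"
| "jw_rec h u (Suc b) = (let P = jw_rec h u b; w = u (2 * b); x = u (2 * b + 1); t = u (2 * b - 1) in
     P - P * w * x * P - P * x * w * P + h (of_nat b / of_nat (b + 1)) * (P * w * t * x * w * P))"

declare jw_rec.simps(2) [simp del]

text \<open>Parametricity of the recursion. It transports the idempotents along the addition of
  strands on either side, and it moves elements past them.\<close>

lemma jw_rec_rel:
  assumes "R 1 1" "\<And>x y x' y'. R x x' \<Longrightarrow> R y y' \<Longrightarrow> R (x * y) (x' * y')"
    "\<And>x y x' y'. R x x' \<Longrightarrow> R y y' \<Longrightarrow> R (x + y) (x' + y')"
    "\<And>x y x' y'. R x x' \<Longrightarrow> R y y' \<Longrightarrow> R (x - y) (x' - y')"
    "\<And>c. R (h c) (h' c)" "\<And>i. i < 2 * b \<Longrightarrow> R (u i) (u' i)"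
  shows "R (jw_rec h u b) (jw_rec h' u' b)"
  using assms(6)
proof (induction b)
  case 0
  then show ?case by (simp add: assms)
next
  case (Suc b)
  then have "R (jw_rec h u b) (jw_rec h' u' b)" by simp
  moreover have "R (u (2 * b)) (u' (2 * b))" "R (u (2 * b + 1)) (u' (2 * b + 1))" "R (u (2 * b - 1)) (u' (2 * b - 1))"
    using Suc.prems by (auto simp del: One_nat_def)
  ultimately show ?case unfolding jw_rec.simps Let_def
    by (intro assms(2-5))
qed

text \<open>\<open>M\<close> counts the genuine generators. \<open>u_sq\<close> and
  \<open>u_comm\<close> carry no bound because in the intended model the generators out of range are
  0, whereas \<open>u_up\<close> and \<open>u_down\<close> would fail at the boundary.\<close>

locale tl_relations =
  fixes u :: "nat \<Rightarrow> 'a::ring_1" and h :: "'k::field \<Rightarrow> 'a" and M :: nat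
  assumes h_add: "h (c + d) = h c + h d" and h_mult: "h (c * d) = h c * h d" and h_one: "h 1 = 1"
    and h_central: "x * h c = h c * x"
    and u_sq: "u i * u i = 0"
    and u_up: "Suc i < M \<Longrightarrow> u i * u (Suc i) * u i = u i"
    and u_down: "Suc i < M \<Longrightarrow> u (Suc i) * u i * u (Suc i) = u (Suc i)"
    and u_comm: "Suc i < j \<Longrightarrow> u i * u j = u j * u i"
begin

abbreviation "P \<equiv> jw_rec h u"

lemma h_zero [simp]: "h 0 = 0"
  using h_add[of 0 0] by simp

lemma h_minus: "h (- c) = - h c"
  using h_add[of c "- c"] by (simp add: eq_neg_iff_add_eq_0 add.commute)

lemma h_left: "x * (h c * y) = h c * (x * y)"
  by (simp add: h_central flip: mult.assoc)

lemma assoc_rule: "x * y = z \<Longrightarrow> x * (y * r) = z * (r :: 'a)"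
  by (simp flip: mult.assoc)

lemma expand_left: "x * (a - b - c + h k * d) = x * a - x * b - x * c + h k * (x * d)"
  by (simp add: distrib_left right_diff_distrib h_left)

lemma expand_right: "(a - b - c + h k * d) * x = a * x - b * x - c * x + h k * (d * x)"
  by (simp add: distrib_right left_diff_distrib mult.assoc)

text \<open>With \<open>u' = u\<close> it moves distant generators past an idempotent; with the
  shifted generators as \<open>u'\<close> it moves an idempotent through a braid.\<close>

lemma comm_jw:
  assumes "\<And>i. i < 2 * b \<Longrightarrow> u' i * y = y * u i"
  shows "jw_rec h u' b * y = y * P b"
  by (rule jw_rec_rel[where R = "\<lambda>x x'. x * y = y * x'"])
    (use assms in \<open>auto simp: algebra_simps h_central\<close>, metis mult.assoc)

lemma P_comm: "2 * b < i \<Longrightarrow> P b * u i = u i * P b"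
  by (rule comm_jw, rule u_comm) simp

text \<open>The partial trace of the idempotent; the factor is the value at a fourth root of unity of the
  quotient \<open>[2b + 2]/[2b]\<close> of quantum integers, in which both terms vanish.\<close>

definition trace_rule :: "nat \<Rightarrow> bool" where
  "trace_rule b \<longleftrightarrow> u (2 * b) * P b * u (2 * b) =
     (if b = 0 then 0 else h (- (of_nat (b + 1) / of_nat b)) * (u (2 * b) * P (b - 1) * u (2 * b - 2) * P (b - 1)))"

definition kill_rule :: "nat \<Rightarrow> bool" where
  "kill_rule b \<longleftrightarrow> P b * P b = P b \<and> (\<forall>i<2 * b. u i * P b = 0 \<and> P b * u i = 0)"

lemma trace_rule_0: "trace_rule 0"
  by (simp add: trace_rule_def u_sq)

lemma kill_rule_0: "kill_rule 0"
  by (simp add: kill_rule_def)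

text \<open>The next generator \<open>w\<close> commutes with every factor in the recursion except
  \<open>t\<close>, and \<open>w * t * w = w\<close>. The leading term thus dies by
  \<open>w * w = 0\<close>, and each correction term becomes \<open>w * Q * y * Q\<close>, with
  total coefficient \<open>b / (b + 1) - 2 = - (b + 2) / (b + 1)\<close>.\<close>

lemma trace_rule_Suc:
  assumes kill: "kill_rule b" and M: "2 * b + 2 < M" and b: "of_nat (b + 1) \<noteq> (0 :: 'k)"
  shows "trace_rule (Suc b)"
proof -
  define Q y t r w where d: "Q = P b" "y = u (2 * b)" "t = u (2 * b + 1)" "r = u (2 * b - 1)" "w = u (2 * b + 2)"
  have PS: "P (Suc b) = Q - Q * y * t * Q - Q * t * y * Q + h (of_nat b / of_nat (b + 1)) * (Q * y * r * t * y * Q)"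
    by (simp add: d Let_def jw_rec.simps(2))
  have wQ: "Q * w = w * Q" unfolding d by (rule P_comm) simp
  have wy: "y * w = w * y" unfolding d by (rule u_comm) simp
  have wr: "r * w = w * r" unfolding d by (rule u_comm) simp
  have ww: "w * w = 0" by (simp add: d u_sq)
  have wtw: "w * t * w = w" using u_down[of "2 * b + 1"] M by (simp add: d)
  have yry: "b \<noteq> 0 \<Longrightarrow> y * r * y = y" using u_down[of "2 * b - 1"] M by (simp add: d)
  have wQy: "w * Q * y = Q * y * w" using wQ wy by (metis mult.assoc)
  have wQyr: "w * Q * y * r = Q * y * r * w" using wQy wr by (metis mult.assoc)
  have yQw: "y * Q * w = w * y * Q" using wQ wy by (metis mult.assoc)
  have 1: "w * Q * w = 0" using wQ ww by (metis mult.assoc mult_zero_right)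
  have 2: "w * (Q * y * t * Q) * w = w * Q * y * Q"
  proof -
    have "w * (Q * y * t * Q) * w = (w * Q * y) * t * (Q * w)" by (simp only: mult.assoc)
    also have "\<dots> = Q * y * (w * t * w) * Q" unfolding wQy wQ by (simp only: mult.assoc)
    finally show ?thesis by (simp only: wtw wQy)
  qed
  have 3: "w * (Q * t * y * Q) * w = w * Q * y * Q"
  proof -
    have "w * (Q * t * y * Q) * w = (w * Q) * t * (y * Q * w)" by (simp only: mult.assoc)
    also have "\<dots> = Q * (w * t * w) * y * Q" unfolding yQw wQ[symmetric] by (simp only: mult.assoc)
    finally show ?thesis by (simp only: wtw wQ)
  qed
  have 4: "w * (Q * y * r * t * y * Q) * w = w * Q * y * Q" if "b \<noteq> 0"
  proof -
    have "w * (Q * y * r * t * y * Q) * w = (w * Q * y * r) * t * (y * Q * w)" by (simp only: mult.assoc)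
    also have "\<dots> = Q * y * r * (w * t * w) * y * Q" unfolding yQw wQyr by (simp only: mult.assoc)
    also have "\<dots> = w * Q * (y * r * y) * Q" unfolding wtw wQyr[symmetric] by (simp only: mult.assoc)
    finally show ?thesis by (simp only: yry[OF that])
  qed
  have c: "- (of_nat (Suc b + 1) / of_nat (Suc b)) = of_nat b / of_nat (b + 1) - (2 :: 'k)"
    using b by (simp add: field_simps)
  have h2: "h (c - 2) * z = h c * z - z - z" for c z
    using h_add[of "c - 2" 2] h_add[of 1 1] h_one by (simp add: algebra_simps) (simp add: mult_2)
  have "w * P (Suc b) * w = h (of_nat b / of_nat (b + 1)) * (w * Q * y * Q) - w * Q * y * Q - w * Q * y * Q"
    unfolding PS expand_left expand_right using 1 2 3 4 by (cases "b = 0") simp_all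
  then show ?thesis
    unfolding trace_rule_def c h2 by (simp add: d)
qed

lemma P_absorb_left: "kill_rule b \<Longrightarrow> P b * P (Suc b) = P (Suc b)"
  using assoc_rule[of "P b" "P b" "P b"] by (simp add: jw_rec.simps(2) kill_rule_def Let_def algebra_simps h_left)
  
lemma P_absorb_right: "kill_rule b \<Longrightarrow> P (Suc b) * P b = P (Suc b)"
  using assoc_rule[of "P b" "P b" "P b"] by (simp add: jw_rec.simps(2) kill_rule_def Let_def algebra_simps h_left)

text \<open>Only the two new generators need work, since the older ones are killed through
  absorption of \<open>P b\<close>. For \<open>x\<close> the relations with neighbours suffice. For
  \<open>w\<close> the factor \<open>p\<close> stands between \<open>w\<close> and \<open>x\<close>,
  so the recursion for \<open>p\<close> itself is inserted, and what is left over cancels against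
  the last term by the partial trace \<open>w * p * w\<close>.\<close>

lemma kill_rule_Suc:
  assumes kill: "kill_rule b" "b \<noteq> 0 \<Longrightarrow> kill_rule (b - 1)" and trace: "trace_rule b" and M: "2 * b + 2 \<le> M"
    and b: "of_nat (b + 1) \<noteq> (0 :: 'k)" "b \<noteq> 0 \<Longrightarrow> of_nat b \<noteq> (0 :: 'k)"
  shows "kill_rule (Suc b)"
proof -
  define p w x t c where d: "p = P b" "w = u (2 * b)" "x = u (2 * b + 1)" "t = u (2 * b - 1)"
    "c = h (of_nat b / of_nat (b + 1))"
  have PS: "P (Suc b) = p - p * w * x * p - p * x * w * p + c * (p * w * t * x * w * p)"
    by (simp add: d Let_def jw_rec.simps(2))
  have PS_left: "z * P (Suc b) = z * p - z * p * w * x * p - z * p * x * w * p + c * (z * p * w * t * x * w * p)" for z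
    unfolding PS unfolding d expand_left by (simp only: mult.assoc)
  have PS_right: "P (Suc b) * z = p * z - p * w * x * p * z - p * x * w * p * z + c * (p * w * t * x * w * p * z)" for z
    unfolding PS unfolding d expand_right ..
  have pp: "p * p = p" using kill(1) by (simp add: kill_rule_def d)
  have px: "p * x = x * p" unfolding d by (rule P_comm) simp
  have ww: "w * w = 0" and xx: "x * x = 0" by (simp_all add: d u_sq)
  have wxw: "w * x * w = w" using u_up[of "2 * b"] M by (simp add: d)
  have xwx: "x * w * x = x" using u_down[of "2 * b"] M by (simp add: d)
  have c_left: "z * (c * z') = c * (z * z')" for z z' by (simp add: d h_left)
  have w: "w * P (Suc b) = 0 \<and> P (Suc b) * w = 0"
  proof (cases "b = 0")
    case True
    then have "p = 1" "c = 0" by (simp_all add: d)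
    moreover have "x * w * w = 0" using ww by (simp add: mult.assoc)
    ultimately show ?thesis unfolding PS_left PS_right using ww wxw by simp
  next
    case False
    define Q y r where e: "Q = P (b - 1)" "y = u (2 * b - 2)" "r = u (2 * b - 3)"
    have Sb: "Suc (b - 1) = b" using False by simp
    have ix: "2 * (b - 1) = 2 * b - 2" "2 * (b - 1) + 1 = 2 * b - 1" "2 * (b - 1) - 1 = 2 * b - 3" using False by auto
    obtain d' where P: "p = Q - Q * y * t * Q - Q * t * y * Q + h d' * (Q * y * r * t * y * Q)"
      using jw_rec.simps(2)[of h u "b - 1", unfolded Sb Let_def, unfolded ix(2,3), unfolded ix(1)]
      by (simp add: d e)
    have Qp: "Q * p = p" and pQ: "p * Q = p"
      using P_absorb_left[of "b - 1"] P_absorb_right[of "b - 1"] kill(2) False by (simp_all add: d e)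
    have yp: "y * p = 0" and py: "p * y = 0" and tp: "t * p = 0" and pt: "p * t = 0"
      using kill(1) False by (simp_all add: kill_rule_def d e)
    have Qw: "Q * w = w * Q" and Qx: "Q * x = x * Q" and Qt: "Q * t = t * Q"
      unfolding d e by (rule P_comm; use False in simp)+
    have yx: "y * x = x * y" and yw: "y * w = w * y" and tx: "t * x = x * t"
      unfolding d e by (rule u_comm; use False in simp)+
    have tr0: "w * p * w = h (- (of_nat (b + 1) / of_nat b)) * (w * Q * y * Q)"
      using trace False by (simp add: trace_rule_def d e)
    \<comment> \<open>The product of \<open>b / (b + 1)\<close> with the trace factor
      \<open>- ((b + 1) / b)\<close> is \<open>- 1\<close>; this is the origin of the last
      coefficient in the recursion.\<close>
    have tr: "c * (w * p * w) = - (w * Q * y * Q)"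
    proof -
      have "of_nat b / of_nat (b + 1) * - (of_nat (b + 1) / of_nat b) = (- 1 :: 'k)"
        using b False by (simp del: of_nat_Suc of_nat_add)
      then have "c * h (- (of_nat (b + 1) / of_nat b)) = - 1"
        unfolding d h_mult[symmetric] by (simp add: h_minus h_one)
      then show ?thesis unfolding tr0 mult.assoc[symmetric] by simp
    qed
    \<comment> \<open>The trace leaves a factor \<open>y\<close>, which passes \<open>x\<close> and
      \<open>Q\<close>, in the mirrored product also \<open>w\<close>, and is killed by the outer
      \<open>p\<close>.\<close>
    have trx: "w * p * w * x * p = 0" "p * x * w * p * w = 0"
    proof -
      have "w * Q * y * Q * x * p = w * Q * x * (y * (Q * p))" by (simp add: Qx yx mult.assoc Qx[THEN assoc_rule] yx[THEN assoc_rule])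
      then have "w * Q * y * Q * x * p = 0" by (simp add: Qp yp)
      then show "w * p * w * x * p = 0" unfolding tr0 by (simp add: mult.assoc)
      have "p * x * w * Q * y * Q = p * Q * y * x * w * Q"
        by (simp add: mult.assoc Qw[symmetric, THEN assoc_rule] Qx[symmetric, THEN assoc_rule] yw[symmetric, THEN assoc_rule] yx[symmetric, THEN assoc_rule])
      then have "p * x * w * Q * y * Q = 0" by (simp add: pQ py)
      then show "p * x * w * p * w = 0" 
        using tr0 by (simp add: mult.assoc h_left)
    qed
    \<comment> \<open>Of the four terms of the inner \<open>p\<close>, the two ending in
      \<open>y * Q\<close> die because \<open>y\<close> passes \<open>w\<close> and meets the outer
      \<open>p\<close>.\<close>
    have mid: "w * p * x * w * p = w * p - w * Q * y * t * x * w * p"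
    proof -
      have 1: "w * x * Q * w * p = w * p"
      proof -
        have "w * x * Q * w * p = w * x * w * (Q * p)" by (simp add: Qw mult.assoc Qw[THEN assoc_rule])
        then show ?thesis by (simp add: wxw Qp)
      qed
      have 2: "w * x * (Q * y * t * Q) * w * p = w * Q * y * t * x * w * p"
      proof -
        have "w * x * (Q * y * t * Q) * w * p = w * x * Q * y * t * w * (Q * p)"
          by (simp add: mult.assoc Qw[THEN assoc_rule])
        also have "\<dots> = w * Q * y * t * x * w * p"
          by (simp add: Qp mult.assoc Qx[symmetric, THEN assoc_rule] yx[symmetric, THEN assoc_rule] tx[symmetric, THEN assoc_rule])
        finally show ?thesis .
      qed
      have y0: "y * Q * w * p = 0"
      proof -
        have "y * Q * w * p = w * y * (Q * p)" by (simp add: mult.assoc Qw[THEN assoc_rule] yw[THEN assoc_rule])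
        then show ?thesis by (simp add: Qp yp mult.assoc)
      qed
      have "w * p * x * w * p = w * x * p * w * p" by (simp add: mult.assoc px[THEN assoc_rule])
      also have "\<dots> = w * x * Q * w * p - w * x * (Q * y * t * Q) * w * p
          - w * x * Q * t * (y * Q * w * p) + h d' * (w * x * Q * y * r * t * (y * Q * w * p))"
      proof -
        have "w * x * p = w * x * (Q - Q * y * t * Q - Q * t * y * Q + h d' * (Q * y * r * t * y * Q))"
          using P by simp
        then show ?thesis unfolding expand_left expand_right by (simp only: expand_right mult.assoc)
      qed
      finally show ?thesis by (simp only: 1 2 y0) simp
    qed
    have mid': "p * w * x * p * w = p * w - p * w * x * t * y * Q * w"
    proof -
      have left: "p * w * Q = p * w" using pQ Qw by (metis mult.assoc)
      have 1: "p * w * Q * x * w = p * w" unfolding left using wxw by (simp add: mult.assoc)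
      have txyQ: "t * y * Q * x = x * t * y * Q" using Qx yx tx by (metis mult.assoc)
      have "p * w * (Q * t * y * Q) * x * w = p * w * Q * (t * y * Q * x) * w" by (simp only: mult.assoc)
      then have 2: "p * w * (Q * t * y * Q) * x * w = p * w * x * t * y * Q * w"
        unfolding left txyQ by (simp only: mult.assoc)
      have y0: "p * w * Q * y = 0" unfolding left using yw py by (metis mult.assoc mult_zero_left)
      have "p * w * x * p * w = p * w * p * x * w" by (simp add: mult.assoc px[symmetric, THEN assoc_rule])
      also have "\<dots> = p * w * Q * x * w - (p * w * Q * y) * t * Q * x * w
          - p * w * (Q * t * y * Q) * x * w + h d' * ((p * w * Q * y) * r * t * y * Q * x * w)"
      proof -
        have "w * p = w * (Q - Q * y * t * Q - Q * t * y * Q + h d' * (Q * y * r * t * y * Q))"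
          using P by simp
        then show ?thesis unfolding expand_left expand_right by (simp only: mult.assoc expand_left expand_right)
      qed
      finally show ?thesis by (simp only: 1 2 y0) simp
    qed
    \<comment> \<open>The trace formula turns the last term of the recursion into the term left over
      in \<open>mid\<close>, with the sign that cancels it.\<close>
    have last: "c * (w * p * w * t * x * w * p) = - (w * Q * y * t * x * w * p)"
    proof -
      have "c * (w * p * w * t * x * w * p) = c * (w * p * w) * (t * x * w * p)" by (simp add: mult.assoc)
      also have "\<dots> = - (w * Q * y * t * x * w * (Q * p))"
        unfolding tr by (simp add: mult.assoc Qt[THEN assoc_rule] Qx[THEN assoc_rule] Qw[THEN assoc_rule])
      finally show ?thesis by (simp only: Qp)
    qed
    have last': "c * (p * w * t * x * w * p * w) = - (p * w * x * t * y * Q * w)"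
    proof -
      have Q1: "w * Q * y * Q = Q * y * Q * w" using Qw yw by (metis mult.assoc)
      have Q2: "w * t * x * Q = Q * w * t * x" using Qw Qt Qx by (metis mult.assoc)
      have "c * (p * w * t * x * w * p * w) = p * w * t * x * (c * (w * p * w))" by (simp add: mult.assoc c_left)
      also have "\<dots> = - (p * (w * t * x * Q) * y * Q * w)"
        unfolding tr Q1 by (simp add: mult.assoc)
      also have "\<dots> = - ((p * Q) * w * (t * x) * y * Q * w)" unfolding Q2 by (simp only: mult.assoc)
      finally show ?thesis unfolding pQ tx by (simp only: mult.assoc)
    qed
    show ?thesis unfolding PS_left PS_right trx mid mid' last last' by simp
  qed
  \<comment> \<open>As \<open>x\<close> commutes with \<open>p\<close>, one correction term cancels
    the leading term by \<open>x * w * x = x\<close>, another contains \<open>x * x\<close>, and in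
    the last one \<open>t\<close> is brought next to \<open>p\<close>.\<close>
  have x: "x * P (Suc b) = 0 \<and> P (Suc b) * x = 0"
  proof -
    have z: "c * (x * p * w * t * x * w * p) = 0 \<and> c * (p * w * t * x * w * p * x) = 0"
    proof (cases "b = 0")
      case True
      then show ?thesis by (simp add: d)
    next
      case False
      then have tp: "t * p = 0" and pt: "p * t = 0" using kill(1) by (simp_all add: kill_rule_def d)
      have tx: "t * x = x * t" unfolding d by (rule u_comm) (use False in simp)
      have "x * p * w * t * x * w * p = p * (x * w * x) * t * w * p"
        using px tx by (metis mult.assoc)
      also have "\<dots> = p * t * x * w * p" unfolding xwx using tx by (metis mult.assoc)
      finally have 1: "x * p * w * t * x * w * p = 0" by (simp add: pt)
      have "p * w * t * x * w * p * x = p * w * t * (x * w * x) * p" using px by (metis mult.assoc)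
      also have "\<dots> = p * w * x * (t * p)" unfolding xwx using tx by (metis mult.assoc)
      finally have 2: "p * w * t * x * w * p * x = 0" by (simp add: tp)
      show ?thesis using 1 2 by simp
    qed
    have "x * p * w * x * p = p * (x * w * x) * p" using px by (metis mult.assoc)
    also have "\<dots> = x * p" unfolding xwx using px pp by (metis mult.assoc)
    finally have 1: "x * p * w * x * p = x * p" .
    have "p * x * w * p * x = p * (x * w * x) * p" using px by (metis mult.assoc)
    also have "\<dots> = p * x" unfolding xwx using px pp by (metis mult.assoc)
    finally have 2: "p * x * w * p * x = p * x" .
    have "x * p * x * w * p = p * (x * x) * w * p" using px by (metis mult.assoc)
    then have 3: "x * p * x * w * p = 0" by (simp add: xx)
    have "p * w * x * p * x = p * w * (x * x) * p" using px by (metis mult.assoc)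
    then have 4: "p * w * x * p * x = 0" by (simp add: xx)
    show ?thesis unfolding PS_left PS_right 1 2 3 4 using z by simp
  qed
  have zero: "u i * P (Suc b) = 0 \<and> P (Suc b) * u i = 0" if i: "i < 2 * Suc b" for i
  proof -
    have "i = 2 * b \<or> i = 2 * b + 1 \<or> i < 2 * b" using i by arith
    then consider "i = 2 * b" | "i = 2 * b + 1" | "i < 2 * b" by blast
    then show ?thesis
    proof cases
      case 3
      then have "u i * p = 0" "p * u i = 0" using kill(1) by (simp_all add: kill_rule_def d)
      moreover have "P (Suc b) = p * P (Suc b)" "P (Suc b) = P (Suc b) * p"
        using P_absorb_left[OF kill(1)] P_absorb_right[OF kill(1)] by (simp_all add: d)
      ultimately show ?thesis by (metis mult.assoc mult_zero_left mult_zero_right)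
    qed (use w x in \<open>simp_all add: d\<close>)
  qed
  have Pp: "P (Suc b) * p = P (Suc b)" using P_absorb_right[OF kill(1)] by (simp add: d)
  \<comment> \<open>The right factor is expanded. Its leading term gives \<open>P (Suc b)\<close>;
    in all others, after absorption of \<open>p\<close>, a new generator stands next to
    \<open>P (Suc b)\<close>.\<close>
  have "P (Suc b) * P (Suc b) = P (Suc b)"
    using w x unfolding PS_left[of "P (Suc b)"] Pp by simp
  then show ?thesis using zero by (simp add: kill_rule_def)
qed

lemma kill_rule:
  assumes "2 * b \<le> M" "\<And>j. 0 < j \<Longrightarrow> j \<le> b \<Longrightarrow> of_nat j \<noteq> (0 :: 'k)"
  shows "kill_rule b"
  using assms
proof (induction b rule: less_induct)
  case (less b)
  show ?case
  proof (cases b)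
    case 0
    then show ?thesis by (simp add: kill_rule_0)
  next
    case (Suc c)
    have kc: "kill_rule c" "c \<noteq> 0 \<Longrightarrow> kill_rule (c - 1)" using less Suc by auto
    have "trace_rule c"
    proof (cases c)
      case 0
      then show ?thesis by (simp add: trace_rule_0)
    next
      case (Suc e)
      then show ?thesis using kc(2) less.prems \<open>b = Suc c\<close> by (auto intro!: trace_rule_Suc simp del: of_nat_add of_nat_Suc)
    qed
    then show ?thesis unfolding Suc using kc less.prems Suc
      by (intro kill_rule_Suc) (auto simp del: of_nat_add of_nat_Suc)
  qed
qed

text \<open>This brings \<open>Y\<close> into the form \<open>P * w * P\<close>. When the middle
  idempotent is expanded, each correction term has a \<open>y\<close> at the left or right of its
  inner part; this \<open>y\<close> slides past \<open>w\<close> and \<open>x\<close> to an outer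
  \<open>p\<close> and dies. There remains \<open>p * w * x * w * p\<close>.\<close>

lemma jw_middle:
  assumes kill: "kill_rule b" "b \<noteq> 0 \<Longrightarrow> kill_rule (b - 1)" and M: "2 * b + 2 \<le> M"
  shows "P b * u (2 * b) * P b * u (2 * b + 1) * u (2 * b) * P b = P b * u (2 * b) * P b"
proof -
  define p w x where d: "p = P b" "w = u (2 * b)" "x = u (2 * b + 1)"
  have wxw: "w * x * w = w" using u_up[of "2 * b"] M by (simp add: d)
  have "p * w * p * x * w * p = p * w * p"
  proof (cases "b = 0")
    case True
    then show ?thesis using wxw by (simp add: d)
  next
    case False
    define Q y t r where e: "Q = P (b - 1)" "y = u (2 * b - 2)" "t = u (2 * b - 1)" "r = u (2 * b - 3)"
    have Sb: "Suc (b - 1) = b" using False by simp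
    have ix: "2 * (b - 1) = 2 * b - 2" "2 * (b - 1) + 1 = 2 * b - 1" "2 * (b - 1) - 1 = 2 * b - 3" using False by auto
    obtain d' where pQ': "p = Q - Q * y * t * Q - Q * t * y * Q + h d' * (Q * y * r * t * y * Q)"
      using jw_rec.simps(2)[of h u "b - 1", unfolded Sb Let_def, unfolded ix(2,3), unfolded ix(1)]
      by (simp add: d e)
    have Qp: "Q * p = p" and pQ: "p * Q = p"
      using P_absorb_left[of "b - 1"] P_absorb_right[of "b - 1"] kill(2) False by (simp_all add: d e)
    have yp: "y * p = 0" and py: "p * y = 0" using kill(1) False by (simp_all add: kill_rule_def d e)
    have Qw: "Q * w = w * Q" and Qx: "Q * x = x * Q"
      unfolding d e by (rule P_comm; use False in simp)+
    have yx: "y * x = x * y" and yw: "y * w = w * y" unfolding d e by (rule u_comm; use False in simp)+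
    have left: "p * w * Q = p * w" using pQ Qw by (metis mult.assoc)
    have left0: "p * w * Q * y = 0" using left yw py by (metis mult.assoc mult_zero_left)
    have "y * Q * x * w * p = x * w * y * (Q * p)" using Qw Qx yx yw by (metis mult.assoc)
    then have right0: "y * Q * x * w * p = 0" by (simp add: Qp yp mult.assoc)
    have "w * p * x * w * p = w * Q * x * w * p - w * Q * y * t * Q * x * w * p
        - w * Q * t * (y * Q * x * w * p) + h d' * (w * Q * y * r * t * (y * Q * x * w * p))"
    proof -
      have "w * p = w * (Q - Q * y * t * Q - Q * t * y * Q + h d' * (Q * y * r * t * y * Q))"
        using pQ' by simp
      then show ?thesis unfolding expand_left expand_right by (simp only: mult.assoc expand_left expand_right)
    qed
    then have "p * (w * p * x * w * p) = p * w * Q * x * w * p - p * w * Q * y * t * Q * x * w * p"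
      unfolding right0 by (simp add: right_diff_distrib mult.assoc)
    then have "p * w * p * x * w * p = p * (w * x * w) * p"
      unfolding left0 unfolding left by (simp add: mult.assoc)
    then show ?thesis by (simp only: wxw)
  qed
  then show ?thesis by (simp add: d)
qed

end

section \<open>The double braiding\<close>

locale tl_braid = tl_relations u h M for u :: "nat \<Rightarrow> 'a::ring_1" and h :: "'k::field \<Rightarrow> 'a" and M :: nat +
  fixes s \<zeta> :: 'k
  assumes s_sq: "s ^ 2 = \<zeta>" and \<zeta>_sq: "\<zeta> ^ 2 = - 1"
begin

definition sigma :: "nat \<Rightarrow> 'a" where
  "sigma i = h s + h (inverse s) * u i"

text \<open>\<open>braid_down n\<close> models the braiding of one strand with \<open>n\<close>
  strands, \<open>braid_up n\<close> that of \<open>n\<close> strands with one.\<close>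

primrec braid_down :: "nat \<Rightarrow> 'a" where
  "braid_down 0 = 1"
| "braid_down (Suc n) = sigma n * braid_down n"

primrec braid_up :: "nat \<Rightarrow> 'a" where
  "braid_up 0 = 1"
| "braid_up (Suc n) = braid_up n * sigma n"

primrec jucys_murphy :: "nat \<Rightarrow> 'a" where
  "jucys_murphy 0 = 1"
| "jucys_murphy (Suc n) = sigma n * jucys_murphy n * sigma n"

text \<open>The partial trace over the last strand, characterised by
  \<open>trace_jucys_murphy\<close>.\<close>

primrec jucys_murphy_trace :: "nat \<Rightarrow> 'a" where
  "jucys_murphy_trace 0 = 0"
| "jucys_murphy_trace (Suc n) = h 2 * jucys_murphy n + h (inverse \<zeta>) * jucys_murphy_trace n"

lemma nonzero: "s \<noteq> 0" "\<zeta> \<noteq> 0"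
  using s_sq \<zeta>_sq by auto

lemma inverse_\<zeta>: "inverse \<zeta> = - \<zeta>"
  using \<zeta>_sq nonzero by (simp add: field_simps power2_eq_square)

lemma h_prod: "h c * (h d * x) = h (c * d) * x"
  by (simp add: h_mult mult.assoc)

lemma h_comm: "h c * h d = h (c * d)"
  by (simp add: h_mult)

lemma sigma_comm: "Suc i < j \<Longrightarrow> sigma j * u i = u i * sigma j" "Suc i < j \<Longrightarrow> sigma i * u j = u j * sigma i"
  using u_comm[of i j] by (simp_all add: sigma_def distrib_left distrib_right h_left mult.assoc) (simp_all add: h_central)

lemma sigma_conj: "sigma n * x * sigma n =
    h \<zeta> * x + u n * x + x * u n + h (inverse \<zeta>) * (u n * x * u n)"
proof -
  let ?w = "u n" and ?i = "inverse s"
  have 1: "h s * x * h s = h (s * s) * x"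
    unfolding h_central[of "h s * x"] h_prod ..
  have 2: "h s * x * (h ?i * ?w) = h (s * ?i) * (x * ?w)"
    unfolding mult.assoc h_left[of x] h_prod ..
  have 3: "h ?i * ?w * x * h s = h (s * ?i) * (?w * x)"
    unfolding h_central[of "h ?i * ?w * x"] unfolding mult.assoc h_prod ..
  have 4: "h ?i * ?w * x * (h ?i * ?w) = h (?i * ?i) * (?w * x * ?w)"
    unfolding h_left[of "h ?i * ?w * x"] unfolding mult.assoc h_prod ..
  have "sigma n * x * sigma n = h (s * s) * x + h (s * inverse s) * (u n * x) + h (s * inverse s) * (x * u n)
      + h (inverse s * inverse s) * (u n * x * u n)"
    unfolding sigma_def distrib_left distrib_right 1 2 3 4 by (simp only: add_ac)
  moreover have "s * s = \<zeta>" "inverse s * inverse s = inverse \<zeta>"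
    using s_sq by (simp_all add: power2_eq_square flip: inverse_mult_distrib)
  ultimately show ?thesis using nonzero by (simp add: h_one)
qed

lemma jucys_murphy_comm: "n < i \<Longrightarrow> jucys_murphy n * u i = u i * jucys_murphy n"
proof (induction n)
  case (Suc n)
  have "sigma n * jucys_murphy n * sigma n * u i = sigma n * jucys_murphy n * u i * sigma n"
    using sigma_comm(2)[of n i] Suc.prems by (simp add: mult.assoc)
  also have "\<dots> = sigma n * u i * jucys_murphy n * sigma n" using Suc by (simp add: mult.assoc)
  also have "\<dots> = u i * sigma n * jucys_murphy n * sigma n" using sigma_comm(2)[of n i] Suc.prems by simp
  finally show ?case by (simp add: mult.assoc)
qed simp

lemma jucys_murphy_trace_comm: "n \<le> i \<Longrightarrow> jucys_murphy_trace n * u i = u i * jucys_murphy_trace n"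
proof (induction n)
  case (Suc n)
  then show ?case using jucys_murphy_comm[of n i]
    by (simp add: distrib_left distrib_right h_left mult.assoc)
qed simp

text \<open>The four terms of \<open>sigma_conj\<close> are enclosed by
  \<open>x = u (Suc n)\<close>. The first dies by \<open>x * x = 0\<close>, the two middle ones each
  give \<open>jucys_murphy n\<close> by \<open>x * w * x = x\<close>, whence the factor 2, and the
  last one gives the previous trace.\<close>

lemma trace_jucys_murphy: "n < M \<Longrightarrow> u n * jucys_murphy n * u n = jucys_murphy_trace n * u n"
proof (induction n)
  case 0
  then show ?case by (simp add: u_sq)
next
  case (Suc n)
  define w x where d: "w = u n" "x = u (Suc n)"
  have x: "jucys_murphy n * x = x * jucys_murphy n" "jucys_murphy_trace n * x = x * jucys_murphy_trace n" unfolding d by (rule jucys_murphy_comm jucys_murphy_trace_comm; simp)+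
  have xx: "x * x = 0" by (simp add: d u_sq)
  have xwx: "x * w * x = x" using u_down[of n] Suc.prems by (simp add: d)
  have "w * jucys_murphy n * w = jucys_murphy_trace n * w" using Suc by (simp add: d)
  then have "x * jucys_murphy (Suc n) * x = h \<zeta> * (x * jucys_murphy n * x) + x * w * jucys_murphy n * x + x * jucys_murphy n * w * x
      + h (inverse \<zeta>) * (x * jucys_murphy_trace n * w * x)"
    unfolding jucys_murphy.simps sigma_conj by (simp add: d distrib_left distrib_right h_left mult.assoc)
  also have "x * jucys_murphy n * x = 0" using x xx by (metis mult.assoc mult_zero_right)
  also have "x * w * jucys_murphy n * x = jucys_murphy n * x" using x xwx by (metis mult.assoc)
  also have "x * jucys_murphy n * w * x = jucys_murphy n * x" using x xwx by (metis mult.assoc)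
  also have "x * jucys_murphy_trace n * w * x = jucys_murphy_trace n * x" using x xwx by (metis mult.assoc)
  finally show ?case
    using h_add[of 1 1] by (simp add: d distrib_right h_one mult.assoc mult_2)
qed

text \<open>Each of the \<open>2 * n\<close> crossings acts on \<open>e\<close> as the scalar
  \<open>s\<close>.\<close>

lemma jucys_murphy_kill:
  assumes "\<And>i. i < n \<Longrightarrow> u i * e = 0" shows "jucys_murphy n * e = h (\<zeta> ^ n) * e"
  using assms
proof (induction n)
  case 0
  then show ?case by (simp add: h_one)
next
  case (Suc n)
  have s: "sigma n * e = h s * e" using Suc.prems[of n] by (simp add: sigma_def distrib_right mult.assoc)
  have "jucys_murphy (Suc n) * e = sigma n * (jucys_murphy n * (sigma n * e))" by (simp add: mult.assoc)
  also have "\<dots> = h (s * \<zeta> ^ n * s) * e"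
  proof -
    have "jucys_murphy n * e = h (\<zeta> ^ n) * e" using Suc by simp
    then show ?thesis unfolding s h_left[of "jucys_murphy n"] by (simp only: h_prod h_left[of "sigma n"] s)
  qed
  also have "s * \<zeta> ^ n * s = s * s * \<zeta> ^ n" by simp
  finally show ?case using s_sq by (simp add: power2_eq_square)
qed

lemma jucys_murphy_kill':
  assumes "\<And>i. i < n \<Longrightarrow> e * u i = 0" shows "e * jucys_murphy n = h (\<zeta> ^ n) * e"
  using assms
proof (induction n)
  case 0
  then show ?case by (simp add: h_one)
next
  case (Suc n)
  have s: "e * sigma n = h s * e" using Suc.prems[of n]
    by (simp add: sigma_def distrib_left h_left h_central[of e])
  have "e * jucys_murphy (Suc n) = e * sigma n * jucys_murphy n * sigma n" by (simp add: mult.assoc)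
  also have "\<dots> = h s * (h (\<zeta> ^ n) * (h s * e))"
    unfolding s using Suc by (simp add: mult.assoc s)
  also have "\<dots> = h (s * s * \<zeta> ^ n) * e" by (simp add: h_prod ac_simps)
  finally show ?case using s_sq by (simp add: power2_eq_square)
qed

text \<open>Along the recursion the value alternates: from 0 it becomes \<open>2 \<zeta>^n\<close>,
  and the next step gives \<open>2 \<zeta>^n + \<zeta>^(-1) 2 \<zeta>^(n-1) = 0\<close>, because the
  inverse of \<open>\<zeta>\<close> is \<open>- \<zeta>\<close>.\<close>

lemma jucys_murphy_trace_kill:
  assumes "\<And>i. Suc i < n \<Longrightarrow> u i * e = 0"
  shows "jucys_murphy_trace n * e = (if even n then 0 else h (2 * \<zeta> ^ (n - 1)) * e)"
  using assms
proof (induction n)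
  case (Suc n)
  have "jucys_murphy n * e = h (\<zeta> ^ n) * e" using Suc.prems by (intro jucys_murphy_kill) simp
  then have eq: "jucys_murphy_trace (Suc n) * e = h (2 * \<zeta> ^ n) * e + h (inverse \<zeta>) * (if even n then 0 else h (2 * \<zeta> ^ (n - 1)) * e)"
    using Suc by (simp add: distrib_right mult.assoc h_prod)
  show ?case
  proof (cases "even n")
    case False
    then obtain m where n: "n = Suc m" by (cases n) auto
    have "2 * \<zeta> ^ n + inverse \<zeta> * (2 * \<zeta> ^ (n - 1)) = 0"
      by (simp add: n inverse_\<zeta>)
    then have "(h (2 * \<zeta> ^ n) + h (inverse \<zeta> * (2 * \<zeta> ^ (n - 1)))) * e = 0"
      by (simp flip: h_add)
    then show ?thesis using False eq by (simp add: distrib_right h_prod)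
  qed (use eq in simp)
qed simp

lemma double_braid_even:
  assumes kill: "kill_rule b" and M: "2 * b < M"
  shows "P b * jucys_murphy (2 * b + 1) * P b = h (\<zeta> ^ (2 * b + 1)) * P b + h (2 * \<zeta> ^ (2 * b)) * (P b * u (2 * b) * P b)"
proof -
  define p w where d: "p = P b" "w = u (2 * b)"
  have pp: "p * p = p" using kill by (simp add: kill_rule_def d)
  have 1: "jucys_murphy (2 * b) * p = h (\<zeta> ^ (2 * b)) * p" unfolding d by (rule jucys_murphy_kill) (use kill in \<open>simp add: kill_rule_def\<close>)
  have 2: "p * jucys_murphy (2 * b) = h (\<zeta> ^ (2 * b)) * p" unfolding d by (rule jucys_murphy_kill') (use kill in \<open>simp add: kill_rule_def\<close>)
  \<comment> \<open>The number of strands is even here, so the partial trace contributes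
    nothing.\<close>
  have "jucys_murphy_trace (2 * b) * p = 0" unfolding d by (subst jucys_murphy_trace_kill) (use kill in \<open>simp_all add: kill_rule_def\<close>)
  moreover have "w * jucys_murphy (2 * b) * w = w * jucys_murphy_trace (2 * b)" using trace_jucys_murphy[OF M] jucys_murphy_trace_comm[of "2 * b" "2 * b"] by (simp add: d)
  ultimately have 3: "p * (w * jucys_murphy (2 * b) * w) * p = 0" by (simp add: mult.assoc)
  have "p * jucys_murphy (2 * b + 1) * p = h \<zeta> * (p * (jucys_murphy (2 * b) * p)) + p * w * (jucys_murphy (2 * b) * p) + (p * jucys_murphy (2 * b)) * w * p
      + h (inverse \<zeta>) * (p * (w * jucys_murphy (2 * b) * w) * p)"
    unfolding Suc_eq_plus1[symmetric] jucys_murphy.simps sigma_conj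
    by (simp add: d distrib_left distrib_right h_left mult.assoc)
  also have "\<dots> = h (\<zeta> * \<zeta> ^ (2 * b)) * p + (h (\<zeta> ^ (2 * b)) + h (\<zeta> ^ (2 * b))) * (p * w * p)"
  proof -
    let ?c = "\<zeta> ^ (2 * b)"
    have "h \<zeta> * (p * (h ?c * p)) = h (\<zeta> * ?c) * p" unfolding h_left[of p] pp h_prod ..
    moreover have "p * w * (h ?c * p) = h ?c * (p * w * p)" unfolding h_left[of "p * w"] ..
    moreover have "h ?c * p * w * p = h ?c * (p * w * p)" by (simp only: mult.assoc)
    ultimately show ?thesis unfolding 1 2 3 by (simp only: distrib_right mult_zero_right add_0_right add.assoc)
  qed
  also have "h (\<zeta> ^ (2 * b)) + h (\<zeta> ^ (2 * b)) = h (2 * \<zeta> ^ (2 * b))"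
    unfolding mult_2 h_add ..
  finally show ?thesis by (simp add: d)
qed

lemma double_braid_odd:
  assumes kill: "kill_rule b" and M: "2 * b + 1 < M"
  shows "P b * jucys_murphy (2 * b + 2) * P b =
    h (\<zeta> ^ (2 * b + 2)) * P (Suc b) + h (\<zeta> ^ (2 * b)) * (P b * u (2 * b) * u (2 * b + 1) * P b)
    + h (\<zeta> ^ (2 * b)) * (P b * u (2 * b + 1) * u (2 * b) * P b)
    + h (2 * \<zeta> ^ (2 * b + 1)) * (P b * u (2 * b) * P b)
    + h (\<zeta> ^ (2 * b + 2)) * (h (- (of_nat b / of_nat (b + 1))) *
        (P b * u (2 * b) * u (2 * b - 1) * u (2 * b + 1) * u (2 * b) * P b))"
proof -
  define p w x j where d: "p = P b" "w = u (2 * b)" "x = u (2 * b + 1)" "j = jucys_murphy (2 * b + 1)"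
  define B where "B = p * w * u (2 * b - 1) * x * w * p"
  have pp: "p * p = p" using kill by (simp add: kill_rule_def d)
  have px: "p * x = x * p" unfolding d by (rule P_comm) simp
  have pjp: "p * j * p = h (\<zeta> ^ (2 * b + 1)) * p + h (2 * \<zeta> ^ (2 * b)) * (p * w * p)"
    unfolding d by (rule double_braid_even) (use kill M in auto)
  have "jucys_murphy_trace (2 * b + 1) * p = h (2 * \<zeta> ^ (2 * b)) * p"
    unfolding d by (subst jucys_murphy_trace_kill) (use kill in \<open>simp_all add: kill_rule_def\<close>)
  moreover have "x * j * x = x * jucys_murphy_trace (2 * b + 1)"
    using trace_jucys_murphy[OF M] jucys_murphy_trace_comm[of "2 * b + 1" "2 * b + 1"] by (simp add: d)
  ultimately have 3: "p * (x * j * x) * p = h (2 * \<zeta> ^ (2 * b)) * (p * x * p)" by (simp add: mult.assoc h_left)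
  have a: "p * x * j * p = x * (p * j * p)"
    using px pp by (metis mult.assoc)
  have b: "p * j * x * p = (p * j * p) * x"
    using px pp by (metis mult.assoc)
  have pxp: "p * x * p = x * p" using px pp by (metis mult.assoc)
  have e1: "x * (p * w * p) = p * x * w * p" "(p * w * p) * x = p * w * x * p"
    using px by (metis mult.assoc)+
  have "p * jucys_murphy (2 * b + 2) * p = h \<zeta> * (p * j * p) + p * x * j * p + p * j * x * p
      + h (inverse \<zeta>) * (p * (x * j * x) * p)"
  proof -
    have "jucys_murphy (2 * b + 2) = sigma (2 * b + 1) * j * sigma (2 * b + 1)" by (simp add: d)
    then show ?thesis unfolding sigma_conj
      by (simp add: d distrib_left distrib_right h_left mult.assoc)
  qed
  also have "\<dots> = h (\<zeta> * \<zeta> ^ (2 * b + 1)) * p + h (\<zeta> * (2 * \<zeta> ^ (2 * b))) * (p * w * p)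
      + (h (\<zeta> ^ (2 * b + 1)) + h (\<zeta> ^ (2 * b + 1)) + h (inverse \<zeta> * (2 * \<zeta> ^ (2 * b)))) * (x * p)
      + h (2 * \<zeta> ^ (2 * b)) * (p * x * w * p) + h (2 * \<zeta> ^ (2 * b)) * (p * w * x * p)"
  proof -
    let ?c = "\<zeta> ^ (2 * b + 1)" and ?d = "2 * \<zeta> ^ (2 * b)"
    have "h \<zeta> * (p * j * p) = h (\<zeta> * ?c) * p + h (\<zeta> * ?d) * (p * w * p)"
      unfolding pjp distrib_left h_prod ..
    moreover have "p * x * j * p = h ?c * (x * p) + h ?d * (p * x * w * p)"
      unfolding a pjp distrib_left h_left e1 ..
    moreover have "p * j * x * p = h ?c * (x * p) + h ?d * (p * w * x * p)"
      unfolding b pjp distrib_right mult.assoc[of "h _"] e1 px ..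
    moreover have "h (inverse \<zeta>) * (p * (x * j * x) * p) = h (inverse \<zeta> * ?d) * (x * p)"
      unfolding 3 pxp h_prod ..
    ultimately show ?thesis by (simp only: distrib_right add_ac)
  qed
  \<comment> \<open>The trace has odd index here and does not vanish; its multiple of
    \<open>x * p\<close> cancels the two that come from the middle terms.\<close>
  also have "h (\<zeta> ^ (2 * b + 1)) + h (\<zeta> ^ (2 * b + 1)) + h (inverse \<zeta> * (2 * \<zeta> ^ (2 * b))) = 0"
    by (simp add: inverse_\<zeta> flip: h_add)
  finally have lhs: "p * jucys_murphy (2 * b + 2) * p = h (\<zeta> ^ (2 * b + 2)) * p + h (2 * \<zeta> ^ (2 * b + 1)) * (p * w * p)
      + h (2 * \<zeta> ^ (2 * b)) * (p * x * w * p) + h (2 * \<zeta> ^ (2 * b)) * (p * w * x * p)"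
    by (simp add: ac_simps)
  \<comment> \<open>Half of each coefficient \<open>2 \<zeta>^(2b)\<close> is supplied by
    \<open>P (Suc b)\<close>, whose correction terms enter with
    \<open>- \<zeta>^(2b+2) = \<zeta>^(2b)\<close>; the last term of \<open>P (Suc b)\<close> is
    cancelled by the term with \<open>B\<close>.\<close>
  have z2: "\<zeta> ^ (2 * b + 2) = - (\<zeta> ^ (2 * b))" unfolding power_add \<zeta>_sq by simp
  have h22: "h (2 * c) = h c + h c" for c unfolding mult_2 h_add ..
  have PS: "P (Suc b) = p - p * w * x * p - p * x * w * p + h (of_nat b / of_nat (b + 1)) * B"
    by (simp add: jw_rec.simps(2) Let_def d B_def)
  show ?thesis
    unfolding d[symmetric] lhs PS B_def[symmetric] h_minus z2 h22
    by (simp add: algebra_simps)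
qed

section \<open>Naturality of the braiding\<close>

lemma jucys_murphy_eq: "jucys_murphy n = braid_down n * braid_up n"
  by (induction n) (simp_all add: mult.assoc)

lemma braid_up_comm: "n < i \<Longrightarrow> u i * braid_up n = braid_up n * u i"
proof (induction n)
  case (Suc n)
  then have "u i * braid_up (Suc n) = braid_up n * (u i * sigma n)" by (simp flip: mult.assoc)
  then show ?case using sigma_comm(2)[of n i] Suc.prems by (simp add: mult.assoc)
qed simp

text \<open>The product of the two crossings is \<open>\<zeta> + w + x - \<zeta> w x\<close>.
  Multiplied by \<open>x\<close> from the left or by \<open>w\<close> from the right, it leaves only
  \<open>x * w\<close>.\<close>

lemma sigma_yang_baxter:
  assumes "Suc i < M" shows "u (Suc i) * sigma i * sigma (Suc i) = sigma i * sigma (Suc i) * u i"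
proof -
  define w x where d: "w = u i" "x = u (Suc i)"
  have z: "h (s * s) = h \<zeta>" "h (s * inverse s) = 1" "h (inverse s * s) = 1" "h (inverse s * inverse s) = - h \<zeta>"
    using s_sq nonzero inverse_\<zeta> by (simp_all add: power2_eq_square h_one flip: inverse_mult_distrib h_minus)
  have p: "sigma i * sigma (Suc i) = h \<zeta> + w + x - h \<zeta> * (w * x)"
  proof -
    have 1: "h s * (h (inverse s) * x) = x" unfolding h_prod z by simp
    have "h (inverse s) * w * h s = h (inverse s) * (h s * w)" by (simp only: mult.assoc h_central[of w])
    then have 2: "h (inverse s) * w * h s = w" unfolding h_prod z by simp
    have "h (inverse s) * w * (h (inverse s) * x) = h (inverse s) * (h (inverse s) * (w * x))"
      by (simp only: mult.assoc h_left[of w])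
    then have 3: "h (inverse s) * w * (h (inverse s) * x) = - (h \<zeta> * (w * x))" unfolding h_prod z by simp
    have 4: "h s * h s = h \<zeta>" unfolding h_comm z ..
    show ?thesis unfolding sigma_def d[symmetric] distrib_left distrib_right 1 2 3 4 by (simp add: algebra_simps)
  qed
  have "w * w = 0" "x * x = 0" "x * (w * x) = x" "w * x * w = w"
    using u_sq u_up[OF assms] u_down[OF assms] by (simp_all add: d mult.assoc)
  then have "x * (sigma i * sigma (Suc i)) = h \<zeta> * x + x * w - h \<zeta> * x"
    "sigma i * sigma (Suc i) * w = h \<zeta> * w + x * w - h \<zeta> * w"
    unfolding p by (simp_all only: distrib_left distrib_right left_diff_distrib right_diff_distrib h_left
        h_central[of x] mult.assoc add_0_right add_0_left)
  then have "x * (sigma i * sigma (Suc i)) = sigma i * sigma (Suc i) * w" by simp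
  then show ?thesis by (simp add: d mult.assoc)
qed

text \<open>Naturality for a generator: it slides under or over the strand that crosses all others,
  and its index changes by one.\<close>

lemma braid_up_shift:
  "Suc i < n \<Longrightarrow> n \<le> M \<Longrightarrow> u (Suc i) * braid_up n = braid_up n * u i"
proof (induction n)
  case (Suc n)
  show ?case
  proof (cases "Suc i < n")
    case True
    then have "u (Suc i) * braid_up (Suc n) = braid_up n * (u i * sigma n)"
      using Suc by (simp flip: mult.assoc)
    then show ?thesis using sigma_comm(1)[OF True] by (simp add: mult.assoc)
  next
    case False
    then have n: "n = Suc i" using Suc.prems by simp
    have "u (Suc i) * braid_up (Suc n) = u (Suc i) * braid_up i * sigma i * sigma (Suc i)"
      by (simp add: n mult.assoc)
    also have "\<dots> = braid_up i * (u (Suc i) * sigma i * sigma (Suc i))"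
      by (simp add: braid_up_comm mult.assoc)
    also have "\<dots> = braid_up (Suc n) * u i"
      using sigma_yang_baxter[of i] Suc.prems by (simp add: n mult.assoc)
    finally show ?thesis .
  qed
qed simp

text \<open>In the completion both braidings carry the idempotent of the swapped object between
  them, here the recursion in the shifted generators. It moves through the braid and is absorbed by
  \<open>P b\<close>.\<close>

lemma double_braid_sandwich:
  assumes kill: "kill_rule b" and n: "2 * b + 1 \<le> n" "n \<le> M"
  shows "(P b * (braid_down n * jw_rec h (\<lambda>i. u (Suc i)) b)) * (jw_rec h (\<lambda>i. u (Suc i)) b * (braid_up n * P b)) =
    P b * jucys_murphy n * P b"
proof -
  have c: "jw_rec h (\<lambda>i. u (Suc i)) b * braid_up n = braid_up n * P b"
    by (rule comm_jw) (use n in \<open>auto intro: braid_up_shift\<close>)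
  have pp: "P b * P b = P b" using kill by (simp add: kill_rule_def)
  let ?S = "jw_rec h (\<lambda>i. u (Suc i)) b"
  have *: "?S * (braid_up n * P b) = braid_up n * P b"
    unfolding mult.assoc[symmetric] c by (simp only: mult.assoc pp)
  have "(P b * (braid_down n * ?S)) * (?S * (braid_up n * P b)) = P b * (braid_down n * (?S * (?S * (braid_up n * P b))))"
    by (simp only: mult.assoc)
  then show ?thesis unfolding * jucys_murphy_eq by (simp only: mult.assoc)
qed

end

section \<open>Generators of the endomorphism algebras\<close>

definition tl_cup :: "nat \<Rightarrow> nat \<Rightarrow> 'k::field tl" where
  "tl_cup i n = Poly_Mapping.single (cup_diag i n) 1"

definition tl_cap :: "nat \<Rightarrow> nat \<Rightarrow> 'k::field tl" where
  "tl_cap i n = Poly_Mapping.single (flip (cup_diag i n)) 1"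

text \<open>The value 0 out of range lets the square and commutation relations hold for all indices.
  Composition is taken at parameter 0, where it agrees with composition at any parameter of loop
  value 0.\<close>

definition tl_gen :: "nat \<Rightarrow> nat \<Rightarrow> 'k::field tl" where
  "tl_gen i N = (if i + 2 \<le> N then TL.comp 0 (tl_cup i (N - 2)) (tl_cap i (N - 2)) else 0)"

lemma tl_cup_Hom: "i \<le> n \<Longrightarrow> tl_cup i n \<in> Hom n (n + 2)"
  using planar_cup_diag[of i n] by (simp add: tl_cup_def del: add_2_eq_Suc')

lemma tl_cap_Hom: "i \<le> n \<Longrightarrow> tl_cap i n \<in> Hom (n + 2) n"
  using planar_cap_diag[of i n] by (simp add: tl_cap_def del: add_2_eq_Suc')

lemma cup_eq: "cup = tl_cup 0 0" and cap_eq: "cap = tl_cap 0 0"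
  by (simp_all add: cup_def cap_def tl_cup_def tl_cap_def cup_diag_0_0 flip_def)

lemma tl_cup_tensor_id: "i \<le> n \<Longrightarrow> tl_cup i n \<otimes> id_tl k = tl_cup i (n + k)"
  by (simp add: tl_cup_def id_tl_def tensor_single cup_diag_juxtapose_id)

lemma id_tensor_tl_cup: "i \<le> n \<Longrightarrow> id_tl k \<otimes> tl_cup i n = tl_cup (k + i) (k + n)"
  by (simp add: tl_cup_def id_tl_def tensor_single id_juxtapose_cup_diag)

lemma tl_cap_tensor_id: "i \<le> n \<Longrightarrow> tl_cap i n \<otimes> id_tl k = tl_cap i (n + k)"
  by (simp add: tl_cap_def id_tl_def tensor_single flip_cup_diag_juxtapose_id)

lemma id_tensor_tl_cap: "i \<le> n \<Longrightarrow> id_tl k \<otimes> tl_cap i n = tl_cap (k + i) (k + n)"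
  by (simp add: tl_cap_def id_tl_def tensor_single id_juxtapose_flip_cup_diag)

lemma id_cup_id: "id_tl i \<otimes> cup \<otimes> id_tl k = tl_cup i (i + k)"
  using id_tensor_tl_cup[of 0 k i] by (simp add: cup_eq tl_cup_tensor_id)

lemma id_cap_id: "id_tl i \<otimes> cap \<otimes> id_tl k = tl_cap i (i + k)"
  using id_tensor_tl_cap[of 0 k i] by (simp add: cap_eq tl_cap_tensor_id)

lemma add_2_leE:
  fixes i N :: nat
  assumes "i + 2 \<le> N" obtains n where "N = n + 2" "i \<le> n"
  by (rule that[of "N - 2"]) (use assms in auto)

context TL_zero
begin

lemma tl_gen_comp: "i \<le> n \<Longrightarrow> tl_gen i (n + 2) = (tl_cup i n \<odot> tl_cap i n :: 'k tl)"
  by (simp add: tl_gen_def comp_eq_comp_0)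

lemma tl_gen_Hom [simp]: "(tl_gen i N :: 'k tl) \<in> Hom N N"
proof (cases "i + 2 \<le> N")
  case True
  then obtain n where n: "N = n + 2" "i \<le> n" by (rule add_2_leE)
  show ?thesis unfolding n(1) tl_gen_comp[OF n(2)]
    by (rule comp_Hom[OF tl_cup_Hom[OF n(2)] tl_cap_Hom[OF n(2)]])
qed (simp add: tl_gen_def)

lemma tl_gen_tensor_id:
  assumes "i + 2 \<le> N" shows "tl_gen i N \<otimes> id_tl k = (tl_gen i (N + k) :: 'k tl)"
proof -
  obtain n where n: "N = n + 2" "i \<le> n" using assms by (rule add_2_leE)
  have "tl_gen i N \<otimes> id_tl k = (tl_cup i n \<odot> tl_cap i n) \<otimes> (id_tl k \<odot> (id_tl k :: 'k tl))"
    unfolding n(1) tl_gen_comp[OF n(2)] by (simp add: comp_id[OF id_tl_Hom])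
  also have "\<dots> = tl_cup i (n + k) \<odot> tl_cap i (n + k)"
    by (simp add: tensor_comp[OF tl_cup_Hom[OF n(2)] tl_cap_Hom[OF n(2)] id_tl_Hom id_tl_Hom, symmetric]
        tl_cup_tensor_id tl_cap_tensor_id n)
  also have "\<dots> = tl_gen i (n + k + 2)" using n by (intro tl_gen_comp[symmetric]) simp
  finally show ?thesis using n by (simp add: add_ac)
qed

lemma id_tensor_tl_gen:
  assumes "i + 2 \<le> N" shows "id_tl k \<otimes> tl_gen i N = (tl_gen (k + i) (k + N) :: 'k tl)"
proof -
  obtain n where n: "N = n + 2" "i \<le> n" using assms by (rule add_2_leE)
  have "id_tl k \<otimes> tl_gen i N = (id_tl k \<odot> (id_tl k :: 'k tl)) \<otimes> (tl_cup i n \<odot> tl_cap i n)"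
    unfolding n(1) tl_gen_comp[OF n(2)] by (simp add: comp_id[OF id_tl_Hom])
  also have "\<dots> = tl_cup (k + i) (k + n) \<odot> tl_cap (k + i) (k + n)"
    by (simp add: tensor_comp[OF id_tl_Hom id_tl_Hom tl_cup_Hom[OF n(2)] tl_cap_Hom[OF n(2)], symmetric]
        id_tensor_tl_cup id_tensor_tl_cap n)
  also have "\<dots> = tl_gen (k + i) (k + n + 2)" using n by (intro tl_gen_comp[symmetric]) simp
  finally show ?thesis using n by (simp add: add_ac)
qed

lemma tl_cap_cup:
  "i \<le> n \<Longrightarrow> tl_cap i n \<odot> tl_cup i n = 0"
  "i < n \<Longrightarrow> tl_cap i n \<odot> tl_cup (Suc i) n = id_tl n"
  "i < n \<Longrightarrow> tl_cap (Suc i) n \<odot> tl_cup i n = id_tl n"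
  using comp_single[OF planar_cup_diag planar_cap_diag, of _ n _ 1 1]
  by (simp_all add: tl_cap_def tl_cup_def id_tl_def not_no_loop_cap_cup_diag no_loop_cap_cup_Suc
      stack_cap_cup_Suc no_loop_cap_Suc_cup stack_cap_Suc_cup)

lemma tl_gen_sq: "tl_gen i N \<odot> tl_gen i N = 0"
proof (cases "i + 2 \<le> N")
  case True
  then obtain n where n: "N = n + 2" "i \<le> n" by (rule add_2_leE)
  note H = tl_cup_Hom[OF n(2)] tl_cap_Hom[OF n(2)]
  have "(tl_cup i n \<odot> tl_cap i n) \<odot> (tl_cup i n \<odot> tl_cap i n) = tl_cup i n \<odot> tl_cap i n \<odot> tl_cup i n \<odot> tl_cap i n"
    by (rule comp_assoc[OF H comp_Hom[OF H]])
  also have "\<dots> = tl_cup i n \<odot> (tl_cap i n \<odot> tl_cup i n) \<odot> tl_cap i n"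
    by (simp only: comp_assoc[OF H(2,1,2)])
  finally show ?thesis using n by (simp add: tl_gen_comp tl_cap_cup del: add_2_eq_Suc')
qed (simp add: tl_gen_def)

lemma tl_gen_braid:
  assumes i: "i \<le> n" "j \<le> n" and cc: "tl_cap i n \<odot> tl_cup j n = id_tl n" "tl_cap j n \<odot> tl_cup i n = id_tl n"
  shows "(tl_gen i (n + 2) \<odot> tl_gen j (n + 2)) \<odot> tl_gen i (n + 2) = tl_gen i (n + 2)"
proof -
  note H = tl_cup_Hom[OF i(1)] tl_cap_Hom[OF i(1)] tl_cup_Hom[OF i(2)] tl_cap_Hom[OF i(2)]
  have "(tl_cup i n \<odot> tl_cap i n) \<odot> (tl_cup j n \<odot> tl_cap j n) = tl_cup i n \<odot> tl_cap i n \<odot> tl_cup j n \<odot> tl_cap j n"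
    by (rule comp_assoc[OF H(1,2) comp_Hom[OF H(3,4)]])
  also have "\<dots> = tl_cup i n \<odot> (tl_cap i n \<odot> tl_cup j n) \<odot> tl_cap j n" using comp_assoc[OF H(2,3,4)] by simp
  finally have 1: "(tl_cup i n \<odot> tl_cap i n) \<odot> (tl_cup j n \<odot> tl_cap j n) = tl_cup i n \<odot> tl_cap j n"
    using comp_id(1)[OF H(4)] cc by simp
  have "(tl_cup i n \<odot> tl_cap j n) \<odot> (tl_cup i n \<odot> tl_cap i n) = tl_cup i n \<odot> tl_cap j n \<odot> tl_cup i n \<odot> tl_cap i n"
    by (rule comp_assoc[OF H(1,4) comp_Hom[OF H(1,2)]])
  also have "\<dots> = tl_cup i n \<odot> (tl_cap j n \<odot> tl_cup i n) \<odot> tl_cap i n" using comp_assoc[OF H(4,1,2)] by simp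
  finally have 2: "(tl_cup i n \<odot> tl_cap j n) \<odot> (tl_cup i n \<odot> tl_cap i n) = tl_cup i n \<odot> tl_cap i n"
    using comp_id(1)[OF H(2)] cc by simp
  show ?thesis using 1 2 i by (simp add: tl_gen_comp del: add_2_eq_Suc')
qed

lemma tl_gen_up_down:
  assumes "Suc i < N - 1"
  shows "(tl_gen i N \<odot> tl_gen (Suc i) N) \<odot> tl_gen i N = tl_gen i N"
    "(tl_gen (Suc i) N \<odot> tl_gen i N) \<odot> tl_gen (Suc i) N = tl_gen (Suc i) N"
proof -
  obtain n where n: "N = n + 2" "i < n" using assms by (intro that[of "N - 2"]) auto
  then show "(tl_gen i N \<odot> tl_gen (Suc i) N) \<odot> tl_gen i N = tl_gen i N"
    "(tl_gen (Suc i) N \<odot> tl_gen i N) \<odot> tl_gen (Suc i) N = tl_gen (Suc i) N"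
    using tl_gen_braid[of i n "Suc i"] tl_gen_braid[of "Suc i" n i] tl_cap_cup(2,3)[of i n] by simp_all
qed

text \<open>The two generators act on the first \<open>j\<close> strands and on the remaining ones,
  so the interchange law applies.\<close>

lemma tl_gen_comm:
  assumes "Suc i < j" shows "tl_gen i N \<odot> tl_gen j N = tl_gen j N \<odot> tl_gen i N"
proof (cases "j + 2 \<le> N")
  case True
  have "tl_gen i (j + (N - j)) = tl_gen i j \<otimes> (id_tl (N - j) :: 'k tl)"
    by (rule tl_gen_tensor_id[symmetric]) (use assms in simp)
  then have 1: "tl_gen i N = tl_gen i j \<otimes> (id_tl (N - j) :: 'k tl)" using True by simp
  have "tl_gen (j + 0) (j + (N - j)) = id_tl j \<otimes> (tl_gen 0 (N - j) :: 'k tl)"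
    by (rule id_tensor_tl_gen[symmetric]) (use True in simp)
  then have 2: "tl_gen j N = id_tl j \<otimes> (tl_gen 0 (N - j) :: 'k tl)" using True by simp
  show ?thesis unfolding 1 2
    by (simp add: tensor_comp[OF tl_gen_Hom id_tl_Hom id_tl_Hom tl_gen_Hom]
        tensor_comp[OF id_tl_Hom tl_gen_Hom tl_gen_Hom id_tl_Hom] comp_id[OF tl_gen_Hom])
qed (simp add: tl_gen_def)

end

text \<open>The family is concentrated on \<open>N\<close> strands, so the relations need to be
  checked in that component only.\<close>

lift_definition gen_endo :: "nat \<Rightarrow> nat \<Rightarrow> 'k::field tl_endo" is "\<lambda>N i n. if n = N then tl_gen i N else 0"
  by (simp add: TL_zero.tl_gen_Hom[OF TL_zero_0])

lemma component_simps:
  "component (x + y) n = component x n + component y n"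
  "component (x - y) n = component x n - component y n"
  "component (x * y) n = TL.comp 0 (component x n) (component y n)"
  "component 1 n = id_tl n" "component 0 n = 0"
  "component (gen_endo n i) n = tl_gen i n"
  "component (scalar_endo c) n = c \<cdot> id_tl n"
  by (transfer; simp)+

lemma component_Hom [simp]: "component x n \<in> Hom n n"
  by transfer simp

lemma component_scalar: "component (scalar_endo c * x) n = c \<cdot> component x n"
proof -
  interpret TL_zero "0 :: 'a" by (rule TL_zero_0)
  show ?thesis by (simp add: component_simps comp_linear comp_id[OF component_Hom])
qed

lemma lookup_id_tl [simp]: "Poly_Mapping.lookup (id_tl n) (id_diag n) = 1"
  by (simp add: id_tl_def)

lemma endo_eqI: "(\<And>n. component x n = component y n) \<Longrightarrow> x = y"
  by (metis component_inject ext)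

lemma gen_endo_off: "n \<noteq> N \<Longrightarrow> component (gen_endo N i) n = 0"
  by transfer simp

lemma tl_relations_gen_endo: "tl_relations (gen_endo N) (scalar_endo :: 'k::field \<Rightarrow> _) (N - 1)"
proof -
  interpret TL_zero "0 :: 'k" by (rule TL_zero_0)
  have cases: "x = y" if "component x N = component y N" "\<And>n. n \<noteq> N \<Longrightarrow> component x n = 0 \<and> component y n = 0"
    for x y :: "'k tl_endo" using that by (metis endo_eqI)
  show ?thesis
  proof
    fix c d :: 'k and x :: "'k tl_endo" and i j
    show "scalar_endo (c + d) = scalar_endo c + scalar_endo d"
      by (rule endo_eqI) (simp add: component_simps scale_simps)
    show "scalar_endo (c * d) = scalar_endo c * scalar_endo d"
      by (rule endo_eqI) (simp add: component_scalar, simp add: component_simps scale_simps)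
    show "scalar_endo 1 = (1 :: 'k tl_endo)" by (rule endo_eqI) (simp add: component_simps scale_simps)
    show "x * scalar_endo c = scalar_endo c * x"
      by (rule endo_eqI) (simp add: component_simps comp_linear comp_id[OF component_Hom])
    show "gen_endo N i * gen_endo N i = (0 :: 'k tl_endo)"
      by (rule cases) (simp_all add: component_simps gen_endo_off tl_gen_sq)
    show "gen_endo N i * gen_endo N (Suc i) * gen_endo N i = (gen_endo N i :: 'k tl_endo)" if "Suc i < N - 1"
      by (rule cases) (use that in \<open>simp_all add: component_simps gen_endo_off tl_gen_up_down\<close>)
    show "gen_endo N (Suc i) * gen_endo N i * gen_endo N (Suc i) = (gen_endo N (Suc i) :: 'k tl_endo)" if "Suc i < N - 1"
      by (rule cases) (use that in \<open>simp_all add: component_simps gen_endo_off tl_gen_up_down\<close>)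
    show "gen_endo N i * gen_endo N j = (gen_endo N j * gen_endo N i :: 'k tl_endo)" if "Suc i < j"
      using tl_gen_comm[OF that] by (intro cases) (simp_all add: component_simps gen_endo_off)
  qed
qed

section \<open>Jones--Wenzl idempotents\<close>

definition jw_tl :: "nat \<Rightarrow> nat \<Rightarrow> 'k::field tl" where
  "jw_tl b N = component (jw_rec scalar_endo (gen_endo N) b) N"

lemma jw_tl_Hom [simp]: "jw_tl b N \<in> Hom N N"
  by (simp add: jw_tl_def)

lemma jw_tl_0: "jw_tl 0 N = id_tl N"
  by (simp add: jw_tl_def component_simps)

text \<open>\<open>S\<close> is a left ideal containing the generators. Correction terms end in
  \<open>p\<close>, but \<open>r * p = r * (p - 1) + r\<close>, so this factor does no harm. The
  lemma is used for the coefficient of the identity diagram and for the annihilator of an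
  idempotent.\<close>

lemma jw_minus_one:
  assumes "0 \<in> S" "\<And>x y. x \<in> S \<Longrightarrow> y \<in> S \<Longrightarrow> x + y \<in> S" "\<And>r x. x \<in> S \<Longrightarrow> r * x \<in> S"
    "\<And>i. i < 2 * b \<Longrightarrow> u i \<in> S"
  shows "jw_rec h u b - 1 \<in> S"
  using assms(4)
proof (induction b)
  case 0
  then show ?case by (simp add: assms)
next
  case (Suc b)
  define p w x t c where d: "p = jw_rec h u b" "w = u (2 * b)" "x = u (2 * b + 1)" "t = u (2 * b - 1)"
    "c = h (of_nat b / of_nat (b + 1))"
  have S: "p - 1 \<in> S" "w \<in> S" "x \<in> S" using Suc by (auto simp: d)
  have "r * p \<in> S" if "r \<in> S" for r
    using assms(2)[OF that assms(3)[OF S(1), of r]] by (simp add: right_diff_distrib)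
  then have "p * w * x * p \<in> S" "p * x * w * p \<in> S" "p * w * t * x * w * p \<in> S"
    using assms(3)[OF S(3), of "p * w"] assms(3)[OF S(2), of "p * x"] assms(3)[OF S(2), of "p * w * t * x"] by simp_all
  note assms(3)[OF this(1), of "- 1"] assms(3)[OF this(2), of "- 1"] assms(3)[OF this(3), of c]
  note assms(2)[OF assms(2)[OF assms(2)[OF S(1) this(1)] this(2)] this(3)]
  then show ?case by (simp add: jw_rec.simps(2) Let_def d algebra_simps)
qed

context TL_zero
begin

lemma tensor_id_comp:
  "g \<in> Hom n k \<Longrightarrow> f \<in> Hom m n \<Longrightarrow> (g \<odot> f) \<otimes> id_tl l = (g \<otimes> id_tl l) \<odot> (f \<otimes> id_tl l)"
  "g \<in> Hom n k \<Longrightarrow> f \<in> Hom m n \<Longrightarrow> id_tl l \<otimes> (g \<odot> f) = (id_tl l \<otimes> g) \<odot> (id_tl l \<otimes> f)"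
  by (simp_all add: tensor_comp[OF _ _ id_tl_Hom id_tl_Hom] tensor_comp[OF id_tl_Hom id_tl_Hom] comp_id[OF id_tl_Hom])

lemma component_mult: "component (x * y) n = component x n \<odot> component y n"
  by (simp add: component_simps comp_eq_comp_0)

lemma jw_tl_tensor_id: "2 * b < N \<Longrightarrow> jw_tl b N \<otimes> id_tl k = (jw_tl b (N + k) :: 'k tl)"
  unfolding jw_tl_def
  by (rule jw_rec_rel[where R = "\<lambda>x x'. component x N \<otimes> id_tl k = component x' (N + k)"])
    (simp_all add: component_mult tensor_id_comp[OF component_Hom component_Hom],
     simp_all add: component_simps tensor_linear id_tensor_id tl_gen_tensor_id)

text \<open>A strand added on the left shifts every generator by one; this is the idempotent of the
  swapped tensor product.\<close>

lemma id_tensor_jw_tl: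
  "2 * b < N \<Longrightarrow> id_tl 1 \<otimes> (jw_tl b N :: 'k tl) =
     component (jw_rec scalar_endo (\<lambda>i. gen_endo (1 + N) (Suc i)) b) (1 + N)"
  unfolding jw_tl_def
  by (rule jw_rec_rel[where R = "\<lambda>x x'. id_tl 1 \<otimes> component x N = component x' (1 + N)"])
    (simp_all add: component_mult tensor_id_comp[OF component_Hom component_Hom] del: One_nat_def,
     simp_all add: component_simps tensor_linear id_tensor_id id_tensor_tl_gen plus_1_eq_Suc del: One_nat_def)

section \<open>Existence and uniqueness of the Jones--Wenzl idempotents\<close>

lemma lookup_comp_cap:
  assumes "g \<in> Hom n (n + 2)" "i \<le> n"
  shows "Poly_Mapping.lookup (g \<odot> tl_cap i n) (id_diag (n + 2)) = 0"
proof -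
  have "Poly_Mapping.lookup (g \<odot> tl_cap i n) (id_diag (n + 2)) = (\<lambda>_. 0) g"
    using assms(1)
  proof (rule Hom_ext)
    fix D c assume D: "D \<in> planar_matchings n (n + 2)"
    \<comment> \<open>The cap survives at the bottom of every composite, while the identity diagram
      has no such strand.\<close>
    have "{Bot i, Bot (Suc i)} \<in> flip (cup_diag i n)"
      by (simp add: doubleton_in_flip_iff cup_diag_def)
    then have "{Bot i, Bot (Suc i)} \<in> stack D (flip (cup_diag i n))"
      using connected_lowerI[of "{Bot i, Bot (Suc i)}" _ "Bot i" "Bot (Suc i)" D] by (simp add: doubleton_in_stack_iff)
    moreover have "{Bot i, Bot (Suc i)} \<notin> id_diag (n + 2)" by (auto simp: id_diag_def doubleton_eq_iff)
    ultimately have "stack D (flip (cup_diag i n)) \<noteq> id_diag (n + 2)" by metis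
    then show "Poly_Mapping.lookup (Poly_Mapping.single D c \<odot> tl_cap i n) (id_diag (n + 2)) = 0"
      by (simp add: tl_cap_def comp_single[OF planar_cap_diag[OF assms(2)] D] lookup_single_not_eq)
  qed (simp_all add: comp_linear lookup_add)
  then show ?thesis by simp
qed

lemma lookup_jw_tl:
  assumes "2 * b < N" shows "Poly_Mapping.lookup (jw_tl b N :: 'k tl) (id_diag N) = 1"
proof -
  let ?\<epsilon> = "\<lambda>x :: 'k tl_endo. Poly_Mapping.lookup (component x N) (id_diag N)"
  \<comment> \<open>Quantifying over the left factor \<open>r\<close> turns the vanishing of the
    coefficient into a left ideal.\<close>
  have "jw_rec scalar_endo (gen_endo N) b - 1 \<in> {x. \<forall>r. ?\<epsilon> (r * x) = 0}"
  proof (rule jw_minus_one)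
    fix i assume "i < 2 * b"
    then obtain n where n: "N = n + 2" "i \<le> n" using assms by (intro that[of "N - 2"]) auto
    have "?\<epsilon> (r * gen_endo N i) = 0" for r
    proof -
      have "component r N \<odot> tl_cup i n \<odot> tl_cap i n = (component r N \<odot> tl_cup i n) \<odot> tl_cap i n"
        unfolding n(1) by (rule comp_assoc[OF component_Hom tl_cup_Hom[OF n(2)] tl_cap_Hom[OF n(2)], symmetric])
      moreover have "component r N \<odot> tl_cup i n \<in> Hom n (n + 2)"
        unfolding n(1) using comp_Hom[OF component_Hom tl_cup_Hom[OF n(2)]] .
      ultimately show ?thesis
        using lookup_comp_cap[OF _ n(2)] n by (simp add: component_mult component_simps tl_gen_comp del: add_2_eq_Suc')
    qed
    then show "gen_endo N i \<in> {x. \<forall>r. ?\<epsilon> (r * x) = 0}" by simp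
  qed (simp_all add: component_simps(1,5) distrib_left lookup_add flip: mult.assoc)
  then have "?\<epsilon> (1 * (jw_rec scalar_endo (gen_endo N) b - 1)) = 0" by blast
  then show ?thesis by (simp add: jw_tl_def component_simps lookup_minus id_tl_def)
qed

text \<open>By \<open>planar_not_id\<close> every other diagram has a cup at its top, which
  \<open>e\<close> kills; only the identity diagram contributes.\<close>

lemma lookup_id_comp:
  assumes e: "e \<in> Hom N N" and kill: "\<And>i n. N = n + 2 \<Longrightarrow> i \<le> n \<Longrightarrow> e \<odot> tl_cup i n = 0" and f: "f \<in> Hom N N"
  shows "e \<odot> f = Poly_Mapping.lookup f (id_diag N) \<cdot> e"
  using f
proof (rule Hom_ext)
  fix D c assume D: "D \<in> planar_matchings N N"
  show "e \<odot> Poly_Mapping.single D c = Poly_Mapping.lookup (Poly_Mapping.single D c) (id_diag N) \<cdot> e"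
  proof (cases "D = id_diag N")
    case True
    have "Poly_Mapping.single D c = c \<cdot> id_tl N" by (simp add: id_tl_def scale_simps True)
    then show ?thesis using comp_id(2)[OF e] True by (simp add: comp_linear)
  next
    case False
    obtain i D' where D': "i + 2 \<le> N" "D' \<in> planar_matchings N (N - 2)" "D = stack (cup_diag i (N - 2)) D'"
      using planar_not_id[OF D False] .
    obtain n where n: "N = n + 2" "i \<le> n" using D'(1) by (rule add_2_leE)
    have D'n: "D' \<in> planar_matchings (n + 2) n" using D'(2) n by simp
    have "tl_cup i n \<odot> Poly_Mapping.single D' c = Poly_Mapping.single D c"
      using n D'(3) by (simp add: tl_cup_def comp_single[OF D'n planar_cup_diag[OF n(2)]] no_loop_cup_diag[OF D'n n(2)])
    then have "e \<odot> Poly_Mapping.single D c = e \<odot> tl_cup i n \<odot> Poly_Mapping.single D' c" by simp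
    also have "\<dots> = (e \<odot> tl_cup i n) \<odot> Poly_Mapping.single D' c"
      using e unfolding n(1) by (intro comp_assoc[symmetric, OF _ tl_cup_Hom[OF n(2)] Hom_simps(6)[OF D'n]])
    finally show ?thesis using kill[OF n] False by (simp add: lookup_single scale_simps)
  qed
qed (simp_all add: comp_linear lookup_add scale_simps)

text \<open>A neighbouring cap straightens the cup in \<open>tl_gen\<close> and thereby removes it.
  A neighbour exists because \<open>n\<close> is not 0.\<close>

lemma tl_cup_cap_cancel:
  assumes "i \<le> n" "n \<noteq> 0"
  shows "f \<in> Hom m (n + 2) \<Longrightarrow> tl_gen i (n + 2) \<odot> f = 0 \<Longrightarrow> tl_cap i n \<odot> f = 0"
    and "g \<in> Hom (n + 2) m \<Longrightarrow> g \<odot> tl_gen i (n + 2) = 0 \<Longrightarrow> g \<odot> tl_cup i n = 0"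
proof -
  obtain j where j: "j \<le> n" "tl_cap j n \<odot> tl_cup i n = id_tl n" "tl_cap i n \<odot> tl_cup j n = id_tl n"
  proof (cases i)
    case 0
    then show ?thesis using that[of 1] tl_cap_cup(2,3)[of 0 n] assms by simp
  next
    case (Suc k)
    then show ?thesis using that[of k] tl_cap_cup(2,3)[of k n] assms by simp
  qed
  note H = tl_cup_Hom[OF assms(1)] tl_cap_Hom[OF assms(1)] tl_cup_Hom[OF j(1)] tl_cap_Hom[OF j(1)]
  {
    assume f: "f \<in> Hom m (n + 2)" and z: "tl_gen i (n + 2) \<odot> f = 0"
    have "tl_cap i n \<odot> f = (tl_cap j n \<odot> tl_cup i n) \<odot> tl_cap i n \<odot> f"
      using comp_id(1)[OF comp_Hom[OF H(2) f]] j by simp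
    also have "\<dots> = tl_cap j n \<odot> (tl_cup i n \<odot> tl_cap i n) \<odot> f"
      by (simp only: comp_assoc[OF H(4,1) comp_Hom[OF H(2) f]] comp_assoc[OF H(1,2) f])
    finally show "tl_cap i n \<odot> f = 0" using z by (simp add: tl_gen_comp[OF assms(1)] del: add_2_eq_Suc')
  }
  {
    assume g: "g \<in> Hom (n + 2) m" and z: "g \<odot> tl_gen i (n + 2) = 0"
    have "g \<odot> tl_cup i n = (g \<odot> tl_cup i n) \<odot> tl_cap i n \<odot> tl_cup j n"
      using comp_id(2)[OF comp_Hom[OF g H(1)]] j by simp
    also have "\<dots> = (g \<odot> tl_cup i n \<odot> tl_cap i n) \<odot> tl_cup j n"
      by (simp only: comp_assoc[OF comp_Hom[OF g H(1)] H(2,3), symmetric] comp_assoc[OF g H(1,2)])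
    finally show "g \<odot> tl_cup i n = 0" using z by (simp add: tl_gen_comp[OF assms(1)] del: add_2_eq_Suc')
  }
qed

lemma jw_tl_kill:
  assumes kill: "tl_relations.kill_rule (gen_endo N) (scalar_endo :: 'k \<Rightarrow> _) b"
  shows "jw_tl b N \<odot> jw_tl b N = (jw_tl b N :: 'k tl)"
    "i < 2 * b \<Longrightarrow> tl_gen i N \<odot> (jw_tl b N :: 'k tl) = 0"
    "i < 2 * b \<Longrightarrow> (jw_tl b N :: 'k tl) \<odot> tl_gen i N = 0"
proof -
  interpret R: tl_relations "gen_endo N" "scalar_endo :: 'k \<Rightarrow> _" "N - 1" by (rule tl_relations_gen_endo)
  note k = kill[unfolded R.kill_rule_def]
  show "jw_tl b N \<odot> jw_tl b N = (jw_tl b N :: 'k tl)"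
    unfolding jw_tl_def component_mult[symmetric] using k by simp
  assume i: "i < 2 * b"
  have "component (gen_endo N i * jw_rec scalar_endo (gen_endo N) b) N = (0 :: 'k tl)"
    using k i by (simp add: component_simps(5))
  then show "tl_gen i N \<odot> (jw_tl b N :: 'k tl) = 0"
    unfolding component_mult component_simps(6) by (simp add: jw_tl_def)
  have "component (jw_rec scalar_endo (gen_endo N) b * gen_endo N i) N = (0 :: 'k tl)"
    using k i by (simp add: component_simps(5))
  then show "(jw_tl b N :: 'k tl) \<odot> tl_gen i N = 0"
    unfolding component_mult component_simps(6) by (simp add: jw_tl_def)
qed

context
  fixes b :: nat
  assumes of_nat_nonzero: "\<And>j. 0 < j \<Longrightarrow> j \<le> b \<Longrightarrow> of_nat j \<noteq> (0 :: 'k)"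
begin

lemma kill_rule_gen_endo: "2 * b < N \<Longrightarrow> tl_relations.kill_rule (gen_endo N) (scalar_endo :: 'k \<Rightarrow> _) b"
  by (rule tl_relations.kill_rule[OF tl_relations_gen_endo]) (use of_nat_nonzero in auto)

lemma is_JW_jw_tl: "is_JW (2 * b + 1) (jw_tl b (2 * b + 1))"
  unfolding is_JW_def
proof (intro conjI allI impI)
  let ?N = "2 * b + 1"
  note k = jw_tl_kill[OF kill_rule_gen_endo[of ?N]]
  show "jw_tl b ?N \<odot> jw_tl b ?N = (jw_tl b ?N :: 'k tl)" using k(1) by simp
  show "Poly_Mapping.lookup (jw_tl b ?N :: 'k tl) (id_diag ?N) = 1" by (rule lookup_jw_tl) simp
  fix i assume i: "i + 2 \<le> ?N"
  then obtain n where n: "?N = n + 2" "i \<le> n" by (rule add_2_leE)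
  \<comment> \<open>By parity: \<open>n + 2 = 2 * b + 1\<close>.\<close>
  have "n \<noteq> 0" using n(1) by presburger
  have "i < 2 * b" using i by simp
  then have z: "tl_gen i (n + 2) \<odot> (jw_tl b ?N :: 'k tl) = 0" "(jw_tl b ?N :: 'k tl) \<odot> tl_gen i (n + 2) = 0"
    using k(2,3) unfolding n(1)[symmetric] by simp_all
  have H: "(jw_tl b ?N :: 'k tl) \<in> Hom ?N (n + 2)" "(jw_tl b ?N :: 'k tl) \<in> Hom (n + 2) ?N"
    using jw_tl_Hom n(1) by metis+
  have ni: "i + (?N - 2 - i) = n" using n by simp
  show "(id_tl i \<otimes> cap \<otimes> id_tl (?N - 2 - i)) \<odot> (jw_tl b ?N :: 'k tl) = 0"
    "(jw_tl b ?N :: 'k tl) \<odot> (id_tl i \<otimes> cup \<otimes> id_tl (?N - 2 - i)) = 0"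
    unfolding id_cap_id id_cup_id ni
    using tl_cup_cap_cancel(1)[OF n(2) \<open>n \<noteq> 0\<close> H(1) z(1)] tl_cup_cap_cancel(2)[OF n(2) \<open>n \<noteq> 0\<close> H(2) z(2)] by simp_all
qed simp

text \<open>With \<open>p\<close> for \<open>jw_tl\<close>, both \<open>p * e = p\<close>, because
  \<open>e\<close> has coefficient 1 at the identity and \<open>p\<close> kills cups, and
  \<open>p * e = e\<close>, because \<open>p - 1\<close> lies in the left ideal of the generators,
  which annihilate \<open>e\<close>.\<close>

lemma is_JW_unique:
  assumes "is_JW (2 * b + 1) e" shows "e = jw_tl b (2 * b + 1)"
proof -
  let ?N = "2 * b + 1"
  let ?p = "jw_tl b ?N :: 'k tl"
  have e: "e \<in> Hom ?N ?N" "Poly_Mapping.lookup e (id_diag ?N) = 1" using assms by (auto simp: is_JW_def)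
  have cap: "tl_cap i n \<odot> e = 0" "?p \<odot> tl_cup i n = 0" if n: "?N = n + 2" "i \<le> n" for i n
  proof -
    have "i + (?N - 2 - i) = n" "i + 2 \<le> ?N" using n by auto
    then show "tl_cap i n \<odot> e = 0" "?p \<odot> tl_cup i n = 0"
      using assms is_JW_jw_tl unfolding is_JW_def id_cap_id id_cup_id by metis+
  qed
  have "?p \<odot> e = ?p"
    using lookup_id_comp[OF jw_tl_Hom cap(2) e(1)] e(2) by (simp add: scale_simps)
  moreover have "jw_rec scalar_endo (gen_endo ?N) b - 1 \<in> {x. component x ?N \<odot> e = 0}"
  proof (rule jw_minus_one)
    fix i assume "i < 2 * b"
    then have "i + 2 \<le> ?N" by simp
    then obtain n where n: "?N = n + 2" "i \<le> n" by (rule add_2_leE)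
    have e': "e \<in> Hom ?N (n + 2)" using e n(1) by metis
    have "tl_gen i ?N \<odot> e = tl_cup i n \<odot> tl_cap i n \<odot> e"
      using comp_assoc[OF tl_cup_Hom[OF n(2)] tl_cap_Hom[OF n(2)] e'] unfolding n(1) tl_gen_comp[OF n(2)] by simp
    then show "gen_endo ?N i \<in> {x. component x ?N \<odot> e = 0}" using cap(1)[OF n] by (simp add: component_simps)
  next
    fix r x assume "x \<in> {x. component x ?N \<odot> e = 0}"
    then show "r * x \<in> {x. component x ?N \<odot> e = 0}"
      using comp_assoc[OF component_Hom component_Hom e(1), of r x] by (simp add: component_mult)
  qed (simp_all add: component_simps comp_linear)
  then have "?p \<odot> e = e"
    using comp_id(1)[OF e(1)] by (simp only: mem_Collect_eq component_simps comp_linear jw_tl_def right_minus_eq)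
  ultimately show ?thesis by simp
qed

lemma JW_eq: "JW (2 * b + 1) = jw_tl b (2 * b + 1)"
  unfolding JW_def using is_JW_jw_tl is_JW_unique by (intro the_equality)

lemma E_eq: "E (2 * b + 1) = jw_tl b (2 * b + 1)" "E (2 * b + 2) = jw_tl b (2 * b + 2)"
  using JW_eq jw_tl_tensor_id[of b "2 * b + 1" 1] by (simp_all add: E_def)

end

end

section \<open>Evaluation of the diagrammatic expressions\<close>

lemma tl_cup_Hom_base:
  "tl_cup 0 0 \<in> Hom 0 2" "tl_cup 1 2 \<in> Hom 2 4" "tl_cap 0 0 \<in> Hom 2 0" "tl_cap 1 2 \<in> Hom 4 2"
  using tl_cup_Hom[of 0 0] tl_cup_Hom[of 1 2] tl_cap_Hom[of 0 0] tl_cap_Hom[of 1 2]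
  by (simp_all del: One_nat_def add_2_eq_Suc add_2_eq_Suc')

text \<open>The first cup becomes the outer strand, and the second is inserted inside it.\<close>

lemma cup2_eq: "cup2 = (TL.comp 0 (tl_cup 1 2) (tl_cup 0 0) :: 'k::field tl)"
  and cap2_eq: "cap2 = (TL.comp 0 (tl_cap 0 0) (tl_cap 1 2) :: 'k::field tl)"
proof -
  interpret TL_zero "0 :: 'k" by (rule TL_zero_0)
  have p: "cup_diag 0 0 \<in> planar_matchings 0 2" "cup_diag 1 2 \<in> planar_matchings 2 4"
    using planar_cup_diag[of 0 0] planar_cup_diag[of 1 2]
    by (simp_all del: One_nat_def add_2_eq_Suc add_2_eq_Suc')
  have s: "stack (cup_diag 1 2) (cup_diag 0 0) = {{Top 0, Top 3}, {Top 1, Top 2}}"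
    by (simp add: stack_cup_diag[OF p(1)], simp add: add_cup_def cup_diag_0_0 ins_def insert_commute numeral_2_eq_2 numeral_3_eq_3)
  have f: "stack (flip (cup_diag 0 0)) (flip (cup_diag 1 2)) = {{Bot 0, Bot 3}, {Bot 1, Bot 2}}"
    unfolding flip_stack[symmetric] s by (simp add: flip_def)
  show "cup2 = (TL.comp 0 (tl_cup 1 2) (tl_cup 0 0) :: 'k tl)"
    unfolding cup2_def tl_cup_def comp_single[OF p] using no_loop_cup_diag[OF p(1), of 1] s by simp
  show "cap2 = (TL.comp 0 (tl_cap 0 0) (tl_cap 1 2) :: 'k tl)"
    unfolding cap2_def tl_cap_def comp_single[OF planar_flip[OF p(2)] planar_flip[OF p(1)]]
    using no_loop_cup_diag[OF p(1), of 1] f by (simp add: no_loop_flip)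
qed

context TL_zero
begin

lemma id_cup2: "id_tl k \<otimes> cup2 = (tl_cup (k + 1) (k + 2) \<odot> tl_cup k k :: 'k tl)"
proof -
  have "id_tl k \<otimes> (tl_cup 1 2 \<odot> tl_cup 0 0) = (id_tl k \<otimes> tl_cup 1 2) \<odot> (id_tl k \<otimes> (tl_cup 0 0 :: 'k tl))"
    by (rule tensor_id_comp(2)[OF tl_cup_Hom_base(2,1)])
  then show ?thesis by (simp add: cup2_eq comp_eq_comp_0 id_tensor_tl_cup)
qed

lemma id_cap2: "id_tl k \<otimes> cap2 = (tl_cap k k \<odot> tl_cap (k + 1) (k + 2) :: 'k tl)"
proof -
  have "id_tl k \<otimes> (tl_cap 0 0 \<odot> tl_cap 1 2) = (id_tl k \<otimes> tl_cap 0 0) \<odot> (id_tl k \<otimes> (tl_cap 1 2 :: 'k tl))"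
    by (rule tensor_id_comp(2)[OF tl_cup_Hom_base(3,4)])
  then show ?thesis by (simp add: cap2_eq comp_eq_comp_0 id_tensor_tl_cap)
qed

lemma slide_cup:
  assumes "f \<in> Hom n n" shows "tl_cup n n \<odot> f = (f \<otimes> id_tl 2) \<odot> tl_cup n n"
proof -
  have c: "id_tl n \<otimes> tl_cup 0 0 = (tl_cup n n :: 'k tl)" using id_tensor_tl_cup[of 0 0 n] by simp
  note H = tl_cup_Hom_base(1)
  have "(id_tl n \<otimes> tl_cup 0 0) \<odot> (f \<otimes> id_tl 0) = (f \<otimes> id_tl 2) \<odot> (id_tl n \<otimes> tl_cup 0 0)"
    unfolding tensor_comp[OF id_tl_Hom assms H id_tl_Hom] tensor_comp[OF assms id_tl_Hom id_tl_Hom H]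
    by (simp add: comp_id[OF assms] comp_id[OF H])
  then show ?thesis by (simp add: c tensor_id_0)
qed

text \<open>Expressions that pass through two strands fewer are turned into products of
  endomorphisms. The cup at the far right slides past \<open>Z\<close>, so cup, \<open>Z\<close> and
  cap there give \<open>Z'\<close> times a generator; a cup or cap at \<open>i\<close> differs from
  the one at \<open>Suc i\<close> by a factor \<open>w\<close>.\<close>

lemma tl_gen_Suc_sandwich:
  assumes Z: "Z \<in> Hom (Suc i) (Suc i)"
  defines "N \<equiv> Suc i + 2"
  defines "Z' \<equiv> Z \<otimes> id_tl 2" and "w \<equiv> tl_gen i N" and "x \<equiv> tl_gen (Suc i) N"
  shows "tl_cup i (Suc i) \<odot> Z \<odot> tl_cap (Suc i) (Suc i) = w \<odot> Z' \<odot> x"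
    "tl_cup (Suc i) (Suc i) \<odot> Z \<odot> tl_cap i (Suc i) = Z' \<odot> x \<odot> w"
    "tl_cup i (Suc i) \<odot> Z \<odot> tl_cap i (Suc i) = w \<odot> Z' \<odot> x \<odot> w"
proof -
  let ?C = "tl_cup i (Suc i) :: 'k tl" and ?K = "tl_cap i (Suc i) :: 'k tl"
  let ?C1 = "tl_cup (Suc i) (Suc i) :: 'k tl" and ?K1 = "tl_cap (Suc i) (Suc i) :: 'k tl"
  have H: "?C \<in> Hom (Suc i) N" "?K \<in> Hom N (Suc i)" "?C1 \<in> Hom (Suc i) N" "?K1 \<in> Hom N (Suc i)"
    unfolding N_def by (rule tl_cup_Hom tl_cap_Hom; simp)+
  have w: "w = ?C \<odot> ?K" and x: "x = ?C1 \<odot> ?K1" unfolding w_def x_def N_def by (rule tl_gen_comp; simp)+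
  have wx: "w \<in> Hom N N" "x \<in> Hom N N" by (simp_all add: w_def x_def)
  have Z': "Z' \<in> Hom N N" unfolding Z'_def N_def using Z by (intro tensor_Hom) simp_all
  have slide: "?C1 \<odot> Z = Z' \<odot> ?C1" unfolding Z'_def by (rule slide_cup[OF Z])
  have C: "?C = w \<odot> ?C1"
    unfolding w comp_assoc[OF H(1,2,3)] using tl_cap_cup(2)[of i "Suc i"] comp_id(2)[OF H(1)] by simp
  have K: "?K = ?K1 \<odot> w"
    unfolding w comp_assoc[OF H(4,1,2), symmetric] using tl_cap_cup(3)[of i "Suc i"] comp_id(1)[OF H(2)] by simp
  have main: "?C1 \<odot> Z \<odot> ?K1 = Z' \<odot> x"
    unfolding comp_assoc[OF H(3) Z H(4), symmetric] slide x comp_assoc[OF Z' H(3,4)] ..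
  have "?C \<odot> Z \<odot> ?K1 = w \<odot> ?C1 \<odot> Z \<odot> ?K1"
    by (subst C) (rule comp_assoc[OF wx(1) H(3) comp_Hom[OF Z H(4)]])
  then show 1: "?C \<odot> Z \<odot> ?K1 = w \<odot> Z' \<odot> x" unfolding main .
  have "?C1 \<odot> Z \<odot> ?K = (?C1 \<odot> Z \<odot> ?K1) \<odot> w"
    by (subst K) (simp only: comp_assoc[OF H(3) comp_Hom[OF Z H(4)] wx(1)] comp_assoc[OF Z H(4) wx(1)])
  then show "?C1 \<odot> Z \<odot> ?K = Z' \<odot> x \<odot> w" unfolding main comp_assoc[OF Z' wx(2,1)] .
  have "?C \<odot> Z \<odot> ?K = (?C \<odot> Z \<odot> ?K1) \<odot> w"
    by (subst K) (simp only: comp_assoc[OF H(1) comp_Hom[OF Z H(4)] wx(1)] comp_assoc[OF Z H(4) wx(1)])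
  then show "?C \<odot> Z \<odot> ?K = w \<odot> Z' \<odot> x \<odot> w"
    unfolding 1 comp_assoc[OF wx(1) comp_Hom[OF Z' wx(2)] wx(1)] comp_assoc[OF Z' wx(2,1)] .
qed

lemma component_jw: "component (jw_rec scalar_endo (gen_endo N) b) N = (jw_tl b N :: 'k tl)"
  by (simp add: jw_tl_def)

context
  fixes b :: nat
  assumes of_nat_nonzero: "\<And>j. 0 < j \<Longrightarrow> j \<le> b \<Longrightarrow> of_nat j \<noteq> (0 :: 'k)"
begin

lemma E_pred: "b \<noteq> 0 \<Longrightarrow> E (2 * b - 1) = jw_tl (b - 1) (2 * b - 1)"
proof -
  assume "b \<noteq> 0"
  then have "2 * (b - 1) + 1 = 2 * b - 1" by simp
  then show ?thesis using E_eq(1)[of "b - 1"] of_nat_nonzero \<open>b \<noteq> 0\<close> by (simp del: One_nat_def)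
qed

lemma L_eq:
  "L (2 * b + 2) = component (jw_rec scalar_endo (gen_endo (2 * b + 2)) b * gen_endo (2 * b + 2) (2 * b) *
      jw_rec scalar_endo (gen_endo (2 * b + 2)) b) (2 * b + 2)"
proof -
  have "cup \<odot> cap = (tl_gen 0 2 :: 'k tl)" using tl_gen_comp[of 0 0] by (simp add: cup_eq cap_eq numeral_2_eq_2)
  then have "id_tl (2 * b) \<otimes> (cup \<odot> cap) = (tl_gen (2 * b) (2 * b + 2) :: 'k tl)"
    using id_tensor_tl_gen[of 0 2 "2 * b"] by simp
  then show ?thesis
    using E_eq(2)[OF of_nat_nonzero, of b]
    by (simp add: L_def component_mult component_jw component_simps(6) comp_assoc[OF jw_tl_Hom tl_gen_Hom jw_tl_Hom]
        del: add_2_eq_Suc')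
qed

lemma
  defines "N \<equiv> 2 * b + 3"
  defines "P \<equiv> jw_rec scalar_endo (gen_endo N) b :: 'k tl_endo" and "w \<equiv> gen_endo N (2 * b)" and "x \<equiv> gen_endo N (2 * b + 1)"
    and "t \<equiv> gen_endo N (2 * b - 1)"
  shows A_eq: "A N = component (P * w * P * x * P) N"
    and A_tilde_eq: "A_tilde N = component (P * P * x * w * P) N"
    and Y_eq: "Y N = component (P * w * P * x * w * P) N"
    and B_eq: "b \<noteq> 0 \<Longrightarrow> B N = (- (of_nat b / of_nat (b + 1))) \<cdot>
      component (P * w * jw_rec scalar_endo (gen_endo N) (b - 1) * t * x * w * P) N"
proof -
  define i where "i = 2 * b"
  have N: "N = Suc i + 2" "N - 2 = Suc i" "N - 3 = i" "N = Suc (Suc (Suc i))" "N - 4 = 2 * b - 1"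
    by (simp_all add: N_def i_def)
  define q where "q = (jw_tl b (Suc i) :: 'k tl)"
  have q: "q \<in> Hom (Suc i) (Suc i)" by (simp add: q_def)
  have E: "E (N - 2) = q" using E_eq(1)[OF of_nat_nonzero] by (simp add: N q_def i_def)
  have p: "q \<otimes> id_tl 2 = component P N"
    using jw_tl_tensor_id[of b "Suc i" 2] by (simp add: q_def i_def P_def component_jw N)
  have wx: "tl_gen i N = (component w N :: 'k tl)" "tl_gen (Suc i) N = (component x N :: 'k tl)"
    by (simp_all add: w_def x_def i_def component_simps)
  have cups: "id_tl (N - 3) \<otimes> cup \<otimes> id_tl 1 = (tl_cup i (Suc i) :: 'k tl)"
    "id_tl (N - 2) \<otimes> cup = (tl_cup (Suc i) (Suc i) :: 'k tl)"
    "id_tl (N - 3) \<otimes> cap \<otimes> id_tl 1 = (tl_cap i (Suc i) :: 'k tl)"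
    "id_tl (N - 2) \<otimes> cap = (tl_cap (Suc i) (Suc i) :: 'k tl)"
    using id_cup_id[of i 1] id_cup_id[of "Suc i" 0] id_cap_id[of i 1] id_cap_id[of "Suc i" 0]
    by (simp_all add: N tensor_id_0)
  let ?C = "tl_cup i (Suc i) :: 'k tl" and ?K = "tl_cap i (Suc i) :: 'k tl"
  let ?C1 = "tl_cup (Suc i) (Suc i) :: 'k tl" and ?K1 = "tl_cap (Suc i) (Suc i) :: 'k tl"
  let ?p = "component P N"
  have H: "?C \<in> Hom (Suc i) N" "?K \<in> Hom N (Suc i)" "?C1 \<in> Hom (Suc i) N" "?K1 \<in> Hom N (Suc i)"
    unfolding N(1) by (rule tl_cup_Hom tl_cap_Hom; simp)+
  note sandwich = tl_gen_Suc_sandwich[where i = i, folded N(1), unfolded wx]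
  have assoc: "c \<odot> Z \<odot> k \<odot> ?p = (c \<odot> Z \<odot> k) \<odot> ?p"
    if "c \<in> Hom (Suc i) N" "Z \<in> Hom (Suc i) (Suc i)" "k \<in> Hom N (Suc i)" for c Z k
    using comp_assoc[OF that(1) comp_Hom[OF that(2,3)] component_Hom] comp_assoc[OF that(2,3) component_Hom] by simp
  show "A N = component (P * w * P * x * P) N"
    unfolding A_def Let_def E cups p assoc[OF H(1) q H(4)] sandwich(1)[OF q] component_mult
    by (simp only: flip: component_mult) (simp only: mult.assoc)
  show "A_tilde N = component (P * P * x * w * P) N"
    unfolding A_tilde_def Let_def E cups p assoc[OF H(3) q H(2)] sandwich(2)[OF q] component_mult
    by (simp only: flip: component_mult) (simp only: mult.assoc)
  show "Y N = component (P * w * P * x * w * P) N"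
    unfolding Y_def Let_def E cups p assoc[OF H(1) q H(2)] sandwich(3)[OF q] component_mult
    by (simp only: flip: component_mult) (simp only: mult.assoc)
  assume b: "b \<noteq> 0"
  define k where "k = 2 * b - 1"
  have k: "k + 1 = i" "k + 2 = Suc i" "k = 2 * (b - 1) + 1" using b by (auto simp: k_def i_def)
  define r where "r = (jw_tl (b - 1) k :: 'k tl)"
  have r: "r \<in> Hom k k" by (simp add: r_def)
  have Er: "E (N - 4) = r" using E_pred[OF b] by (simp add: N(5) r_def k_def)
  have c2: "id_tl (N - 4) \<otimes> cup2 = (?C \<odot> tl_cup k k :: 'k tl)" "id_tl (N - 4) \<otimes> cap2 = (tl_cap k k \<odot> ?K :: 'k tl)"
    unfolding N(5) k_def[symmetric] id_cup2 id_cap2 k(1,2) by (rule refl)+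
  have h: "(tl_cup k k :: 'k tl) \<in> Hom k (Suc i)" "(tl_cap k k :: 'k tl) \<in> Hom (Suc i) k"
    unfolding k(2)[symmetric] by (rule tl_cup_Hom tl_cap_Hom; simp)+
  \<comment> \<open>\<open>Z\<close> comprises the outer cup and cap with the idempotent between
    them. The inner cup and cap are \<open>?C\<close> and \<open>?K\<close>, so the sandwich rule
    applies once more.\<close>
  define Z where "Z = (r \<otimes> id_tl 2) \<odot> (tl_gen k (Suc i) :: 'k tl)"
  have rt: "r \<otimes> id_tl 2 = (jw_tl (b - 1) (Suc i) :: 'k tl)"
    using jw_tl_tensor_id[of "b - 1" k 2] k by (simp add: r_def)
  have Z: "Z \<in> Hom (Suc i) (Suc i)" unfolding Z_def rt by (rule comp_Hom[OF jw_tl_Hom tl_gen_Hom])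
  have Z2: "Z \<otimes> id_tl 2 = component (jw_rec scalar_endo (gen_endo N) (b - 1) * t) N"
  proof -
    have "Z \<otimes> id_tl 2 = (jw_tl (b - 1) (Suc i) \<otimes> id_tl 2) \<odot> (tl_gen k (Suc i) \<otimes> (id_tl 2 :: 'k tl))"
      unfolding Z_def rt by (rule tensor_id_comp(1)[OF jw_tl_Hom tl_gen_Hom])
    also have "\<dots> = jw_tl (b - 1) N \<odot> tl_gen k N"
      using k by (subst jw_tl_tensor_id; (subst tl_gen_tensor_id)?) (simp_all add: N(1) del: add_2_eq_Suc add_2_eq_Suc')
    finally show ?thesis by (simp add: component_mult component_jw component_simps(6) t_def k_def)
  qed
  have "(?C \<odot> tl_cup k k) \<odot> r \<odot> (tl_cap k k \<odot> ?K) \<odot> ?p = ?C \<odot> (tl_cup k k \<odot> r) \<odot> tl_cap k k \<odot> ?K \<odot> ?p"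
    by (simp only: comp_assoc[OF h(2) H(2) component_Hom] comp_assoc[OF H(1) h(1) comp_Hom[OF r comp_Hom[OF h(2) comp_Hom[OF H(2) component_Hom]]]]
        comp_assoc[OF h(1) r comp_Hom[OF h(2) comp_Hom[OF H(2) component_Hom]]])
  also have "(tl_cup k k \<odot> r) \<odot> tl_cap k k \<odot> ?K \<odot> ?p = Z \<odot> ?K \<odot> ?p"
  proof -
    have r2: "r \<otimes> id_tl 2 \<in> Hom (Suc i) (Suc i)" unfolding rt by simp
    have t: "tl_cup k k \<odot> tl_cap k k = (tl_gen k (Suc i) :: 'k tl)" unfolding k(2)[symmetric] by (rule tl_gen_comp[symmetric]) simp
    show ?thesis
      unfolding slide_cup[OF r] Z_def t[symmetric] 
      by (simp only: comp_assoc[OF r2 h(1) comp_Hom[OF h(2) comp_Hom[OF H(2) component_Hom]]]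
         comp_assoc[OF r2 comp_Hom[OF h] comp_Hom[OF H(2) component_Hom]] comp_assoc[OF h comp_Hom[OF H(2) component_Hom]])
  qed
  finally have inner: "(?C \<odot> tl_cup k k) \<odot> r \<odot> (tl_cap k k \<odot> ?K) \<odot> ?p = (?C \<odot> Z \<odot> ?K) \<odot> ?p"
    unfolding assoc[OF H(1) Z H(2)] .
  have a: "(N - 1) div 2 = b + 1" "b + 1 - 1 = b" by (simp_all add: N_def)
  show "B N = (- (of_nat b / of_nat (b + 1))) \<cdot>
      component (P * w * jw_rec scalar_endo (gen_endo N) (b - 1) * t * x * w * P) N"
    unfolding B_def Let_def E Er c2 p inner sandwich(3)[OF Z] Z2 a
    by (simp only: flip: component_mult) (simp only: mult.assoc)
qed

end

section \<open>Passage to the completion and to the quotient\<close>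

lemma single_mat_comp: "mat_comp (single_mat g) [n] (single_mat f) = single_mat (g \<odot> f)"
  by (intro ext) (simp add: mat_comp_def single_mat_def)

lemma tensor_single_mat: "tensor_mat 1 1 (single_mat f) (single_mat g) = (single_mat (f \<otimes> g) :: 'k tlmat)"
  by (intro ext) (simp add: tensor_mat_def single_mat_def)

lemma T_tensor: "T m \<otimes>\<^sub>T T n = ([m + n], single_mat (E m \<otimes> E n))"
  using tensor_single_mat[of "E m" "E n"] by (simp add: tensor_obj_def T_def tensor_list_def)

lemma braid_single_mat: "braid_mat s [m] [n] = single_mat (braid s m n)"
  by (intro ext) (simp add: braid_mat_def single_mat_def)

lemma double_braiding_T:
  "double_braiding s (T m) (T n) = single_mat
     (((E m \<otimes> E n) \<odot> braid s n m \<odot> (E n \<otimes> E m)) \<odot> ((E n \<otimes> E m) \<odot> braid s m n \<odot> (E m \<otimes> E n)))"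
proof -
  have "fst (T m) = [m]" "fst (T n) = [n]" by (simp_all add: T_def)
  then show ?thesis
    by (simp add: double_braiding_def TBraid_def TComp_def T_tensor braid_single_mat single_mat_comp)
qed

text \<open>The difference is the zero morphism, which factors through the generator of the
  ideal.\<close>

lemma eq_mod_J_refl: "eq_mod_J p X Z f f"
proof -
  have z: "mat_comp M ns (\<lambda>_ _. 0) = (\<lambda>_ _. 0)" "mat_comp (\<lambda>_ _. 0) ns M = (\<lambda>_ _. 0)" for M ns
    by (simp_all add: mat_comp_def)
  have "(\<lambda>_ _. 0) \<in> THom X Z" for X Z by (simp add: THom_def mats_def z)
  then show ?thesis unfolding eq_mod_J_def factors_through_J_def
    by (intro bexI[OF _ generator] bexI[of _ "\<lambda>_ _. 0"]) (auto simp: TComp_def z)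
qed

lemma single_mat_diff: "(\<lambda>i j. single_mat f i j - single_mat g i j) = single_mat (f - g)"
  by (intro ext) (simp add: single_mat_def)

lemma single_mat_Hom: "f \<in> Hom m n \<Longrightarrow> single_mat f \<in> mats [m] [n]"
  by (auto simp: mats_def single_mat_def)

text \<open>The difference factors as \<open>e\<close> after \<open>c \<cdot> e\<close> through the
  generator, whose identity is \<open>e\<close>; absorption of \<open>d\<close> makes both factors
  morphisms of the completion.\<close>

lemma eq_mod_J_single_mat:
  assumes e: "E (2 * p - 1) = e" "e \<in> Hom n n" "e \<odot> e = e" "d \<odot> e = e" "e \<odot> d = e" and n: "n = 2 * p - 1"
    and diff: "f - g = c \<cdot> e"
  shows "eq_mod_J p ([n], single_mat d) ([n], single_mat d) (single_mat f) (single_mat g)"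
proof -
  have T: "T (2 * p - 1) = ([n], single_mat e)" unfolding T_def n e(1) ..
  have "single_mat (c \<cdot> e) \<in> THom ([n], single_mat d) (T (2 * p - 1))"
    "single_mat e \<in> THom (T (2 * p - 1)) ([n], single_mat d)"
    unfolding T by (simp_all add: THom_def single_mat_comp single_mat_Hom comp_linear e)
  moreover have "single_mat (c \<cdot> e) = TComp (single_mat e) (T (2 * p - 1)) (single_mat (c \<cdot> e))"
    unfolding T TComp_def by (simp add: single_mat_comp comp_linear e)
  ultimately show ?thesis unfolding eq_mod_J_def factors_through_J_def single_mat_diff diff
    using generator[of p] by blast
qed

end

section \<open>The braiding in terms of the generators\<close>

locale TL_root = TL_zero \<zeta> for \<zeta> :: "'k::field" +
  fixes s :: 'k
  assumes s_sq: "s ^ 2 = \<zeta>" and \<zeta>_sq: "\<zeta> ^ 2 = - 1"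
begin

lemma tl_braid_gen_endo: "tl_braid (gen_endo N) (scalar_endo :: 'k \<Rightarrow> _) (N - 1) s \<zeta>"
  by (intro tl_braid.intro tl_relations_gen_endo tl_braid_axioms.intro s_sq \<zeta>_sq)

lemma crossing_Hom: "crossing s \<in> Hom 2 2"
  and id_crossing_id: "id_tl i \<otimes> crossing s \<otimes> id_tl k =
    component (tl_braid.sigma (gen_endo (i + 2 + k)) scalar_endo s i) (i + 2 + k)"
proof -
  have "cup \<odot> cap = (tl_gen 0 2 :: 'k tl)" using tl_gen_comp[of 0 0] by (simp add: cup_eq cap_eq numeral_2_eq_2)
  then have c: "crossing s = s \<cdot> id_tl 2 + inverse s \<cdot> tl_gen 0 2" by (simp add: crossing_def)
  then show "crossing s \<in> Hom 2 2" by simp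
  interpret R: tl_braid "gen_endo (i + 2 + k)" "scalar_endo :: 'k \<Rightarrow> _" "i + 2 + k - 1" s \<zeta> by (rule tl_braid_gen_endo)
  have "tl_gen 0 2 \<otimes> id_tl k = (tl_gen 0 (2 + k) :: 'k tl)" by (rule tl_gen_tensor_id) simp
  moreover have "id_tl i \<otimes> tl_gen 0 (2 + k) = (tl_gen (i + 0) (i + (2 + k)) :: 'k tl)" by (rule id_tensor_tl_gen) simp
  ultimately show "id_tl i \<otimes> crossing s \<otimes> id_tl k = component (R.sigma i) (i + 2 + k)"
    unfolding c R.sigma_def
    by (simp add: tensor_linear id_tensor_id component_simps(1,7) component_scalar component_simps(6) add.assoc
        del: add_2_eq_Suc add_2_eq_Suc')
qed

text \<open>The \<open>k\<close> extra strands on the right make the statement inductive, since each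
  step of the recursion adds one strand on that side.\<close>

lemma braid_one_eq:
  "braid_one s n \<otimes> id_tl k = component (tl_braid.braid_down (gen_endo (n + 1 + k)) scalar_endo s n) (n + 1 + k)"
proof (induction n arbitrary: k)
  case 0
  interpret R: tl_braid "gen_endo (0 + 1 + k)" "scalar_endo :: 'k \<Rightarrow> _" "0 + 1 + k - 1" s \<zeta> by (rule tl_braid_gen_endo)
  show ?case unfolding R.braid_down.simps by (simp add: id_tensor_id component_simps)
next
  case (Suc n)
  let ?N = "n + 2 + k"
  interpret R: tl_braid "gen_endo ?N" "scalar_endo :: 'k \<Rightarrow> _" "?N - 1" s \<zeta> by (rule tl_braid_gen_endo)
  have H0: "braid_one s n \<in> Hom (n + 1) (n + 1)" using Suc[of 0] by (simp add: tensor_id_0)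
  have H: "id_tl n \<otimes> crossing s \<in> Hom (n + 2) (n + 2)" "braid_one s n \<otimes> id_tl 1 \<in> Hom (n + 2) (n + 2)"
    using tensor_Hom[OF id_tl_Hom crossing_Hom] tensor_Hom[OF H0 id_tl_Hom[of 1]] by (simp_all add: add.assoc)
  have "braid_one s (Suc n) \<otimes> id_tl k = ((id_tl n \<otimes> crossing s) \<otimes> id_tl k) \<odot> ((braid_one s n \<otimes> id_tl 1) \<otimes> id_tl k)"
    by (simp only: braid_one.simps tensor_id_comp(1)[OF H])
  also have "\<dots> = (id_tl n \<otimes> crossing s \<otimes> id_tl k) \<odot> (braid_one s n \<otimes> id_tl (1 + k))"
    by (simp only: tensor_assoc[OF id_tl_Hom crossing_Hom] tensor_assoc[OF H0 id_tl_Hom] id_tensor_id)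
  also have "\<dots> = component (R.sigma n) ?N \<odot> component (R.braid_down n) ?N"
    using Suc[of "1 + k"] id_crossing_id[of n k] by (simp add: add.assoc)
  also have "\<dots> = component (R.braid_down (Suc n)) ?N" by (simp only: component_mult R.braid_down.simps)
  finally show ?case by (simp del: braid_one.simps)
qed

lemma braid_right_eq:
  "braid s n 1 \<otimes> id_tl k = component (tl_braid.braid_up (gen_endo (n + 1 + k)) scalar_endo s n) (n + 1 + k)"
proof (induction n arbitrary: k)
  case 0
  interpret R: tl_braid "gen_endo (0 + 1 + k)" "scalar_endo :: 'k \<Rightarrow> _" "0 + 1 + k - 1" s \<zeta> by (rule tl_braid_gen_endo)
  show ?case unfolding R.braid_up.simps by (simp add: id_tensor_id component_simps)
next
  case (Suc n)
  let ?N = "n + 2 + k"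
  interpret R: tl_braid "gen_endo ?N" "scalar_endo :: 'k \<Rightarrow> _" "?N - 1" s \<zeta> by (rule tl_braid_gen_endo)
  have H0: "braid s n 1 \<in> Hom (n + 1) (n + 1)" using Suc[of 0] by (simp add: tensor_id_0)
  have H: "id_tl n \<otimes> crossing s \<in> Hom (n + 2) (n + 2)" "braid s n 1 \<otimes> id_tl 1 \<in> Hom (n + 2) (n + 2)"
    using tensor_Hom[OF id_tl_Hom crossing_Hom] tensor_Hom[OF H0 id_tl_Hom[of 1]] by (simp_all add: add.assoc)
  have "braid_one s 1 = crossing s \<odot> id_tl 2"
    by (simp add: tensor_id_0 id_tensor_id numeral_2_eq_2)
  then have b1: "braid_one s 1 = crossing s" by (simp add: comp_id(2)[OF crossing_Hom])
  have "braid s (Suc n) 1 \<otimes> id_tl k = ((braid s n 1 \<otimes> id_tl 1) \<otimes> id_tl k) \<odot> ((id_tl n \<otimes> crossing s) \<otimes> id_tl k)"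
    by (simp only: braid.simps b1 tensor_id_comp(1)[OF H(2,1)])
  also have "\<dots> = (braid s n 1 \<otimes> id_tl (1 + k)) \<odot> (id_tl n \<otimes> crossing s \<otimes> id_tl k)"
    by (simp only: tensor_assoc[OF id_tl_Hom crossing_Hom] tensor_assoc[OF H0 id_tl_Hom] id_tensor_id)
  also have "\<dots> = component (R.braid_up n) ?N \<odot> component (R.sigma n) ?N"
    using Suc[of "1 + k"] id_crossing_id[of n k] by (simp add: add.assoc)
  also have "\<dots> = component (R.braid_up (Suc n)) ?N" by (simp only: component_mult R.braid_up.simps)
  finally show ?case by (simp del: braid.simps)
qed

lemma braid_left_eq: "braid s 1 n = braid_one s n"
proof -
  have "braid_one s n \<in> Hom (n + 1) (n + 1)" using braid_one_eq[of n 0] by (simp add: tensor_id_0)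
  then show ?thesis using comp_id(1) by (simp add: tensor_id_0 id_tensor_id)
qed

text \<open>For both parities of \<open>n\<close> the object is cut out by the same idempotent,
  because \<open>E\<close> on an even number of strands only adds a free strand.\<close>

lemma double_braiding_component:
  assumes nz: "\<And>j. 0 < j \<Longrightarrow> j \<le> b \<Longrightarrow> of_nat j \<noteq> (0 :: 'k)" and n: "n = 2 * b + 1 \<or> n = 2 * b + 2"
  defines "N \<equiv> n + 1"
  shows "E n \<otimes> E 1 = jw_tl b N"
    and "double_braiding s (T n) (T 1) = single_mat (component (jw_rec scalar_endo (gen_endo N) b *
      tl_braid.jucys_murphy (gen_endo N) scalar_endo s n * jw_rec scalar_endo (gen_endo N) b) N)"
proof -
  interpret R: tl_braid "gen_endo N" "scalar_endo :: 'k \<Rightarrow> _" "N - 1" s \<zeta> by (rule tl_braid_gen_endo)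
  have E1: "E 1 = id_tl 1" using E_eq(1)[of 0] by (simp add: jw_tl_0)
  have En: "E n = jw_tl b n" using E_eq[OF nz] n by auto
  have bn: "2 * b < n" using n by auto
  show right: "E n \<otimes> E 1 = jw_tl b N" unfolding E1 En N_def by (rule jw_tl_tensor_id[OF bn])
  have left: "E 1 \<otimes> E n = component (jw_rec scalar_endo (\<lambda>i. gen_endo N (Suc i)) b) N"
    unfolding E1 En N_def using id_tensor_jw_tl[OF bn] by (simp add: add.commute)
  have down: "braid s 1 n = component (R.braid_down n) N"
    using braid_one_eq[of n 0] unfolding braid_left_eq by (simp add: N_def tensor_id_0)
  have up: "braid s n 1 = component (R.braid_up n) N"
    using braid_right_eq[of n 0] by (simp add: N_def tensor_id_0)
  have kill: "R.kill_rule b" by (rule kill_rule_gen_endo[OF nz]) (use bn N_def in auto)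
  have sandwich: "(R.P b * (R.braid_down n * jw_rec scalar_endo (\<lambda>i. gen_endo N (Suc i)) b)) *
      (jw_rec scalar_endo (\<lambda>i. gen_endo N (Suc i)) b * (R.braid_up n * R.P b)) = R.P b * R.jucys_murphy n * R.P b"
    by (rule R.double_braid_sandwich[OF kill]) (use bn N_def in auto)
  show "double_braiding s (T n) (T 1) = single_mat (component (R.P b * R.jucys_murphy n * R.P b) N)"
    unfolding double_braiding_T right left down up component_jw[symmetric] component_mult[symmetric] sandwich ..
qed

end

theorem proposition2p6:
  fixes \<zeta> s :: "'k::alg_closed_field" and p a1 a0 v :: nat
  assumes "CHAR('k) = p" and "p > 2"
    and "\<zeta> ^ 4 = 1" and "\<forall>k\<in>{1..<4}. \<zeta> ^ k \<noteq> 1"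
    and "s ^ 2 = \<zeta>"
    and "1 \<le> a1" and "a1 \<le> p - 1" and "a0 \<in> {0, 1}" and "v = 2 * a1 + a0"
  shows
    "(a0 = 0 \<longrightarrow>
        TL.eq_mod_J \<zeta> p (TL.T \<zeta> (v - 1) \<otimes>\<^sub>T TL.T \<zeta> 1) (TL.T \<zeta> (v - 1) \<otimes>\<^sub>T TL.T \<zeta> 1)
          (TL.double_braiding \<zeta> s (TL.T \<zeta> (v - 1)) (TL.T \<zeta> 1))
          (single_mat (\<zeta> ^ (v - 1) \<cdot> TL.E \<zeta> v + (2 * \<zeta> ^ (v - 2)) \<cdot> TL.L \<zeta> v))) \<and>
     (a0 = 1 \<longrightarrow>
        TL.eq_mod_J \<zeta> p (TL.T \<zeta> (v - 1) \<otimes>\<^sub>T TL.T \<zeta> 1) (TL.T \<zeta> (v - 1) \<otimes>\<^sub>T TL.T \<zeta> 1)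
          (TL.double_braiding \<zeta> s (TL.T \<zeta> (v - 1)) (TL.T \<zeta> 1))
          (single_mat
            ((if v = 2 * p - 1 then 0 else \<zeta> ^ (v - 1) \<cdot> TL.E \<zeta> v) +
             \<zeta> ^ (v - 3) \<cdot> TL.A \<zeta> v +
             \<zeta> ^ (v - 3) \<cdot> TL.A_tilde \<zeta> v +
             (2 * \<zeta> ^ (v - 2)) \<cdot> TL.Y \<zeta> v +
             (if v = 3 then 0 else \<zeta> ^ (v - 1) \<cdot> TL.B \<zeta> v))))"
proof -
  have "(\<zeta> ^ 2 - 1) * (\<zeta> ^ 2 + 1) = 0" using assms(3) by (simp add: algebra_simps flip: power_add)
  moreover have "\<zeta> ^ 2 \<noteq> 1" using assms(4) by simp
  ultimately have \<zeta>_sq: "\<zeta> ^ 2 = - 1" by (simp add: eq_neg_iff_add_eq_0)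
  then have "\<zeta> \<noteq> 0" by auto
  then have "\<zeta> + inverse \<zeta> = 0" using \<zeta>_sq by (simp add: field_simps power2_eq_square)
  then interpret TL_root \<zeta> s using assms(5) \<zeta>_sq by unfold_locales auto
  \<comment> \<open>The idempotent of the object is \<open>P b\<close>, on \<open>2 * b + 1\<close>
    strands, and \<open>v\<close> is \<open>2 * b + 2\<close> or \<open>2 * b + 3\<close>.\<close>
  define b where "b = a1 - 1"
  have a1: "a1 = b + 1" using assms(6) by (simp add: b_def)
  \<comment> \<open>Here \<open>a1 \<le> p - 1\<close> enters. The bound \<open>b + 1\<close>, not
    just \<open>b\<close>, is needed for \<open>P (Suc b)\<close> when \<open>v\<close> is
    odd.\<close>
  have nz': "of_nat j \<noteq> (0 :: 'k)" if "0 < j" "j \<le> b + 1" for j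
  proof
    assume "of_nat j = (0 :: 'k)"
    then have "p dvd j" using assms(1) by (simp add: of_nat_eq_0_iff_char_dvd)
    then show False using that assms(2,7) a1 by (auto dest!: dvd_imp_le)
  qed
  then have nz: "of_nat j \<noteq> (0 :: 'k)" if "0 < j" "j \<le> b" for j using that by simp
  show ?thesis
  proof (intro conjI impI)
    assume "a0 = 0"
    then have v: "v = 2 * b + 2" using assms(9) a1 by simp
    interpret R: tl_braid "gen_endo v" "scalar_endo :: 'k \<Rightarrow> _" "v - 1" s \<zeta> by (rule tl_braid_gen_endo)
    have kill: "R.kill_rule b" using kill_rule_gen_endo[of b v] nz v by simp
    have "double_braiding s (T (v - 1)) (T 1) = single_mat (component (R.P b * R.jucys_murphy (2 * b + 1) * R.P b) v)"
      using double_braiding_component(2)[OF nz, of b "2 * b + 1"] by (simp add: v)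
    also have "component (R.P b * R.jucys_murphy (2 * b + 1) * R.P b) v = \<zeta> ^ (v - 1) \<cdot> E v + (2 * \<zeta> ^ (v - 2)) \<cdot> L v"
    proof -
      have M: "2 * b < v - 1" and e: "v - 1 = 2 * b + 1" "v - 2 = 2 * b" by (simp_all add: v)
      have "E v = component (R.P b) v" "L v = component (R.P b * gen_endo v (2 * b) * R.P b) v"
        using E_eq(2)[OF nz, of b] L_eq[OF nz, of b] by (simp_all add: v component_jw)
      then show ?thesis unfolding R.double_braid_even[OF kill M] component_simps(1) component_scalar e by simp
    qed
    finally show "eq_mod_J p (T (v - 1) \<otimes>\<^sub>T T 1) (T (v - 1) \<otimes>\<^sub>T T 1) (double_braiding s (T (v - 1)) (T 1))
        (single_mat (\<zeta> ^ (v - 1) \<cdot> E v + (2 * \<zeta> ^ (v - 2)) \<cdot> L v))"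
      by (simp add: eq_mod_J_refl)
  next
    assume "a0 = 1"
    then have v: "v = 2 * b + 3" using assms(9) a1 by simp
    interpret R: tl_braid "gen_endo v" "scalar_endo :: 'k \<Rightarrow> _" "v - 1" s \<zeta> by (rule tl_braid_gen_endo)
    have kill: "R.kill_rule b" "R.kill_rule (Suc b)"
      using kill_rule_gen_endo[of b v] kill_rule_gen_endo[of "Suc b" v] nz' v by simp_all
    have kill': "R.kill_rule (b - 1)"
      by (rule kill_rule_gen_endo) (use nz' in \<open>auto simp: v\<close>)
    define w x t :: "'k tl_endo" where "w = gen_endo v (2 * b)" "x = gen_endo v (2 * b + 1)" "t = gen_endo v (2 * b - 1)"
    have PP: "R.P b * R.P b = R.P b" using kill by (simp add: R.kill_rule_def)
    have Px: "R.P b * x = x * R.P b" unfolding w_x_t_def by (rule R.P_comm) simp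
    have Av: "A v = component (R.P b * w * x * R.P b) v"
    proof -
      have "R.P b * w * R.P b * x * R.P b = R.P b * w * x * R.P b" using Px PP by (metis mult.assoc)
      then show ?thesis using A_eq[OF nz, of b] by (simp add: v w_x_t_def)
    qed
    have A'v: "A_tilde v = component (R.P b * x * w * R.P b) v"
      using A_tilde_eq[OF nz, of b] PP by (simp add: v w_x_t_def)
    have Yv: "Y v = component (R.P b * w * R.P b) v"
      using Y_eq[OF nz, of b] R.jw_middle[OF kill(1) kill'] by (simp add: v w_x_t_def)
    have Bv: "(if v = 3 then 0 else \<zeta> ^ (v - 1) \<cdot> B v) =
        \<zeta> ^ (v - 1) \<cdot> (- (of_nat b / of_nat (b + 1))) \<cdot> component (R.P b * w * t * x * w * R.P b) v"
    proof (cases "b = 0")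
      \<comment> \<open>This is \<open>v = 3\<close>: the coefficient \<open>b / (b + 1)\<close> is
        0, in agreement with the omission of the term.\<close>
      case True
      then show ?thesis by (simp add: v scale_simps)
    next
      case False
      \<comment> \<open>The smaller idempotent in the middle of \<open>B\<close> commutes with
        \<open>w\<close> and is absorbed by the outer one.\<close>
      have "R.P b * R.P (b - 1) = R.P b" using R.P_absorb_right[OF kill'] False by simp
      moreover have "R.P (b - 1) * w = w * R.P (b - 1)" unfolding w_x_t_def by (rule R.P_comm) (use False in simp)
      ultimately have "R.P b * w * R.P (b - 1) = R.P b * w" by (metis mult.assoc)
      then show ?thesis using B_eq[OF nz False] False by (simp add: v w_x_t_def)
    qed
    have Ev: "E v = component (R.P (Suc b)) v"
      using E_eq(1)[OF nz', of "Suc b"] by (simp add: v component_jw numeral_3_eq_3)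
    define X where "X = \<zeta> ^ (v - 3) \<cdot> A v + \<zeta> ^ (v - 3) \<cdot> A_tilde v + (2 * \<zeta> ^ (v - 2)) \<cdot> Y v +
        (if v = 3 then 0 else \<zeta> ^ (v - 1) \<cdot> B v)"
    have e: "v - 1 = 2 * b + 2" "v - 2 = 2 * b + 1" "v - 3 = 2 * b" by (simp_all add: v)
    have "double_braiding s (T (v - 1)) (T 1) = single_mat (component (R.P b * R.jucys_murphy (2 * b + 2) * R.P b) v)"
      using double_braiding_component(2)[OF nz, of b "2 * b + 2"] by (simp add: v numeral_3_eq_3)
    also have "component (R.P b * R.jucys_murphy (2 * b + 2) * R.P b) v = \<zeta> ^ (v - 1) \<cdot> E v + X"
    proof -
      have M: "2 * b + 1 < v - 1" by (simp add: v)
      show ?thesis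
        unfolding R.double_braid_odd[OF kill(1) M] component_simps(1) component_scalar X_def Bv
        unfolding Av A'v Yv Ev e w_x_t_def by (simp only: add_ac)
    qed
    finally have db: "double_braiding s (T (v - 1)) (T 1) = single_mat (\<zeta> ^ (v - 1) \<cdot> E v + X)" .
    have obj: "T (v - 1) \<otimes>\<^sub>T T 1 = ([v], single_mat (component (R.P b) v))"
      using double_braiding_component(1)[OF nz, of b "2 * b + 2"] unfolding T_tensor
      by (simp add: v component_jw numeral_3_eq_3)
    have "eq_mod_J p (T (v - 1) \<otimes>\<^sub>T T 1) (T (v - 1) \<otimes>\<^sub>T T 1) (double_braiding s (T (v - 1)) (T 1))
        (single_mat ((if v = 2 * p - 1 then 0 else \<zeta> ^ (v - 1) \<cdot> E v) + X))"
    proof (cases "v = 2 * p - 1")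
      \<comment> \<open>The two sides differ by a multiple of \<open>E v\<close>, which is now the
        identity of the generating object of the ideal.\<close>
      case True
      show ?thesis unfolding obj db
      proof (rule eq_mod_J_single_mat)
        show "E (2 * p - 1) = component (R.P (Suc b)) v" using Ev True by simp
        show "component (R.P (Suc b)) v \<odot> component (R.P (Suc b)) v = component (R.P (Suc b)) v"
          unfolding component_mult[symmetric] using kill(2) by (simp add: R.kill_rule_def)
        show "component (R.P b) v \<odot> component (R.P (Suc b)) v = component (R.P (Suc b)) v"
          unfolding component_mult[symmetric] R.P_absorb_left[OF kill(1)] ..
        show "component (R.P (Suc b)) v \<odot> component (R.P b) v = component (R.P (Suc b)) v"
          unfolding component_mult[symmetric] R.P_absorb_right[OF kill(1)] ..
        show "\<zeta> ^ (v - 1) \<cdot> E v + X - ((if v = 2 * p - 1 then 0 else \<zeta> ^ (v - 1) \<cdot> E v) + X) =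
            \<zeta> ^ (v - 1) \<cdot> component (R.P (Suc b)) v" unfolding if_P[OF True] Ev by simp
      qed (use True in simp_all)
    next
      case False
      show ?thesis unfolding if_not_P[OF False] db by (rule eq_mod_J_refl)
    qed
    then show "eq_mod_J p (T (v - 1) \<otimes>\<^sub>T T 1) (T (v - 1) \<otimes>\<^sub>T T 1) (double_braiding s (T (v - 1)) (T 1))
        (single_mat ((if v = 2 * p - 1 then 0 else \<zeta> ^ (v - 1) \<cdot> E v) + \<zeta> ^ (v - 3) \<cdot> A v +
          \<zeta> ^ (v - 3) \<cdot> A_tilde v + (2 * \<zeta> ^ (v - 2)) \<cdot> Y v + (if v = 3 then 0 else \<zeta> ^ (v - 1) \<cdot> B v)))"
      by (simp only: X_def add.assoc)
  qed
qed

end
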